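(* Let $X$ be a nonempty totally disconnected compact metrizable space and $\sigma:X\to X$ a surjective local homeomorphism. Then there exists an inverse system $\{(X_n,\sigma_n),\psi_{n,m}\}$ in $\mathsf{LHomeo}$ (indexed by $n\ge 0$), consisting of generalized finite shifts $(X_n,\sigma_n)$, such that $$(X,\sigma)\cong\varprojlim(X_n,\sigma_n).$$
   Context: $\mathsf{LHomeo}$ has as objects the pairs $(X,\sigma)$ with $X$ a totally disconnected compact metrizable space and $\sigma:X\to X$ a surjective local homeomorphism, and as morphisms the equivariant continuous maps $\psi:(X,\sigma)\to(Y,\rho)$ (i.e. $\psi\circ\sigma=\rho\circ\psi$). In an inverse system, $\psi_{n,m}:X_m\to X_n$ for $n\le m$ are such morphisms with the usual compatibility; $\varprojlim(X_n,\sigma_n)$ is the inverse limit of the spaces $X_n$ with the induced coordinatewise map, and $\cong$ means a homeomorphism intertwining the maps. **Separated graphs.** A directed graph $E=(E^0,E^1,r,s)$ has vertices $E^0$, edges $E^1$, range and source maps $r,s$. A separated graph $(E,C)$ has in addition $C=\bigsqcup_{v}C_v$, $C_v$ a partition of $r^{-1}(v)$ into nonempty subsets. It is bipartite if $E^0=E^{0,0}\sqcup E^{0,1}$ with $s(E^1)=E^{0,1}$, $r(E^1)=E^{0,0}$. **Generalized finite shift graph.** A finite bipartite separated graph $(E,C)$ such that (a) $C_v=\{B_v,R_v\}$ with $B_v,R_v$ nonempty, for each $v\in E^{0,0}$ (elements of $B_v$ are blue edges, elements of $R_v$ red edges); (b) $E^{0,1}=\bigsqcup_{v\in E^{0,0}}s(B_v)$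 and $E^{0,1}=\bigcup_{v\in E^{0,0}}s(R_v)$, and distinct edges of $B_v$ have distinct sources for all $v\in E^{0,0}$. **Canonical resolution.** For a finite bipartite separated graph $(E,C)$ with $C_u=\{X_1^u,\dots,X_{k_u}^u\}$ for $u\in E^{0,0}$, the 1-step resolution $(E_1,C^1)$ has $E_1^{0,0}=E^{0,1}$, $E_1^{0,1}=\{v(x_1,\dots,x_{k_u})\mid u\in E^{0,0},x_j\in X_j^u\}$ (formal symbols), edges $\alpha^{x_i}(x_1,\dots,\widehat{x_i},\dots,x_{k_u})$ ($u\in E^{0,0}$, $1\le i\le k_u$, $x_j\in X^u_j$ for all $j$) with range $s(x_i)$ and source $v(x_1,\dots,x_{k_u})$, and $C^1_v=\{X(x)\mid x\in s^{-1}(v)\}$ for $v\in E_1^{0,0}$, where $X(x_i)=\{\alpha^{x_i}(x_1,\dots,\widehat{x_i},\dots,x_{k_u})\mid x_j\in X_j^u, j\ne i\}$. Put $(E_0,C^0)=(E,C)$ and let $(E_{n+1},C^{n+1})$ be the 1-step resolution of $(E_n,C^n)$. The canonical resolution is $(F,D)=\bigcup_n(E_n,C^n)$, with $F^{0,n}=E_n^{0,0}$, $F^{1,n}=E_n^1$, $D_v=C^n_v$ for $v\in F^{0,n}$. If $(E,C)$ is a generalized finite shift graph, colours are propagated by declaring the edges of $X(x)$ to have the colour of $x$; for a red edge $f$ at an even level write $R(f)=X(f)$. **Generalized finite shift.** Let $(E,C)$ be a generalized finite shift graph with canonical resolution $(F,D)$. Its generalized finite shift $(X,\sigma)\in\mathsf{LHomeo}$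 is defined as follows. $X$ is the set of sequences $(e_0,e_1,\dots)$ of blue edges $e_i\in F^{1,i}$ with $r(e_{i+1})=s(e_i)$, with topology generated by the cylinder sets $Z(e_0,\dots,e_n)$. In $(F,D)$: for blue edges $e_0\in F^{1,2j}$, $e_1$ with $r(e_1)=s(e_0)$ there is a unique red pair $(f_0,f_1)$ with $r(f_0)=r(e_0)$, $r(f_1)=s(f_0)$, $s(f_1)=s(e_1)$, $f_1\in R(f_0)$; for red edges $f_0\in F^{1,2j-1}$ ($j\ge1$), $f_1$ with $r(f_1)=s(f_0)$ there is a unique blue pair $(e_0,e_1)$ with $r(e_0)=r(f_0)$, $r(e_1)=s(e_0)$, $s(e_1)=s(f_1)$. Given $(e_i)\in X$, let $(f_{2j},f_{2j+1})$ be the red pair associated to $(e_{2j},e_{2j+1})$ ($j\ge0$), $(e'_{2j-1},e'_{2j})$ the blue pair associated to $(f_{2j-1},f_{2j})$ ($j\ge1$), and $e_0'$ the unique blue edge with $s(e_0')=r(e_1')$; then $\sigma(e_0,e_1,\dots)=(e_0',e_1',\dots)$. *)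

theory Defs
  imports "HOL-Analysis.Analysis" "HOL-Library.FSet" "HOL-Library.Disjoint_Sets"
begin

section \<open>The category of surjective local homeomorphisms\<close>

definition totally_disconnected_space :: "'a topology \<Rightarrow> bool" where
  "totally_disconnected_space X \<longleftrightarrow>
     (\<forall>S. connectedin X S \<longrightarrow> (\<exists>a. S \<subseteq> {a}))"

definition local_homeomorphism_map :: "'a topology \<Rightarrow> 'b topology \<Rightarrow> ('a \<Rightarrow> 'b) \<Rightarrow> bool" where
  "local_homeomorphism_map X Y f \<longleftrightarrow>
     (\<forall>x\<in>topspace X. \<exists>U. openin X U \<and> x \<in> U \<and> openin Y (f ` U) \<and>
        homeomorphic_map (subtopology X U) (subtopology Y (f ` U)) f)"

definition LHomeo :: "'a topology \<Rightarrow> ('a \<Rightarrow> 'a) \<Rightarrow> bool" where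
  "LHomeo X \<sigma> \<longleftrightarrow>
     totally_disconnected_space X \<and> compact_space X \<and> metrizable_space X \<and>
     local_homeomorphism_map X X \<sigma> \<and> \<sigma> ` topspace X = topspace X"

definition LHomeo_morphism ::
  "'a topology \<Rightarrow> ('a \<Rightarrow> 'a) \<Rightarrow> 'b topology \<Rightarrow> ('b \<Rightarrow> 'b) \<Rightarrow> ('a \<Rightarrow> 'b) \<Rightarrow> bool" where
  "LHomeo_morphism X \<sigma> Y \<rho> \<psi> \<longleftrightarrow>
     continuous_map X Y \<psi> \<and> (\<forall>x\<in>topspace X. \<psi> (\<sigma> x) = \<rho> (\<psi> x))"

definition conjugate_systems ::
  "'a topology \<Rightarrow> ('a \<Rightarrow> 'a) \<Rightarrow> 'b topology \<Rightarrow> ('b \<Rightarrow> 'b) \<Rightarrow> bool" where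
  "conjugate_systems X \<sigma> Y \<rho> \<longleftrightarrow>
     (\<exists>h. homeomorphic_map X Y h \<and> (\<forall>x\<in>topspace X. h (\<sigma> x) = \<rho> (h x)))"

text \<open>The bonding map \<open>\<psi> n m\<close> goes from the \<open>m\<close>-th to the \<open>n\<close>-th space and is relevant only
  for \<open>n \<le> m\<close>.\<close>

definition LHomeo_inverse_system ::
  "(nat \<Rightarrow> 'a topology) \<Rightarrow> (nat \<Rightarrow> 'a \<Rightarrow> 'a) \<Rightarrow> (nat \<Rightarrow> nat \<Rightarrow> 'a \<Rightarrow> 'a) \<Rightarrow> bool" where
  "LHomeo_inverse_system X \<sigma> \<psi> \<longleftrightarrow>
     (\<forall>n. LHomeo (X n) (\<sigma> n)) \<and>
     (\<forall>n m. n \<le> m \<longrightarrow> LHomeo_morphism (X m) (\<sigma> m) (X n) (\<sigma> n) (\<psi> n m)) \<and>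
     (\<forall>n. \<forall>x\<in>topspace (X n). \<psi> n n x = x) \<and>
     (\<forall>n m k. n \<le> m \<longrightarrow> m \<le> k \<longrightarrow> (\<forall>x\<in>topspace (X k). \<psi> n m (\<psi> m k x) = \<psi> n k x))"

definition inverse_limit_space ::
  "(nat \<Rightarrow> 'a topology) \<Rightarrow> (nat \<Rightarrow> nat \<Rightarrow> 'a \<Rightarrow> 'a) \<Rightarrow> (nat \<Rightarrow> 'a) topology" where
  "inverse_limit_space X \<psi> =
     subtopology (product_topology X UNIV) {x. \<forall>n m. n \<le> m \<longrightarrow> \<psi> n m (x m) = x n}"

definition inverse_limit_map :: "(nat \<Rightarrow> 'a \<Rightarrow> 'a) \<Rightarrow> (nat \<Rightarrow> 'a) \<Rightarrow> (nat \<Rightarrow> 'a)" where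
  "inverse_limit_map \<sigma> x = (\<lambda>n. \<sigma> n (x n))"


section \<open>Bipartite separated graphs\<close>

text \<open>\<open>V0 G\<close> and \<open>V1 G\<close> are $E^{0,0}$ (ranges) and $E^{0,1}$ (sources); \<open>classes G v\<close> is the
  set $C_v$ of subsets of $r^{-1}(v)$.\<close>

record ('v, 'e) bisep_graph =
  V0 :: "'v set"
  V1 :: "'v set"
  edges :: "'e set"
  rng :: "'e \<Rightarrow> 'v"
  src :: "'e \<Rightarrow> 'v"
  classes :: "'v \<Rightarrow> 'e set set"

definition finite_bipartite_separated_graph :: "('v, 'e, 'z) bisep_graph_scheme \<Rightarrow> bool" where
  "finite_bipartite_separated_graph G \<longleftrightarrow>
     finite (V0 G) \<and> finite (V1 G) \<and> finite (edges G) \<and>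
     V0 G \<inter> V1 G = {} \<and> src G ` edges G = V1 G \<and> rng G ` edges G = V0 G \<and>
     (\<forall>v \<in> V0 G \<union> V1 G. partition_on {e \<in> edges G. rng G e = v} (classes G v))"

record ('v, 'e) shift_graph = "('v, 'e) bisep_graph" +
  blue :: "'v \<Rightarrow> 'e set"
  red :: "'v \<Rightarrow> 'e set"

definition generalized_finite_shift_graph :: "('v, 'e, 'z) shift_graph_scheme \<Rightarrow> bool" where
  "generalized_finite_shift_graph G \<longleftrightarrow>
     finite_bipartite_separated_graph G \<and>
     (\<forall>v \<in> V0 G. classes G v = {blue G v, red G v} \<and> blue G v \<noteq> red G v \<and>
        blue G v \<noteq> {} \<and> red G v \<noteq> {}) \<and>
     V1 G = (\<Union>v\<in>V0 G. src G ` blue G v) \<and>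
     disjoint_family_on (\<lambda>v. src G ` blue G v) (V0 G) \<and>
     V1 G = (\<Union>v\<in>V0 G. src G ` red G v) \<and>
     (\<forall>v \<in> V0 G. inj_on (src G) (blue G v))"


section \<open>The canonical resolution\<close>

text \<open>The vertices and edges of all levels live in one pair of types. Since the classes
  $X_1,\dots,X_k$ at a vertex are pairwise disjoint, a tuple $(x_1,\dots,x_k)$ with $x_j \in X_j$
  is encoded, without choosing an order of the classes, by the set \<open>T = {x\<^sub>1, \<dots>, x\<^sub>k}\<close>.
  Then \<open>Tuple_vertex T\<close> is the vertex $v(x_1,\dots,x_k)$ and \<open>Alpha x T'\<close> with \<open>T' = T - {x}\<close> is
  the edge $\alpha^{x}(x_1,\dots,\widehat{x},\dots,x_k)$.\<close>

datatype 'e res_edge =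
    Base_edge 'e
  | Alpha "'e res_edge" "'e res_edge fset"

datatype ('v, 'e) res_vertex =
    Base_vertex 'v
  | Tuple_vertex "'e res_edge fset"

type_synonym ('v, 'e) res_graph = "(('v, 'e) res_vertex, 'e res_edge) bisep_graph"

definition choices :: "('v, 'e) res_graph \<Rightarrow> ('v, 'e) res_vertex \<Rightarrow> 'e res_edge fset set" where
  "choices G u =
     {T. fset T \<subseteq> \<Union> (classes G u) \<and> (\<forall>X\<in>classes G u. \<exists>!x. x \<in> X \<and> x |\<in>| T)}"

text \<open>The class \<open>X(x)\<close>, a set of edges of the resolution of \<open>G\<close>, for an edge \<open>x\<close> of \<open>G\<close>.\<close>

definition res_class :: "('v, 'e) res_graph \<Rightarrow> 'e res_edge \<Rightarrow> 'e res_edge set" where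
  "res_class G x = {Alpha x (T |-| {|x|}) | T. T \<in> choices G (rng G x) \<and> x |\<in>| T}"

definition one_step_resolution :: "('v, 'e) res_graph \<Rightarrow> ('v, 'e) res_graph" where
  "one_step_resolution G =
     \<lparr> V0 = V1 G,
       V1 = {Tuple_vertex T | u T. u \<in> V0 G \<and> T \<in> choices G u},
       edges = {Alpha x (T |-| {|x|}) | u x T. u \<in> V0 G \<and> T \<in> choices G u \<and> x |\<in>| T},
       rng = (\<lambda>e. case e of Base_edge _ \<Rightarrow> undefined | Alpha x T' \<Rightarrow> src G x),
       src = (\<lambda>e. case e of Base_edge _ \<Rightarrow> undefined
                          | Alpha x T' \<Rightarrow> Tuple_vertex (finsert x T')),
       classes = (\<lambda>v. {res_class G x | x. x \<in> edges G \<and> src G x = v}) \<rparr>"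

definition base_level :: "('v, 'e, 'z) bisep_graph_scheme \<Rightarrow> ('v, 'e) res_graph" where
  "base_level G =
     \<lparr> V0 = Base_vertex ` V0 G,
       V1 = Base_vertex ` V1 G,
       edges = Base_edge ` edges G,
       rng = (\<lambda>e. case e of Base_edge a \<Rightarrow> Base_vertex (rng G a) | Alpha x T' \<Rightarrow> undefined),
       src = (\<lambda>e. case e of Base_edge a \<Rightarrow> Base_vertex (src G a) | Alpha x T' \<Rightarrow> undefined),
       classes = (\<lambda>v. case v of Base_vertex a \<Rightarrow> (\<lambda>X. Base_edge ` X) ` classes G a
                              | Tuple_vertex T \<Rightarrow> undefined) \<rparr>"

text \<open>\<open>level G n\<close> is $(E_n, C^n)$. The canonical resolution $(F,D)$ is the union of the levels; its
  layers are $F^{0,n}$ = \<open>V0 (level G n)\<close> and $F^{1,n}$ = \<open>edges (level G n)\<close>. The edge sets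
  of different levels are disjoint, because edges of level \<open>n\<close> are nested to depth \<open>n\<close>, so the
  range and source maps of $F$ on $F^{1,n}$ are those of \<open>level G n\<close>.\<close>

primrec level :: "('v, 'e, 'z) bisep_graph_scheme \<Rightarrow> nat \<Rightarrow> ('v, 'e) res_graph" where
  "level G 0 = base_level G"
| "level G (Suc n) = one_step_resolution (level G n)"

text \<open>Every edge of \<open>X(x)\<close> inherits the colour of \<open>x\<close>.\<close>

primrec is_blue :: "('v, 'e, 'z) shift_graph_scheme \<Rightarrow> 'e res_edge \<Rightarrow> bool" where
  "is_blue G (Base_edge e) \<longleftrightarrow> e \<in> blue G (rng G e)"
| "is_blue G (Alpha x T') \<longleftrightarrow> is_blue G x"

primrec is_red :: "('v, 'e, 'z) shift_graph_scheme \<Rightarrow> 'e res_edge \<Rightarrow> bool" where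
  "is_red G (Base_edge e) \<longleftrightarrow> e \<in> red G (rng G e)"
| "is_red G (Alpha x T') \<longleftrightarrow> is_red G x"

definition blue_edges :: "('v, 'e, 'z) shift_graph_scheme \<Rightarrow> nat \<Rightarrow> 'e res_edge set" where
  "blue_edges G n = {e \<in> edges (level G n). is_blue G e}"

definition red_edges :: "('v, 'e, 'z) shift_graph_scheme \<Rightarrow> nat \<Rightarrow> 'e res_edge set" where
  "red_edges G n = {e \<in> edges (level G n). is_red G e}"


section \<open>The generalized finite shift of a generalized finite shift graph\<close>

definition gfs_points :: "('v, 'e, 'z) shift_graph_scheme \<Rightarrow> (nat \<Rightarrow> 'e res_edge) set" where
  "gfs_points G =
     {e. \<forall>i. e i \<in> blue_edges G i \<and> rng (level G (Suc i)) (e (Suc i)) = src (level G i) (e i)}"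

text \<open>The cylinder $Z(p_0,\dots,p_n)$; it is empty if $(p_0,\dots,p_n)$ is not an initial segment
  of a point.\<close>

definition gfs_cylinder ::
  "('v, 'e, 'z) shift_graph_scheme \<Rightarrow> nat \<Rightarrow> (nat \<Rightarrow> 'e res_edge) \<Rightarrow> (nat \<Rightarrow> 'e res_edge) set" where
  "gfs_cylinder G n p = {e \<in> gfs_points G. \<forall>i\<le>n. e i = p i}"

definition gfs_space :: "('v, 'e, 'z) shift_graph_scheme \<Rightarrow> (nat \<Rightarrow> 'e res_edge) topology" where
  "gfs_space G = topology_generated_by {gfs_cylinder G n p | n p. True}"

text \<open>In \<open>red_pair G n e0 e1\<close> the level \<open>n\<close> of \<open>e0\<close> is even, in \<open>blue_pair G n f0 f1\<close> the level
  \<open>n\<close> of \<open>f0\<close> is odd.\<close>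

definition red_pair ::
  "('v, 'e, 'z) shift_graph_scheme \<Rightarrow> nat \<Rightarrow> 'e res_edge \<Rightarrow> 'e res_edge \<Rightarrow>
     'e res_edge \<times> 'e res_edge" where
  "red_pair G n e0 e1 =
     (THE (f0, f1). f0 \<in> red_edges G n \<and> f1 \<in> red_edges G (Suc n) \<and>
        rng (level G n) f0 = rng (level G n) e0 \<and>
        rng (level G (Suc n)) f1 = src (level G n) f0 \<and>
        src (level G (Suc n)) f1 = src (level G (Suc n)) e1 \<and>
        f1 \<in> res_class (level G n) f0)"

definition blue_pair ::
  "('v, 'e, 'z) shift_graph_scheme \<Rightarrow> nat \<Rightarrow> 'e res_edge \<Rightarrow> 'e res_edge \<Rightarrow>
     'e res_edge \<times> 'e res_edge" where
  "blue_pair G n f0 f1 =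
     (THE (e0, e1). e0 \<in> blue_edges G n \<and> e1 \<in> blue_edges G (Suc n) \<and>
        rng (level G n) e0 = rng (level G n) f0 \<and>
        rng (level G (Suc n)) e1 = src (level G n) e0 \<and>
        src (level G (Suc n)) e1 = src (level G (Suc n)) f1)"

definition red_sequence ::
  "('v, 'e, 'z) shift_graph_scheme \<Rightarrow> (nat \<Rightarrow> 'e res_edge) \<Rightarrow> nat \<Rightarrow> 'e res_edge" where
  "red_sequence G e i =
     (if even i then fst (red_pair G i (e i) (e (Suc i)))
      else snd (red_pair G (i - 1) (e (i - 1)) (e i)))"

text \<open>For \<open>i \<ge> 1\<close> this is the edge $e'_i$.\<close>

definition blue_sequence ::
  "('v, 'e, 'z) shift_graph_scheme \<Rightarrow> (nat \<Rightarrow> 'e res_edge) \<Rightarrow> nat \<Rightarrow> 'e res_edge" where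
  "blue_sequence G f i =
     (if odd i then fst (blue_pair G i (f i) (f (Suc i)))
      else snd (blue_pair G (i - 1) (f (i - 1)) (f i)))"

definition gfs_map ::
  "('v, 'e, 'z) shift_graph_scheme \<Rightarrow> (nat \<Rightarrow> 'e res_edge) \<Rightarrow> (nat \<Rightarrow> 'e res_edge)" where
  "gfs_map G e =
     (let e' = blue_sequence G (red_sequence G e)
      in (\<lambda>i. if i = 0
               then (THE a. a \<in> blue_edges G 0 \<and> src (level G 0) a = rng (level G 1) (e' 1))
               else e' i))"

end

theory Submission
  imports Defs
begin

text \<open>A generalized finite shift graph \<open>G\<close> describes a map \<open>\<rho>\<close> on a space \<open>Y\<close> by finitely many pieces. Each
  point \<open>y\<close> gets a blue edge \<open>a y\<close> and a red edge \<open>c y\<close> with the same range, and \<open>\<rho>\<close> maps the piece of a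
  red edge \<open>k\<close> bijectively onto the set of points whose blue edge has the source of \<open>k\<close>; this is a
  \<open>labelling\<close>. The shift of \<open>G\<close> is the universal space with such a labelling. Indeed, a labelling by an
  even level of the resolution induces one two levels up (\<open>labelling_next\<close>): the labels of \<open>y\<close> and of
  all points over \<open>y\<close> form a tuple, which is the source of the new blue label of \<open>y\<close>, and the tuple of
  \<open>\<rho> y\<close> is the source of the new red label. The blue labels at all levels form
  a point of the shift, and this gives an equivariant map from \<open>Y\<close> to the shift
  (\<open>label_point_equivariant\<close>, \<open>label_point_morphism\<close>). The shift itself carries a canonical labelling for
  which this map is the identity (\<open>canonical_labelling\<close>, \<open>canonical_label_point\<close>).

  Given \<open>(X, \<sigma>)\<close>, a finite clopen partition \<open>q\<close> on whose pieces \<open>\<sigma>\<close> is injective yields a graph and a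
  labelling of \<open>X\<close>: the blue label of \<open>x\<close> is the pair of \<open>q x\<close> and the set of values of \<open>q\<close> on the
  fibre over \<open>x\<close>, the red label is \<open>q x\<close> together with the blue label of \<open>\<sigma> x\<close>
  (\<open>labelling_partition_graph\<close>). The next partition is chosen so fine that its pieces determine both
  labels obtained from the preceding one, and in the end the partitions separate points. The
  labelling of \<open>X\<close> by an earlier graph then factors through the vertices of a later one, and it
  can be transferred to the shift of the later graph (\<open>labelling_transfer\<close>). By universality this
  defines the bonding maps, and likewise the maps from \<open>X\<close> to all shifts.

  A single shift is larger than the image of \<open>X\<close>, since in the resolution all combinations of
  labels occur. The excess vanishes in the limit: the range vertex of a point at level \<open>2 * j\<close> for
  one stage determines both labels at level \<open>2 * j\<close> for the preceding stage
  (\<open>next_labels_determined\<close>), hence the range vertex at level \<open>2 * (j + 1)\<close> for that stage. So the first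
  vertex of a point at stage \<open>n + j + 1\<close> determines coordinate \<open>2 * j\<close> of its image at stage \<open>n\<close>
  (\<open>vertex_determines_bond\<close>). All these vertices occur in \<open>X\<close>, so a point of the limit amounts to a
  decreasing sequence of nonempty clopen pieces of \<open>X\<close>, which has exactly one common point.\<close>

section \<open>Even levels of the canonical resolution\<close>

lemma level_Suc_simps [simp]:
  "V0 (level G (Suc n)) = V1 (level G n)"
  "rng (level G (Suc n)) (Alpha x T) = src (level G n) x"
  "src (level G (Suc n)) (Alpha x T) = Tuple_vertex (finsert x T)"
  "classes (level G (Suc n)) v = {res_class (level G n) x | x. x \<in> edges (level G n) \<and> src (level G n) x = v}"
  by (auto simp: one_step_resolution_def)

lemma edges_level_Suc:
  "edges (level G (Suc n)) = {Alpha x (T |-| {|x|}) | u x T.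
     u \<in> V0 (level G n) \<and> T \<in> choices (level G n) u \<and> x |\<in>| T}"
  by (simp add: one_step_resolution_def)

lemma V1_level_Suc:
  "V1 (level G (Suc n)) = {Tuple_vertex T | u T. u \<in> V0 (level G n) \<and> T \<in> choices (level G n) u}"
  by (simp add: one_step_resolution_def)

lemmas [simp del] = level.simps(2)

lemma pair_eq: "{|a, b|} = {|c, d|} \<longleftrightarrow> a = c \<and> b = d \<or> a = d \<and> b = c"
proof -
  have "{|a, b|} = {|c, d|} \<longleftrightarrow> {a, b} = {c, d}"
    by (metis bot_fset.rep_eq finsert.rep_eq fset_inject)
  then show ?thesis by (simp add: doubleton_eq_iff)
qed

text \<open>At an even level a range vertex has one class of either colour, so its tuples are exactly the
  pairs of mates.\<close>

definition mate :: "('v, 'e, 'z) shift_graph_scheme \<Rightarrow> nat \<Rightarrow> 'e res_edge \<Rightarrow> 'e res_edge \<Rightarrow> bool" where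
  "mate G n x y \<longleftrightarrow> x \<in> edges (level G n) \<and> y \<in> edges (level G n) \<and>
     rng (level G n) x = rng (level G n) y \<and> is_blue G x \<noteq> is_blue G y"

lemma mate_sym: "mate G n x y \<Longrightarrow> mate G n y x"
  by (auto simp: mate_def)

lemma mate_neq: "mate G n x y \<Longrightarrow> x \<noteq> y"
  by (auto simp: mate_def)

text \<open>The part of the definition of a generalized finite shift graph that survives two steps of
  resolution. One step destroys it: at an odd level a vertex carries one red class for each red
  edge of the preceding level whose source it is.\<close>

locale even_level =
  fixes G :: "('v, 'e, 'z) shift_graph_scheme" and n :: nat
  assumes finite_edges: "finite (edges (level G n))"
    and red_iff: "x \<in> edges (level G n) \<Longrightarrow> is_red G x \<longleftrightarrow> \<not> is_blue G x"
    and rng_in: "x \<in> edges (level G n) \<Longrightarrow> rng (level G n) x \<in> V0 (level G n)"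
    and classes_V0: "u \<in> V0 (level G n) \<Longrightarrow> classes (level G n) u =
          {{e \<in> blue_edges G n. rng (level G n) e = u}, {e \<in> red_edges G n. rng (level G n) e = u}}"
    and blue_ex: "u \<in> V0 (level G n) \<Longrightarrow> \<exists>e\<in>blue_edges G n. rng (level G n) e = u"
    and red_ex: "u \<in> V0 (level G n) \<Longrightarrow> \<exists>e\<in>red_edges G n. rng (level G n) e = u"
    and src_blue_inj: "inj_on (src (level G n)) (blue_edges G n)"
    and src_blue: "src (level G n) ` blue_edges G n = V1 (level G n)"
    and src_red: "src (level G n) ` red_edges G n = V1 (level G n)"
begin

lemma blue_iff: "x \<in> blue_edges G n \<longleftrightarrow> x \<in> edges (level G n) \<and> is_blue G x"
  by (simp add: blue_edges_def)

lemma red_edge_iff: "x \<in> red_edges G n \<longleftrightarrow> x \<in> edges (level G n) \<and> \<not> is_blue G x"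
  using red_iff by (auto simp: red_edges_def)

lemma src_in: "x \<in> edges (level G n) \<Longrightarrow> src (level G n) x \<in> V1 (level G n)"
  using src_blue src_red by (metis blue_iff red_edge_iff imageI)

lemma mate_blue_red:
  "x \<in> blue_edges G n \<Longrightarrow> y \<in> red_edges G n \<Longrightarrow> rng (level G n) x = rng (level G n) y \<Longrightarrow> mate G n x y"
  by (auto simp: mate_def blue_iff red_edge_iff)

lemma mate_cases:
  assumes "mate G n x y"
  obtains "x \<in> blue_edges G n" "y \<in> red_edges G n" | "x \<in> red_edges G n" "y \<in> blue_edges G n"
  using assms by (auto simp: mate_def blue_iff red_edge_iff)

lemma mate_ex: "x \<in> edges (level G n) \<Longrightarrow> \<exists>y. mate G n x y"
  using blue_ex[OF rng_in] red_ex[OF rng_in]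
  by (cases "is_blue G x") (force simp: mate_def blue_iff red_edge_iff)+

lemma choices_even:
  assumes u: "u \<in> V0 (level G n)"
  shows "choices (level G n) u = {{|x, y|} | x y. mate G n x y \<and> rng (level G n) x = u}" (is "?L = ?M")
proof (intro equalityI subsetI)
  fix T assume T: "T \<in> ?L"
  let ?B = "{e \<in> blue_edges G n. rng (level G n) e = u}"
  let ?R = "{e \<in> red_edges G n. rng (level G n) e = u}"
  have sub: "fset T \<subseteq> ?B \<union> ?R" and b: "\<exists>!x. x \<in> ?B \<and> x |\<in>| T" and r: "\<exists>!x. x \<in> ?R \<and> x |\<in>| T"
    using T unfolding choices_def classes_V0[OF u] by auto
  obtain x where x: "x \<in> ?B" "x |\<in>| T" "\<And>z. z \<in> ?B \<Longrightarrow> z |\<in>| T \<Longrightarrow> z = x"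
    using b by (metis (lifting))
  obtain y where y: "y \<in> ?R" "y |\<in>| T" "\<And>z. z \<in> ?R \<Longrightarrow> z |\<in>| T \<Longrightarrow> z = y"
    using r by (metis (lifting))
  have "T = {|x, y|}"
  proof (rule fset_eqI)
    fix z show "z |\<in>| T \<longleftrightarrow> z |\<in>| {|x, y|}" using x y sub by blast
  qed
  moreover have "mate G n x y" using x(1) y(1) by (intro mate_blue_red) auto
  ultimately show "T \<in> ?M" using x(1) by blast
next
  fix T assume "T \<in> ?M"
  then obtain x y where xy: "T = {|x, y|}" "mate G n x y" "rng (level G n) x = u" by auto
  then have ru: "rng (level G n) y = u" by (simp add: mate_def)
  show "T \<in> ?L"
    using xy(2)
    by (rule mate_cases)
      (use xy ru in \<open>auto simp: choices_def classes_V0[OF u] blue_iff red_edge_iff\<close>)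
qed

lemma choices_evenE:
  assumes "u \<in> V0 (level G n)" "T \<in> choices (level G n) u" "x |\<in>| T"
  obtains y where "mate G n x y" "rng (level G n) x = u" "T |-| {|x|} = {|y|}" "T = {|x, y|}"
proof -
  obtain a b where ab: "T = {|a, b|}" "mate G n a b" "rng (level G n) a = u"
    using assms(2) unfolding choices_even[OF assms(1)] by auto
  have ne: "a \<noteq> b" and ba: "mate G n b a" and rb: "rng (level G n) b = u"
    using ab mate_neq mate_sym by (auto simp: mate_def)
  consider "x = a" | "x = b" using ab(1) assms(3) by auto
  then show thesis
  proof cases
    case 1
    have "{|a, b|} |-| {|a|} = {|b|}" using ne by auto
    then show thesis using that[of b] ab 1 by simp
  next
    case 2
    have "{|a, b|} |-| {|b|} = {|a|}" using ne by auto
    then show thesis using that[of a] ab(1) ba rb 2 by (simp add: finsert_commute)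
  qed
qed

lemma choices_evenI:
  assumes "mate G n x y"
  shows "{|x, y|} \<in> choices (level G n) (rng (level G n) x)" "{|x, y|} |-| {|x|} = {|y|}"
    "rng (level G n) x \<in> V0 (level G n)"
proof -
  show u: "rng (level G n) x \<in> V0 (level G n)" using assms rng_in by (simp add: mate_def)
  show "{|x, y|} \<in> choices (level G n) (rng (level G n) x)"
    unfolding choices_even[OF u] using assms by blast
  show "{|x, y|} |-| {|x|} = {|y|}" using mate_neq[OF assms] by auto
qed

lemma res_class_even:
  assumes x: "x \<in> edges (level G n)"
  shows "res_class (level G n) x = {Alpha x {|y|} | y. mate G n x y}"
proof (intro equalityI subsetI)
  fix z assume "z \<in> res_class (level G n) x"
  then obtain T where T: "z = Alpha x (T |-| {|x|})" "T \<in> choices (level G n) (rng (level G n) x)" "x |\<in>| T"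
    by (auto simp: res_class_def)
  then show "z \<in> {Alpha x {|y|} | y. mate G n x y}"
    using choices_evenE[OF rng_in[OF x] T(2,3)] by (metis (mono_tags, lifting) mem_Collect_eq)
next
  fix z assume "z \<in> {Alpha x {|y|} | y. mate G n x y}"
  then obtain y where y: "z = Alpha x {|y|}" "mate G n x y" by blast
  have "z = Alpha x ({|x, y|} |-| {|x|})" using choices_evenI(2)[OF y(2)] y(1) by simp
  then show "z \<in> res_class (level G n) x"
    unfolding res_class_def using choices_evenI(1)[OF y(2)] by blast
qed

lemma edges_odd: "edges (level G (Suc n)) = {Alpha x {|y|} | x y. mate G n x y}"
proof (intro equalityI subsetI)
  fix z assume "z \<in> edges (level G (Suc n))"
  then obtain u T x where T: "z = Alpha x (T |-| {|x|})" "u \<in> V0 (level G n)" "T \<in> choices (level G n) u" "x |\<in>| T"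
    unfolding edges_level_Suc by blast
  show "z \<in> {Alpha x {|y|} | x y. mate G n x y}"
    by (rule choices_evenE[OF T(2,3,4)]) (use T(1) in auto)
next
  fix z assume "z \<in> {Alpha x {|y|} | x y. mate G n x y}"
  then obtain x y where y: "z = Alpha x {|y|}" "mate G n x y" by blast
  have "z = Alpha x ({|x, y|} |-| {|x|})" using choices_evenI(2)[OF y(2)] y(1) by simp
  then show "z \<in> edges (level G (Suc n))"
    unfolding edges_level_Suc using choices_evenI(1,3)[OF y(2)] by blast
qed

lemma finite_edges_odd: "finite (edges (level G (Suc n)))"
proof (rule finite_subset)
  show "edges (level G (Suc n)) \<subseteq> (\<lambda>(x, y). Alpha x {|y|}) ` (edges (level G n) \<times> edges (level G n))"
    unfolding edges_odd by (auto simp: mate_def)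
qed (use finite_edges in auto)

lemma V1_odd: "V1 (level G (Suc n)) = {Tuple_vertex {|x, y|} | x y. mate G n x y}" (is "?L = ?R")
proof (intro equalityI subsetI)
  fix z assume "z \<in> ?L"
  then show "z \<in> ?R"
    unfolding V1_level_Suc by clarify (auto simp: choices_even)
next
  fix z assume "z \<in> ?R"
  then show "z \<in> ?L"
    unfolding V1_level_Suc using choices_evenI(1,3) by blast
qed

text \<open>A tuple at the vertex \<open>v\<close> of the odd level selects, for each edge \<open>x\<close> with source \<open>v\<close>, one
  element of the class \<open>X(x)\<close>, hence one mate of \<open>x\<close>.\<close>

definition selection :: "('v, 'e) res_vertex \<Rightarrow> ('e res_edge \<Rightarrow> 'e res_edge) \<Rightarrow> 'e res_edge fset" where
  "selection v sel = Abs_fset ((\<lambda>x. Alpha x {|sel x|}) ` {x \<in> edges (level G n). src (level G n) x = v})"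

lemma in_selection:
  "z |\<in>| selection v sel \<longleftrightarrow> (\<exists>x. x \<in> edges (level G n) \<and> src (level G n) x = v \<and> z = Alpha x {|sel x|})"
  using finite_edges by (auto simp: selection_def Abs_fset_inverse)

lemma choices_odd:
  "choices (level G (Suc n)) v = {selection v sel | sel.
     \<forall>x. x \<in> edges (level G n) \<longrightarrow> src (level G n) x = v \<longrightarrow> mate G n x (sel x)}" (is "?L = ?R")
proof -
  let ?In = "\<lambda>x. x \<in> edges (level G n) \<and> src (level G n) x = v"
  have cl: "classes (level G (Suc n)) v = (\<lambda>x. {Alpha x {|y|} | y. mate G n x y}) ` {x. ?In x}"
    using res_class_even by auto
  show ?thesis
  proof (intro equalityI subsetI)
    fix T assume T: "T \<in> ?L"
    have sub: "\<exists>x y. ?In x \<and> mate G n x y \<and> z = Alpha x {|y|}" if "z |\<in>| T" for z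
      using T that unfolding choices_def cl by auto
    have one: "\<exists>!y. mate G n x y \<and> Alpha x {|y|} |\<in>| T" if "?In x" for x
    proof -
      have "{Alpha x {|y|} | y. mate G n x y} \<in> classes (level G (Suc n)) v" unfolding cl using that by blast
      moreover have "\<forall>X\<in>classes (level G (Suc n)) v. \<exists>!z. z \<in> X \<and> z |\<in>| T"
        using T unfolding choices_def by simp
      ultimately have "\<exists>!z. z \<in> {Alpha x {|y|} | y. mate G n x y} \<and> z |\<in>| T" by (rule bspec[rotated])
      then obtain z where z: "z \<in> {Alpha x {|y|} | y. mate G n x y}" "z |\<in>| T"
        "\<And>z'. z' \<in> {Alpha x {|y|} | y. mate G n x y} \<Longrightarrow> z' |\<in>| T \<Longrightarrow> z' = z" by (elim ex1E conjE) blast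
      from z(1) obtain y where y: "z = Alpha x {|y|}" "mate G n x y" by blast
      show ?thesis
      proof (rule ex1I[of _ y])
        show "mate G n x y \<and> Alpha x {|y|} |\<in>| T" using y z(2) by simp
        fix y' assume "mate G n x y' \<and> Alpha x {|y'|} |\<in>| T"
        then have "Alpha x {|y'|} = z" by (intro z(3)) auto
        then show "y' = y" using y(1) by simp
      qed
    qed
    define sel where "sel = (\<lambda>x. THE y. mate G n x y \<and> Alpha x {|y|} |\<in>| T)"
    have sel: "mate G n x (sel x)" "Alpha x {|sel x|} |\<in>| T" if "?In x" for x
      using theI'[OF one[OF that]] by (auto simp: sel_def)
    have "T = selection v sel"
    proof (rule fset_eqI)
      fix z show "z |\<in>| T \<longleftrightarrow> z |\<in>| selection v sel"
        using sub sel one unfolding in_selection by metis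
    qed
    then show "T \<in> ?R" using sel by blast
  next
    fix T assume "T \<in> ?R"
    then obtain sel where "T = selection v sel" and sel: "\<And>x. ?In x \<Longrightarrow> mate G n x (sel x)" by auto
    then show "T \<in> ?L" unfolding choices_def cl by (auto simp: in_selection)
  qed
qed

lemma choices_odd_unique:
  assumes "T \<in> choices (level G (Suc n)) v" "Alpha x {|y|} |\<in>| T" "Alpha x {|y'|} |\<in>| T"
  shows "y = y'"
  using assms unfolding choices_odd by (auto simp: in_selection)

lemma choices_odd_memE:
  assumes "T \<in> choices (level G (Suc n)) v" "z |\<in>| T"
  obtains x y where "x \<in> edges (level G n)" "src (level G n) x = v" "mate G n x y" "z = Alpha x {|y|}"
  using assms unfolding choices_odd by (auto simp: in_selection)

lemma choices_odd_elem:
  assumes "T \<in> choices (level G (Suc n)) v" "x |\<in>| T"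
  shows "x \<in> edges (level G (Suc n))" "rng (level G (Suc n)) x = v"
  using assms unfolding choices_odd edges_odd by (auto simp: in_selection)

lemma choices_odd_ex:
  assumes "T \<in> choices (level G (Suc n)) v" "x \<in> edges (level G n)" "src (level G n) x = v"
  obtains y where "mate G n x y" "Alpha x {|y|} |\<in>| T"
  using assms unfolding choices_odd by (auto simp: in_selection)

text \<open>A tuple meets every class at its vertex exactly once, so it cannot be enlarged.\<close>

lemma choices_odd_subset:
  assumes "T \<in> choices (level G (Suc n)) v" "T' \<in> choices (level G (Suc n)) v" "T |\<subseteq>| T'"
  shows "T = T'"
proof (rule fset_eqI)
  fix z
  have "z |\<in>| T" if z: "z |\<in>| T'"
  proof -
    from z assms(2) obtain x y where x: "x \<in> edges (level G n)" "src (level G n) x = v" "z = Alpha x {|y|}"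
      unfolding choices_odd by (auto simp: in_selection)
    obtain y' where "Alpha x {|y'|} |\<in>| T" using choices_odd_ex[OF assms(1) x(1,2)] by blast
    then show ?thesis using choices_odd_unique[OF assms(2)] z x assms(3) by blast
  qed
  then show "z |\<in>| T \<longleftrightarrow> z |\<in>| T'" using assms(3) by auto
qed

text \<open>The remaining entries can be chosen freely, because every edge has a mate.\<close>

lemma choices_odd_through:
  assumes "z \<in> edges (level G (Suc n))"
  obtains T where "T \<in> choices (level G (Suc n)) (rng (level G (Suc n)) z)" "z |\<in>| T"
proof -
  obtain x y where z: "z = Alpha x {|y|}" and m: "mate G n x y" using assms unfolding edges_odd by blast
  define sel where "sel = (\<lambda>x'. if x' = x then y else SOME y'. mate G n x' y')"
  have sel: "mate G n x' (sel x')" if "x' \<in> edges (level G n)" for x'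
    using m someI_ex[OF mate_ex[OF that]] by (simp add: sel_def)
  have x: "x \<in> edges (level G n)" "sel x = y" using m by (auto simp: mate_def sel_def)
  show thesis
  proof (rule that)
    show "selection (src (level G n) x) sel \<in> choices (level G (Suc n)) (rng (level G (Suc n)) z)"
      unfolding choices_odd z using sel by auto
    show "z |\<in>| selection (src (level G n) x) sel" unfolding in_selection z using x by blast
  qed
qed

lemma edges_even:
  "edges (level G (Suc (Suc n))) =
     {Alpha x (T |-| {|x|}) | v x T. T \<in> choices (level G (Suc n)) v \<and> x |\<in>| T}"
proof -
  have "v \<in> V0 (level G (Suc n))" if Tx: "T \<in> choices (level G (Suc n)) v" "x |\<in>| T" for v x T
  proof -
    obtain y where "y \<in> edges (level G n)" "src (level G n) y = v"
      using choices_odd_memE[OF Tx] .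
    then show ?thesis using src_in by auto
  qed
  then show ?thesis unfolding edges_level_Suc[of G "Suc n"] by blast
qed

lemma V1_even: "V1 (level G (Suc (Suc n))) =
    {Tuple_vertex T | v T. v \<in> V1 (level G n) \<and> T \<in> choices (level G (Suc n)) v}"
  by (simp add: V1_level_Suc[of G "Suc n"])

lemma edge_evenE:
  assumes "e \<in> edges (level G (Suc (Suc n)))"
  obtains x T where "e = Alpha x (T |-| {|x|})" "T \<in> choices (level G (Suc n)) (rng (level G (Suc n)) x)"
    "x |\<in>| T" "x \<in> edges (level G (Suc n))"
    "src (level G (Suc (Suc n))) e = Tuple_vertex T" 
  using assms choices_odd_elem unfolding edges_even by (auto simp: finsert_absorb)

lemma edge_evenI:
  assumes "T \<in> choices (level G (Suc n)) v" "x |\<in>| T"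
  shows "Alpha x (T |-| {|x|}) \<in> edges (level G (Suc (Suc n)))"
    "src (level G (Suc (Suc n))) (Alpha x (T |-| {|x|})) = Tuple_vertex T"
  using assms unfolding edges_even by (auto simp: finsert_absorb)


text \<open>Two steps of the resolution lead from a graph of this shape to a graph of the same shape:
  a vertex \<open>{x, y}\<close> of the next even level, with \<open>x\<close> blue and \<open>y\<close> red, is the source of exactly
  two edges, one of either colour, and a tuple contains exactly one blue edge because the
  sources of the blue edges are distinct.\<close>

lemma even_level_Suc_Suc: "even_level G (Suc (Suc n))"
proof
  let ?E = "level G n" and ?E1 = "level G (Suc n)" and ?E2 = "level G (Suc (Suc n))"
  have col: "is_blue G (Alpha x T) = is_blue G x" "is_red G (Alpha x T) = is_red G x" for x T by simp_all
  have red1: "is_red G e \<longleftrightarrow> \<not> is_blue G e" if "e \<in> edges ?E1" for e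
    using that red_iff unfolding edges_odd by (auto simp: mate_def)
  show red2: "is_red G e \<longleftrightarrow> \<not> is_blue G e" if "e \<in> edges ?E2" for e
    using that by (rule edge_evenE) (simp add: red1)
  have blue2: "e \<in> blue_edges G (Suc (Suc n)) \<longleftrightarrow> e \<in> edges ?E2 \<and> is_blue G e"
    and red2': "e \<in> red_edges G (Suc (Suc n)) \<longleftrightarrow> e \<in> edges ?E2 \<and> \<not> is_blue G e" for e
    using red2 by (auto simp: blue_edges_def red_edges_def)
  note fin1 = finite_edges_odd
  have finT: "finite {T. fset T \<subseteq> edges ?E1}"
  proof (rule finite_subset)
    show "{T. fset T \<subseteq> edges ?E1} \<subseteq> Abs_fset ` Pow (edges ?E1)"
    proof
      fix T assume "T \<in> {T. fset T \<subseteq> edges ?E1}"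
      then show "T \<in> Abs_fset ` Pow (edges ?E1)"
        by (intro image_eqI[of _ _ "fset T"]) (auto simp: fset_inverse)
    qed
  qed (use fin1 in auto)
  show "finite (edges ?E2)"
  proof (rule finite_subset)
    show "edges ?E2 \<subseteq> (\<lambda>(x, T). Alpha x (T |-| {|x|})) ` (edges ?E1 \<times> {T. fset T \<subseteq> edges ?E1})"
    proof
      fix e assume "e \<in> edges ?E2"
      then obtain x T where "e = Alpha x (T |-| {|x|})" "x \<in> edges ?E1" "fset T \<subseteq> edges ?E1"
        by (rule edge_evenE) (simp add: subset_iff choices_odd_elem(1))
      then show "e \<in> (\<lambda>(x, T). Alpha x (T |-| {|x|})) ` (edges ?E1 \<times> {T. fset T \<subseteq> edges ?E1})"
        by (intro image_eqI[of _ _ "(x, T)"]) auto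
    qed
  qed (use fin1 finT in auto)
  show "rng ?E2 e \<in> V0 ?E2" if "e \<in> edges ?E2" for e
    using that
  proof (rule edge_evenE)
    fix x T assume e: "e = Alpha x (T |-| {|x|})" and x: "x \<in> edges ?E1"
    obtain a b where "x = Alpha a {|b|}" "mate G n a b" using x unfolding edges_odd by blast
    then show "rng ?E2 e \<in> V0 ?E2" using e by (auto simp: V1_odd)
  qed
  \<comment> \<open>the edges of the class of \<open>x\<close> are those with the range and the colour of \<open>x\<close>\<close>
  have cls: "res_class ?E1 x = {e \<in> edges ?E2. is_blue G e = is_blue G x \<and> rng ?E2 e = src ?E1 x}" (is "_ = ?C x")
    and cls_ne: "res_class ?E1 x \<noteq> {}" if x: "x \<in> edges ?E1" for x
  proof -
    obtain a b where ab: "x = Alpha a {|b|}" "mate G n a b" using x unfolding edges_odd by blast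
    show "res_class ?E1 x = ?C x"
    proof (intro equalityI subsetI)
      fix e assume "e \<in> res_class ?E1 x"
      then obtain T where T: "e = Alpha x (T |-| {|x|})" "T \<in> choices ?E1 (rng ?E1 x)" "x |\<in>| T"
        unfolding res_class_def by blast
      then show "e \<in> ?C x" using edge_evenI(1)[OF T(2,3)] by simp
    next
      fix e assume e: "e \<in> ?C x"
      then have "e \<in> edges ?E2" by simp
      then obtain y T where yT: "e = Alpha y (T |-| {|y|})" "T \<in> choices ?E1 (rng ?E1 y)" "y |\<in>| T" "y \<in> edges ?E1"
        by (rule edge_evenE)
      obtain c d where cd: "y = Alpha c {|d|}" "mate G n c d" using yT(4) unfolding edges_odd by blast
      have "{|c, d|} = {|a, b|}" "is_blue G c = is_blue G a" using e yT ab cd by auto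
      then have "c = a \<and> d = b"
        using pair_eq[of c d a b] ab(2) cd(2) unfolding mate_def by metis
      then have "y = x" using ab cd by simp
      then show "e \<in> res_class ?E1 x" using yT unfolding res_class_def by blast
    qed
    obtain T where "T \<in> choices ?E1 (rng ?E1 x)" "x |\<in>| T" using choices_odd_through[OF x] .
    then have "Alpha x (T |-| {|x|}) \<in> res_class ?E1 x" unfolding res_class_def by blast
    then show "res_class ?E1 x \<noteq> {}" by blast
  qed
  have vert: "\<exists>x y. x \<in> edges ?E1 \<and> y \<in> edges ?E1 \<and> is_blue G x \<and> \<not> is_blue G y \<and>
      {e \<in> edges ?E1. src ?E1 e = u} = {x, y}" if u: "u \<in> V0 ?E2" for u
  proof -
    have "\<exists>x y. mate G n x y \<and> u = Tuple_vertex {|x, y|} \<and> is_blue G x"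
    proof -
      obtain x y where xy: "u = Tuple_vertex {|x, y|}" "mate G n x y" using u by (auto simp: V1_odd)
      show ?thesis
      proof (cases "is_blue G x")
        case False
        then have "is_blue G y" using xy(2) by (simp add: mate_def)
        moreover have "{|x, y|} = {|y, x|}" by auto
        ultimately show ?thesis using xy mate_sym by metis
      qed (use xy in blast)
    qed
    then obtain x y where xy: "mate G n x y" "u = Tuple_vertex {|x, y|}" "is_blue G x" by blast
    have yx: "mate G n y x" "\<not> is_blue G y" using xy mate_sym by (auto simp: mate_def)
    let ?x = "Alpha x {|y|}" and ?y = "Alpha y {|x|}"
    have "{e \<in> edges ?E1. src ?E1 e = u} = {?x, ?y}"
    proof (intro equalityI subsetI)
      fix e assume "e \<in> {e \<in> edges ?E1. src ?E1 e = u}"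
      then obtain a b where e: "e = Alpha a {|b|}" "mate G n a b" "{|a, b|} = {|x, y|}"
        using xy(2) by (auto simp: edges_odd)
      then have "a = x \<and> b = y \<or> a = y \<and> b = x"
        by (simp add: pair_eq)
      then show "e \<in> {?x, ?y}" using e by auto
    next
      fix e assume "e \<in> {?x, ?y}"
      moreover have "{|x, y|} = {|y, x|}" by auto
      ultimately show "e \<in> {e \<in> edges ?E1. src ?E1 e = u}"
        using xy yx unfolding edges_odd by auto
    qed
    moreover have "?x \<in> edges ?E1" "?y \<in> edges ?E1" using xy yx unfolding edges_odd by blast+
    ultimately show ?thesis using xy(3) yx(2) by (intro exI[of _ ?x] exI[of _ ?y]) simp
  qed
  have two: "\<exists>x y. classes ?E2 u = {res_class ?E1 x, res_class ?E1 y} \<and>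
      res_class ?E1 x = {e \<in> blue_edges G (Suc (Suc n)). rng ?E2 e = u} \<and>
      res_class ?E1 y = {e \<in> red_edges G (Suc (Suc n)). rng ?E2 e = u} \<and>
      res_class ?E1 x \<noteq> {} \<and> res_class ?E1 y \<noteq> {}" if u: "u \<in> V0 ?E2" for u
  proof -
    obtain x y where xy: "x \<in> edges ?E1" "y \<in> edges ?E1" "is_blue G x" "\<not> is_blue G y"
      "{e \<in> edges ?E1. src ?E1 e = u} = {x, y}" using vert[OF u] by blast
    then have sx: "src ?E1 x = u" "src ?E1 y = u" by blast+
    have "classes ?E2 u = res_class ?E1 ` {e \<in> edges ?E1. src ?E1 e = u}" by auto
    also have "\<dots> = {res_class ?E1 x, res_class ?E1 y}" unfolding xy(5) by simp
    finally have c: "classes ?E2 u = {res_class ?E1 x, res_class ?E1 y}" .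
    have "res_class ?E1 x = {e \<in> blue_edges G (Suc (Suc n)). rng ?E2 e = u}"
      "res_class ?E1 y = {e \<in> red_edges G (Suc (Suc n)). rng ?E2 e = u}"
      unfolding cls[OF xy(1)] cls[OF xy(2)] sx blue2 red2' using xy(3,4) by blast+
    with c cls_ne[OF xy(1)] cls_ne[OF xy(2)] show ?thesis by blast
  qed
  show "classes ?E2 u = {{e \<in> blue_edges G (Suc (Suc n)). rng ?E2 e = u},
      {e \<in> red_edges G (Suc (Suc n)). rng ?E2 e = u}}" if "u \<in> V0 ?E2" for u
    using two[OF that] by metis
  show "\<exists>e\<in>blue_edges G (Suc (Suc n)). rng ?E2 e = u" if "u \<in> V0 ?E2" for u
    using two[OF that] by blast
  show "\<exists>e\<in>red_edges G (Suc (Suc n)). rng ?E2 e = u" if "u \<in> V0 ?E2" for u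
    using two[OF that] by blast
  \<comment> \<open>a tuple at \<open>v\<close> contains one element for each edge of the previous even level with source \<open>v\<close>\<close>
  have in_T: "\<exists>z. z |\<in>| T \<and> z \<in> edges ?E1 \<and> is_blue G z = col"
    if T: "T \<in> choices ?E1 v" and v: "v \<in> V1 ?E" for T v col
  proof -
    obtain x where x: "x \<in> edges ?E" "src ?E x = v" "is_blue G x = col"
      using v src_blue src_red by (cases col) (metis (no_types, opaque_lifting) imageE blue_iff red_edge_iff)+
    then obtain y where "Alpha x {|y|} |\<in>| T" using choices_odd_ex[OF T] by metis
    then show ?thesis using choices_odd_elem(1)[OF T] x(3) by fastforce
  qed
  have src2: "src ?E2 e \<in> V1 ?E2" if e: "e \<in> edges ?E2" for e
  proof -
    obtain x T where T: "T \<in> choices ?E1 (rng ?E1 x)" "x |\<in>| T" "src ?E2 e = Tuple_vertex T"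
      using edge_evenE[OF e] .
    obtain y where "y \<in> edges ?E" "src ?E y = rng ?E1 x" using choices_odd_memE[OF T(1,2)] .
    then have "rng ?E1 x \<in> V1 ?E" using src_in by metis
    then show ?thesis using T(1,3) unfolding V1_even by blast
  qed
  show "inj_on (src ?E2) (blue_edges G (Suc (Suc n)))"
  proof (rule inj_onI)
    fix e e' assume e: "e \<in> blue_edges G (Suc (Suc n))" and e': "e' \<in> blue_edges G (Suc (Suc n))"
      and eq: "src ?E2 e = src ?E2 e'"
    obtain x T where T: "e = Alpha x (T |-| {|x|})" "T \<in> choices ?E1 (rng ?E1 x)" "x |\<in>| T"
      "src ?E2 e = Tuple_vertex T" using e edge_evenE unfolding blue2 by metis
    obtain x' T' where T': "e' = Alpha x' (T' |-| {|x'|})" "T' \<in> choices ?E1 (rng ?E1 x')" "x' |\<in>| T'"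
      "src ?E2 e' = Tuple_vertex T'" using e' edge_evenE unfolding blue2 by metis
    have TT: "T = T'" using eq T T' by simp
    obtain a b where ab: "a \<in> edges ?E" "src ?E a = rng ?E1 x" "mate G n a b" "x = Alpha a {|b|}"
      using choices_odd_memE[OF T(2,3)] .
    obtain a' b' where ab': "a' \<in> edges ?E" "src ?E a' = rng ?E1 x" "mate G n a' b'" "x' = Alpha a' {|b'|}"
      using choices_odd_memE[OF T(2)] T'(3) TT by metis
    have "a \<in> blue_edges G n" "a' \<in> blue_edges G n"
      using e[unfolded blue2 T(1) ab(4)] e'[unfolded blue2 T'(1) ab'(4)] ab(1) ab'(1)
      unfolding blue_iff by simp_all
    then have "a = a'" using inj_onD[OF src_blue_inj, of a a'] ab(2) ab'(2) by simp
    moreover from this have "b = b'"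
      using choices_odd_unique[OF T(2)] T(3) T'(3) ab(4) ab'(4) TT by metis
    ultimately show "e = e'" unfolding T(1) T'(1) TT ab(4) ab'(4) by simp
  qed
  show "src ?E2 ` blue_edges G (Suc (Suc n)) = V1 ?E2"
  proof (intro equalityI subsetI)
    fix u assume "u \<in> src ?E2 ` blue_edges G (Suc (Suc n))"
    then obtain e where "e \<in> edges ?E2" "u = src ?E2 e" by (auto simp: blue_edges_def)
    then show "u \<in> V1 ?E2" using src2 by simp
  next
    fix u assume "u \<in> V1 ?E2"
    then obtain v T where u: "u = Tuple_vertex T" "v \<in> V1 ?E" "T \<in> choices ?E1 v"
      unfolding V1_even by blast
    obtain z where z: "z |\<in>| T" "is_blue G z" using in_T[OF u(3,2), of True] by blast
    have "Alpha z (T |-| {|z|}) \<in> blue_edges G (Suc (Suc n))"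
      using edge_evenI(1)[OF u(3) z(1)] z(2) unfolding blue2 by simp
    then show "u \<in> src ?E2 ` blue_edges G (Suc (Suc n))"
      using edge_evenI(2)[OF u(3) z(1)] u(1) by (metis imageI)
  qed
  show "src ?E2 ` red_edges G (Suc (Suc n)) = V1 ?E2"
  proof (intro equalityI subsetI)
    fix u assume "u \<in> src ?E2 ` red_edges G (Suc (Suc n))"
    then obtain e where "e \<in> edges ?E2" "u = src ?E2 e" by (auto simp: red_edges_def)
    then show "u \<in> V1 ?E2" using src2 by simp
  next
    fix u assume "u \<in> V1 ?E2"
    then obtain v T where u: "u = Tuple_vertex T" "v \<in> V1 ?E" "T \<in> choices ?E1 v"
      unfolding V1_even by blast
    obtain z where z: "z |\<in>| T" "\<not> is_blue G z" using in_T[OF u(3,2), of False] by blast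
    have "Alpha z (T |-| {|z|}) \<in> red_edges G (Suc (Suc n))"
      using edge_evenI(1)[OF u(3) z(1)] z(2) unfolding red2' by simp
    then show "u \<in> src ?E2 ` red_edges G (Suc (Suc n))"
      using edge_evenI(2)[OF u(3) z(1)] u(1) by (metis imageI)
  qed
qed

end

lemma even_level_0:
  assumes "generalized_finite_shift_graph G"
  shows "even_level G 0"
proof
  have fbs: "finite_bipartite_separated_graph G"
    using assms unfolding generalized_finite_shift_graph_def by simp
  have fin: "finite (edges G)" and rng_V0: "rng G ` edges G = V0 G"
    and part0: "\<And>v. v \<in> V0 G \<Longrightarrow> partition_on {e \<in> edges G. rng G e = v} (classes G v)"
    using fbs unfolding finite_bipartite_separated_graph_def by simp_all
  have bipart: "\<forall>v\<in>V0 G. classes G v = {blue G v, red G v} \<and> blue G v \<noteq> red G v \<and>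
        blue G v \<noteq> {} \<and> red G v \<noteq> {}"
    and V1b: "V1 G = (\<Union>v\<in>V0 G. src G ` blue G v)" and V1r: "V1 G = (\<Union>v\<in>V0 G. src G ` red G v)"
    and dis: "disjoint_family_on (\<lambda>v. src G ` blue G v) (V0 G)"
    and inj0: "\<forall>v\<in>V0 G. inj_on (src G) (blue G v)"
    using assms unfolding generalized_finite_shift_graph_def by - (elim conjE; assumption)+
  have cls: "\<And>v. v \<in> V0 G \<Longrightarrow> classes G v = {blue G v, red G v}"
    and neq: "\<And>v. v \<in> V0 G \<Longrightarrow> blue G v \<noteq> red G v"
    and bne: "\<And>v. v \<in> V0 G \<Longrightarrow> blue G v \<noteq> {}" and rne: "\<And>v. v \<in> V0 G \<Longrightarrow> red G v \<noteq> {}"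
    and inj: "\<And>v. v \<in> V0 G \<Longrightarrow> inj_on (src G) (blue G v)"
    using bipart inj0 by simp_all
  have part: "partition_on {e \<in> edges G. rng G e = v} {blue G v, red G v}" if "v \<in> V0 G" for v
    using part0[OF that] cls[OF that] by simp
  have un: "blue G v \<union> red G v = {e \<in> edges G. rng G e = v}" if "v \<in> V0 G" for v
    using partition_onD1[OF part[OF that]] by simp
  have disj: "blue G v \<inter> red G v = {}" if "v \<in> V0 G" for v
    using partition_onD2[OF part[OF that]] neq[OF that] by (auto simp: disjoint_def)
  have rngV: "rng G e \<in> V0 G" if "e \<in> edges G" for e using rng_V0 that by blast
  have bl: "e \<in> blue_edges G 0 \<longleftrightarrow> (\<exists>v a. v \<in> V0 G \<and> a \<in> blue G v \<and> e = Base_edge a)"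
    and re: "e \<in> red_edges G 0 \<longleftrightarrow> (\<exists>v a. v \<in> V0 G \<and> a \<in> red G v \<and> e = Base_edge a)" for e
  proof -
    have "rng G a = v" "a \<in> edges G" if "v \<in> V0 G" "a \<in> blue G v \<or> a \<in> red G v" for a v
      using un[OF that(1)] that(2) by blast+
    then show "e \<in> blue_edges G 0 \<longleftrightarrow> (\<exists>v a. v \<in> V0 G \<and> a \<in> blue G v \<and> e = Base_edge a)"
      "e \<in> red_edges G 0 \<longleftrightarrow> (\<exists>v a. v \<in> V0 G \<and> a \<in> red G v \<and> e = Base_edge a)"
      by (auto simp: blue_edges_def red_edges_def base_level_def) (metis rngV)+
  qed
  show "finite (edges (level G 0))" using fin by (simp add: base_level_def)
  show "is_red G x \<longleftrightarrow> \<not> is_blue G x" if x: "x \<in> edges (level G 0)" for x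
  proof -
    obtain a where a: "x = Base_edge a" "a \<in> edges G" using x by (auto simp: base_level_def)
    then show ?thesis using un[OF rngV[OF a(2)]] disj[OF rngV[OF a(2)]] by auto
  qed
  show "rng (level G 0) x \<in> V0 (level G 0)" if "x \<in> edges (level G 0)" for x
    using that rngV by (auto simp: base_level_def)
  have r0: "rng (level G 0) (Base_edge a) = Base_vertex (rng G a)"
    and s0: "src (level G 0) (Base_edge a) = Base_vertex (src G a)" for a
    by (simp_all add: base_level_def)
  have cb: "{e \<in> blue_edges G 0. rng (level G 0) e = Base_vertex v} = Base_edge ` blue G v"
    and cr: "{e \<in> red_edges G 0. rng (level G 0) e = Base_vertex v} = Base_edge ` red G v" if "v \<in> V0 G" for v
  proof -
    have "rng G a = w" if "w \<in> V0 G" "a \<in> blue G w \<or> a \<in> red G w" for a w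
      using un[OF that(1)] that(2) by blast
    then show "{e \<in> blue_edges G 0. rng (level G 0) e = Base_vertex v} = Base_edge ` blue G v"
      "{e \<in> red_edges G 0. rng (level G 0) e = Base_vertex v} = Base_edge ` red G v"
      using that unfolding bl re by (auto simp: base_level_def) 
  qed
  show "classes (level G 0) u = {{e \<in> blue_edges G 0. rng (level G 0) e = u},
      {e \<in> red_edges G 0. rng (level G 0) e = u}}" if u: "u \<in> V0 (level G 0)" for u
  proof -
    obtain v where v: "v \<in> V0 G" "u = Base_vertex v" using u by (auto simp: base_level_def)
    show ?thesis unfolding v(2) cb[OF v(1)] cr[OF v(1)]
      using cls[OF v(1)] by (simp add: base_level_def)
  qed
  show "\<exists>e\<in>blue_edges G 0. rng (level G 0) e = u" if u: "u \<in> V0 (level G 0)" for u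
  proof -
    obtain v where v: "v \<in> V0 G" "u = Base_vertex v" using u by (auto simp: base_level_def)
    then show ?thesis using cb[OF v(1)] bne[OF v(1)] by blast
  qed
  show "\<exists>e\<in>red_edges G 0. rng (level G 0) e = u" if u: "u \<in> V0 (level G 0)" for u
  proof -
    obtain v where v: "v \<in> V0 G" "u = Base_vertex v" using u by (auto simp: base_level_def)
    then show ?thesis using cr[OF v(1)] rne[OF v(1)] by blast
  qed
  show "inj_on (src (level G 0)) (blue_edges G 0)"
  proof (rule inj_onI)
    fix x y assume "x \<in> blue_edges G 0" "y \<in> blue_edges G 0" and eq: "src (level G 0) x = src (level G 0) y"
    then obtain v a w b where x: "v \<in> V0 G" "a \<in> blue G v" "x = Base_edge a"
      and y: "w \<in> V0 G" "b \<in> blue G w" "y = Base_edge b" unfolding bl by blast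
    have s: "src G a = src G b" using eq[unfolded x(3) y(3) s0] by simp
    have "v = w"
    proof (rule ccontr)
      assume "v \<noteq> w"
      then have "src G ` blue G v \<inter> src G ` blue G w = {}"
        using dis x y unfolding disjoint_family_on_def by blast
      then show False using s x y by blast
    qed
    then show "x = y" using inj x y s by (metis inj_onD)
  qed
  show "src (level G 0) ` blue_edges G 0 = V1 (level G 0)"
  proof -
    have "blue_edges G 0 = (\<Union>v\<in>V0 G. Base_edge ` blue G v)" unfolding set_eq_iff bl by blast
    moreover have "V1 (level G 0) = Base_vertex ` (\<Union>v\<in>V0 G. src G ` blue G v)"
      using V1b by (simp add: base_level_def)
    ultimately show ?thesis by (simp only: image_UN image_image s0)
  qed
  show "src (level G 0) ` red_edges G 0 = V1 (level G 0)"
  proof -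
    have "red_edges G 0 = (\<Union>v\<in>V0 G. Base_edge ` red G v)" unfolding set_eq_iff re by blast
    moreover have "V1 (level G 0) = Base_vertex ` (\<Union>v\<in>V0 G. src G ` red G v)"
      using V1r by (simp add: base_level_def del: UN_simps image_UN)
    ultimately show ?thesis by (simp only: image_UN image_image s0)
  qed
qed

lemma even_level: "generalized_finite_shift_graph G \<Longrightarrow> even_level G (2 * j)"
proof (induction j)
  case (Suc j)
  then show ?case using even_level.even_level_Suc_Suc[of G "2 * j"] by simp
qed (simp add: even_level_0)

section \<open>Labellings of a dynamical system by a finite shift graph\<close>

text \<open>A labelling presents \<open>\<rho>\<close> by finitely many pieces: \<open>a\<close> and \<open>c\<close> both refine the partition of \<open>Y\<close>
  by range vertices, and \<open>\<rho>\<close> maps the piece of a red edge \<open>k\<close> bijectively onto the set of points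
  whose blue label has the source of \<open>k\<close>.\<close>

definition labelling :: "('v, 'e, 'z) shift_graph_scheme \<Rightarrow> nat \<Rightarrow> 'y set \<Rightarrow> ('y \<Rightarrow> 'y) \<Rightarrow>
    ('y \<Rightarrow> 'e res_edge) \<Rightarrow> ('y \<Rightarrow> 'e res_edge) \<Rightarrow> bool" where
  "labelling G n Y \<rho> a c \<longleftrightarrow>
     (\<forall>y\<in>Y. \<rho> y \<in> Y \<and> a y \<in> blue_edges G n \<and> c y \<in> red_edges G n \<and>
        rng (level G n) (a y) = rng (level G n) (c y) \<and> src (level G n) (c y) = src (level G n) (a (\<rho> y))) \<and>
     (\<forall>y\<in>Y. \<forall>k\<in>red_edges G n. src (level G n) k = src (level G n) (a y) \<longrightarrow>
        (\<exists>!x. x \<in> Y \<and> \<rho> x = y \<and> c x = k))"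

lemma labellingD:
  assumes "labelling G n Y \<rho> a c" "y \<in> Y"
  shows "\<rho> y \<in> Y" "a y \<in> blue_edges G n" "c y \<in> red_edges G n"
    "rng (level G n) (a y) = rng (level G n) (c y)" "src (level G n) (c y) = src (level G n) (a (\<rho> y))"
  using assms unfolding labelling_def by blast+

lemma labelling_lift:
  assumes "labelling G n Y \<rho> a c" "y \<in> Y" "k \<in> red_edges G n" "src (level G n) k = src (level G n) (a y)"
  obtains x where "x \<in> Y" "\<rho> x = y" "c x = k"
  using assms unfolding labelling_def by blast

lemma labelling_inj:
  assumes "labelling G n Y \<rho> a c" "x \<in> Y" "x' \<in> Y" "\<rho> x = \<rho> x'" "c x = c x'"
  shows "x = x'"
proof -
  have "\<exists>!z. z \<in> Y \<and> \<rho> z = \<rho> x \<and> c z = c x"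
    using assms labellingD[OF assms(1,2)] unfolding labelling_def by blast
  then show ?thesis using assms by metis
qed

text \<open>The tuple that describes \<open>y\<close> one level up. By the lifting property the points over \<open>y\<close> are in
  bijection with the red edges with the source of \<open>a y\<close>; each contributes its own blue label as
  the mate of that red edge. The point \<open>y\<close> itself contributes its red label as the mate of \<open>a y\<close>.\<close>

definition label_tuple :: "'y set \<Rightarrow> ('y \<Rightarrow> 'y) \<Rightarrow> ('y \<Rightarrow> 'e res_edge) \<Rightarrow> ('y \<Rightarrow> 'e res_edge) \<Rightarrow> 'y \<Rightarrow> 'e res_edge fset" where
  "label_tuple Y \<rho> a c y =
     Abs_fset (insert (Alpha (a y) {|c y|}) ((\<lambda>x. Alpha (c x) {|a x|}) ` {x \<in> Y. \<rho> x = y}))"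

definition next_blue :: "'y set \<Rightarrow> ('y \<Rightarrow> 'y) \<Rightarrow> ('y \<Rightarrow> 'e res_edge) \<Rightarrow> ('y \<Rightarrow> 'e res_edge) \<Rightarrow> 'y \<Rightarrow> 'e res_edge" where
  "next_blue Y \<rho> a c y = Alpha (Alpha (a y) {|c y|}) (label_tuple Y \<rho> a c y |-| {|Alpha (a y) {|c y|}|})"

definition next_red :: "'y set \<Rightarrow> ('y \<Rightarrow> 'y) \<Rightarrow> ('y \<Rightarrow> 'e res_edge) \<Rightarrow> ('y \<Rightarrow> 'e res_edge) \<Rightarrow> 'y \<Rightarrow> 'e res_edge" where
  "next_red Y \<rho> a c y = Alpha (Alpha (c y) {|a y|}) (label_tuple Y \<rho> a c (\<rho> y) |-| {|Alpha (c y) {|a y|}|})"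

context even_level
begin

context
  fixes Y :: "'y set" and \<rho> a c
  assumes lab: "labelling G n Y \<rho> a c"
begin

lemma label_mate: "y \<in> Y \<Longrightarrow> mate G n (a y) (c y)"
  using labellingD[OF lab] by (intro mate_blue_red)

lemma in_label_tuple:
  assumes "y \<in> Y"
  shows "z |\<in>| label_tuple Y \<rho> a c y \<longleftrightarrow>
    z = Alpha (a y) {|c y|} \<or> (\<exists>x\<in>Y. \<rho> x = y \<and> z = Alpha (c x) {|a x|})"
proof -
  let ?S = "(\<lambda>x. Alpha (c x) {|a x|}) ` {x \<in> Y. \<rho> x = y}"
  have "?S \<subseteq> edges (level G (Suc n))"
    unfolding edges_odd using label_mate mate_sym by blast
  then have "finite ?S" using finite_edges_odd finite_subset by blast
  then have "fset (label_tuple Y \<rho> a c y) = insert (Alpha (a y) {|c y|}) ?S"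
    unfolding label_tuple_def by (simp add: Abs_fset_inverse)
  then show ?thesis by blast
qed

text \<open>The edges with the source of \<open>a y\<close> are \<open>a y\<close> itself, the only blue one, and the red labels of the
  points over \<open>y\<close>, each attained once.\<close>

lemma label_tuple_choice:
  assumes y: "y \<in> Y"
  shows "label_tuple Y \<rho> a c y \<in> choices (level G (Suc n)) (src (level G n) (a y))"
proof -
  \<comment> \<open>a red edge is paired with the blue label of the point over \<open>y\<close> that carries it\<close>
  define sel where "sel = (\<lambda>x. if x = a y then c y else a (THE x'. x' \<in> Y \<and> \<rho> x' = y \<and> c x' = x))"
  have sel_red: "sel (c x) = a x" if x: "x \<in> Y" "\<rho> x = y" for x
  proof -
    have "c x \<noteq> a y" using labellingD[OF lab] x y unfolding blue_iff red_edge_iff by metis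
    moreover have "(THE x'. x' \<in> Y \<and> \<rho> x' = y \<and> c x' = c x) = x"
      using x labelling_inj[OF lab] by (intro the_equality) auto
    ultimately show ?thesis by (simp add: sel_def)
  qed
  have over: "x = a y \<or> (\<exists>x'\<in>Y. \<rho> x' = y \<and> c x' = x)"
    if x: "x \<in> edges (level G n)" "src (level G n) x = src (level G n) (a y)" for x
  proof (cases "is_blue G x")
    case True
    then have "x = a y" using inj_onD[OF src_blue_inj x(2)] labellingD(2)[OF lab y] x(1) blue_iff by blast
    then show ?thesis ..
  next
    case False
    then have "x \<in> red_edges G n" using x(1) red_edge_iff by blast
    then show ?thesis using labelling_lift[OF lab y _ x(2)] by metis
  qed
  have "mate G n x (sel x)" if x: "x \<in> edges (level G n)" "src (level G n) x = src (level G n) (a y)" for x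
    using over[OF x]
  proof
    assume "x = a y" then show ?thesis using label_mate[OF y] by (simp add: sel_def)
  next
    assume "\<exists>x'\<in>Y. \<rho> x' = y \<and> c x' = x"
    then show ?thesis using sel_red label_mate mate_sym by metis
  qed
  moreover have "label_tuple Y \<rho> a c y = selection (src (level G n) (a y)) sel"
  proof (rule fset_eqI)
    fix z
    have ay: "sel (a y) = c y" by (simp add: sel_def)
    have ain: "a y \<in> edges (level G n)" using labellingD(2)[OF lab y] blue_iff by blast
    have cin: "c x \<in> edges (level G n)" "src (level G n) (c x) = src (level G n) (a y)" if "x \<in> Y" "\<rho> x = y" for x
      using labellingD(3,5)[OF lab that(1)] that(2) red_edge_iff by auto
    show "z |\<in>| label_tuple Y \<rho> a c y \<longleftrightarrow> z |\<in>| selection (src (level G n) (a y)) sel"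
      unfolding in_label_tuple[OF y] in_selection
      using over sel_red ay ain cin by metis
  qed
  ultimately show ?thesis unfolding choices_odd by blast
qed

lemma next_blue_red:
  assumes y: "y \<in> Y"
  shows "next_blue Y \<rho> a c y \<in> blue_edges G (Suc (Suc n))"
    "src (level G (Suc (Suc n))) (next_blue Y \<rho> a c y) = Tuple_vertex (label_tuple Y \<rho> a c y)"
    "rng (level G (Suc (Suc n))) (next_blue Y \<rho> a c y) = Tuple_vertex {|a y, c y|}"
    "next_red Y \<rho> a c y \<in> red_edges G (Suc (Suc n))"
    "src (level G (Suc (Suc n))) (next_red Y \<rho> a c y) = Tuple_vertex (label_tuple Y \<rho> a c (\<rho> y))"
    "rng (level G (Suc (Suc n))) (next_red Y \<rho> a c y) = Tuple_vertex {|a y, c y|}"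
proof -
  have mem: "Alpha (a y) {|c y|} |\<in>| label_tuple Y \<rho> a c y"
    "Alpha (c y) {|a y|} |\<in>| label_tuple Y \<rho> a c (\<rho> y)"
    using in_label_tuple y labellingD(1)[OF lab y] by blast+
  note ch = label_tuple_choice[OF y] label_tuple_choice[OF labellingD(1)[OF lab y]]
  interpret E2: even_level G "Suc (Suc n)" by (rule even_level_Suc_Suc)
  show "next_blue Y \<rho> a c y \<in> blue_edges G (Suc (Suc n))"
    unfolding E2.blue_iff next_blue_def
    using edge_evenI(1)[OF ch(1) mem(1)] labellingD(2)[OF lab y] blue_iff by simp
  show "next_red Y \<rho> a c y \<in> red_edges G (Suc (Suc n))"
    unfolding E2.red_edge_iff next_red_def
    using edge_evenI(1)[OF ch(2) mem(2)] labellingD(3)[OF lab y] red_edge_iff by simp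
  show "src (level G (Suc (Suc n))) (next_blue Y \<rho> a c y) = Tuple_vertex (label_tuple Y \<rho> a c y)"
    unfolding next_blue_def by (rule edge_evenI(2)[OF ch(1) mem(1)])
  show "src (level G (Suc (Suc n))) (next_red Y \<rho> a c y) = Tuple_vertex (label_tuple Y \<rho> a c (\<rho> y))"
    unfolding next_red_def by (rule edge_evenI(2)[OF ch(2) mem(2)])
  show "rng (level G (Suc (Suc n))) (next_blue Y \<rho> a c y) = Tuple_vertex {|a y, c y|}"
    "rng (level G (Suc (Suc n))) (next_red Y \<rho> a c y) = Tuple_vertex {|a y, c y|}"
    by (auto simp: next_blue_def next_red_def)
qed

text \<open>The lifting property persists because the points over \<open>y\<close> are still told apart by their old red
  labels: a red edge whose source is the tuple of \<open>y\<close> is given by a red entry of this tuple, and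
  such an entry comes from a point over \<open>y\<close>.\<close>

lemma labelling_next: "labelling G (Suc (Suc n)) Y \<rho> (next_blue Y \<rho> a c) (next_red Y \<rho> a c)"
proof -
  interpret E2: even_level G "Suc (Suc n)" by (rule even_level_Suc_Suc)
  have "\<exists>!x. x \<in> Y \<and> \<rho> x = y \<and> next_red Y \<rho> a c x = k"
    if y: "y \<in> Y" and k: "k \<in> red_edges G (Suc (Suc n))"
      and s: "src (level G (Suc (Suc n))) k = src (level G (Suc (Suc n))) (next_blue Y \<rho> a c y)" for y k
  proof -
    have kE: "k \<in> edges (level G (Suc (Suc n)))" "\<not> is_blue G k" using k E2.red_edge_iff by auto
    obtain Z T where Z: "k = Alpha Z (T |-| {|Z|})" "Z |\<in>| T" "src (level G (Suc (Suc n))) k = Tuple_vertex T"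
      using edge_evenE[OF kE(1)] by metis
    have T: "T = label_tuple Y \<rho> a c y" using s Z(3) next_blue_red(2)[OF y] by simp
    have "is_blue G (a y)" using labellingD(2)[OF lab y] blue_iff by blast
    then have "Z \<noteq> Alpha (a y) {|c y|}" using kE(2) Z(1) by auto
    then obtain x where x: "x \<in> Y" "\<rho> x = y" "Z = Alpha (c x) {|a x|}"
      using Z(2) unfolding T in_label_tuple[OF y] by blast
    show ?thesis
    proof (rule ex1I)
      show "x \<in> Y \<and> \<rho> x = y \<and> next_red Y \<rho> a c x = k"
        using x unfolding Z(1) T next_red_def by simp
      fix x' assume x': "x' \<in> Y \<and> \<rho> x' = y \<and> next_red Y \<rho> a c x' = k"
      then have "c x' = c x" using x unfolding Z(1) T next_red_def by simp
      then show "x' = x" using labelling_inj[OF lab] x x' by metis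
    qed
  qed
  then show ?thesis
    unfolding labelling_def using next_blue_red labellingD(1)[OF lab] by simp
qed

end

end

subsection \<open>The iterated labels\<close>

primrec labels :: "'y set \<Rightarrow> ('y \<Rightarrow> 'y) \<Rightarrow> ('y \<Rightarrow> 'e res_edge) \<Rightarrow> ('y \<Rightarrow> 'e res_edge) \<Rightarrow> nat \<Rightarrow>
    ('y \<Rightarrow> 'e res_edge) \<times> ('y \<Rightarrow> 'e res_edge)" where
  "labels Y \<rho> a c 0 = (a, c)"
| "labels Y \<rho> a c (Suc j) = (case labels Y \<rho> a c j of (a', c') \<Rightarrow> (next_blue Y \<rho> a' c', next_red Y \<rho> a' c'))"

definition blue_label :: "'y set \<Rightarrow> ('y \<Rightarrow> 'y) \<Rightarrow> ('y \<Rightarrow> 'e res_edge) \<Rightarrow> ('y \<Rightarrow> 'e res_edge) \<Rightarrow> nat \<Rightarrow> 'y \<Rightarrow> 'e res_edge" where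
  "blue_label Y \<rho> a c j = fst (labels Y \<rho> a c j)"

definition red_label :: "'y set \<Rightarrow> ('y \<Rightarrow> 'y) \<Rightarrow> ('y \<Rightarrow> 'e res_edge) \<Rightarrow> ('y \<Rightarrow> 'e res_edge) \<Rightarrow> nat \<Rightarrow> 'y \<Rightarrow> 'e res_edge" where
  "red_label Y \<rho> a c j = snd (labels Y \<rho> a c j)"

lemma label_simps:
  "blue_label Y \<rho> a c 0 = a" "red_label Y \<rho> a c 0 = c"
  "blue_label Y \<rho> a c (Suc j) = next_blue Y \<rho> (blue_label Y \<rho> a c j) (red_label Y \<rho> a c j)"
  "red_label Y \<rho> a c (Suc j) = next_red Y \<rho> (blue_label Y \<rho> a c j) (red_label Y \<rho> a c j)"
  by (simp_all add: blue_label_def red_label_def split: prod.split)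

lemma labelling_iterate:
  assumes "generalized_finite_shift_graph G" "labelling G 0 Y \<rho> a c"
  shows "labelling G (2 * j) Y \<rho> (blue_label Y \<rho> a c j) (red_label Y \<rho> a c j)"
proof (induction j)
  case (Suc j)
  then show ?case
    using even_level.labelling_next[OF even_level[OF assms(1)] Suc.IH] by (simp add: label_simps)
qed (use assms in \<open>simp add: label_simps\<close>)

text \<open>The blue edge at an odd level is the blue label paired with its mate, so that the coordinates
  \<open>2 * j\<close> and \<open>2 * j + 1\<close> together record both labels at level \<open>2 * j\<close>.\<close>

definition label_point :: "'y set \<Rightarrow> ('y \<Rightarrow> 'y) \<Rightarrow> ('y \<Rightarrow> 'e res_edge) \<Rightarrow> ('y \<Rightarrow> 'e res_edge) \<Rightarrow> 'y \<Rightarrow> nat \<Rightarrow> 'e res_edge" where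
  "label_point Y \<rho> a c y i = (if even i then blue_label Y \<rho> a c (i div 2) y
     else Alpha (blue_label Y \<rho> a c (i div 2) y) {|red_label Y \<rho> a c (i div 2) y|})"

lemma label_point_simps:
  "label_point Y \<rho> a c y (2 * j) = blue_label Y \<rho> a c j y"
  "label_point Y \<rho> a c y (Suc (2 * j)) = Alpha (blue_label Y \<rho> a c j y) {|red_label Y \<rho> a c j y|}"
  by (simp_all add: label_point_def)

lemma even_odd_cases:
  obtains j where "i = 2 * j" | j where "i = Suc (2 * j)"
  by (metis evenE oddE Suc_eq_plus1)

lemma label_point_in_gfs_points:
  assumes G: "generalized_finite_shift_graph G" and lab: "labelling G 0 Y \<rho> a c" and y: "y \<in> Y"
  shows "label_point Y \<rho> a c y \<in> gfs_points G"
proof -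
  let ?p = "label_point Y \<rho> a c y"
  have "?p i \<in> blue_edges G i \<and> rng (level G (Suc i)) (?p (Suc i)) = src (level G i) (?p i)" for i
  proof (cases i rule: even_odd_cases)
    case (1 j)
    then show ?thesis using labellingD(2)[OF labelling_iterate[OF G lab, of j] y]
      by (simp add: label_point_simps)
  next
    case (2 j)
    interpret E: even_level G "2 * j" by (rule even_level[OF G])
    note l = labelling_iterate[OF G lab, of j]
    have "?p (Suc i) = blue_label Y \<rho> a c (Suc j) y"
      unfolding 2 label_point_simps(1)[of _ _ _ _ _ "Suc j", symmetric] by simp
    then have "rng (level G (Suc i)) (?p (Suc i)) = src (level G i) (?p i)"
      unfolding 2 using E.next_blue_red(3)[OF l y] by (simp add: label_point_simps label_simps)
    moreover have "?p i \<in> blue_edges G i"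
      unfolding 2 using E.label_mate[OF l y] labellingD(2)[OF l y]
      by (auto simp: label_point_simps blue_edges_def E.edges_odd)
    ultimately show ?thesis by blast
  qed
  then show ?thesis unfolding gfs_points_def by blast
qed

text \<open>An equivariant map that respects labels restricts to bijections between fibres, since points of a
  fibre correspond to red edges on both sides. Hence all derived labels are respected as well.\<close>

lemma label_tuple_natural:
  assumes "even_level G n"
    and Y: "labelling G n Y \<rho> a c" and Z: "labelling G n Z \<tau> a' c'"
    and \<phi>: "\<And>y. y \<in> Y \<Longrightarrow> \<phi> y \<in> Z \<and> \<phi> (\<rho> y) = \<tau> (\<phi> y) \<and> a y = a' (\<phi> y) \<and> c y = c' (\<phi> y)"
    and y: "y \<in> Y"
  shows "label_tuple Y \<rho> a c y = label_tuple Z \<tau> a' c' (\<phi> y)"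
proof (rule fset_eqI)
  interpret even_level G n by fact
  fix z
  have \<phi>y: "\<phi> y \<in> Z" using \<phi> y by blast
  have "(\<exists>x\<in>Y. \<rho> x = y \<and> z = Alpha (c x) {|a x|}) \<longleftrightarrow> (\<exists>x\<in>Z. \<tau> x = \<phi> y \<and> z = Alpha (c' x) {|a' x|})"
  proof
    assume "\<exists>x\<in>Y. \<rho> x = y \<and> z = Alpha (c x) {|a x|}"
    then show "\<exists>x\<in>Z. \<tau> x = \<phi> y \<and> z = Alpha (c' x) {|a' x|}" using \<phi> by metis
  next
    assume "\<exists>x\<in>Z. \<tau> x = \<phi> y \<and> z = Alpha (c' x) {|a' x|}"
    then obtain x where x: "x \<in> Z" "\<tau> x = \<phi> y" "z = Alpha (c' x) {|a' x|}" by blast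
    have "src (level G n) (c' x) = src (level G n) (a y)" using labellingD(5)[OF Z x(1)] x(2) \<phi> y by simp
    then obtain w where w: "w \<in> Y" "\<rho> w = y" "c w = c' x"
      using labelling_lift[OF Y y labellingD(3)[OF Z x(1)]] by metis
    have "\<phi> w = x" using labelling_inj[OF Z _ x(1)] \<phi> w x(2) by metis
    then show "\<exists>x\<in>Y. \<rho> x = y \<and> z = Alpha (c x) {|a x|}" using w x \<phi> by metis
  qed
  then show "z |\<in>| label_tuple Y \<rho> a c y \<longleftrightarrow> z |\<in>| label_tuple Z \<tau> a' c' (\<phi> y)"
    unfolding in_label_tuple[OF Y y] in_label_tuple[OF Z \<phi>y] using \<phi>[OF y] by simp
qed

lemma label_point_natural:
  assumes G: "generalized_finite_shift_graph G"
    and Y: "labelling G 0 Y \<rho> a c" and Z: "labelling G 0 Z \<tau> a' c'"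
    and \<phi>: "\<And>y. y \<in> Y \<Longrightarrow> \<phi> y \<in> Z \<and> \<phi> (\<rho> y) = \<tau> (\<phi> y)"
    and ac: "\<And>y. y \<in> Y \<Longrightarrow> a y = a' (\<phi> y) \<and> c y = c' (\<phi> y)"
    and y: "y \<in> Y"
  shows "label_point Z \<tau> a' c' (\<phi> y) = label_point Y \<rho> a c y"
proof -
  have "\<forall>y\<in>Y. blue_label Y \<rho> a c j y = blue_label Z \<tau> a' c' j (\<phi> y) \<and>
      red_label Y \<rho> a c j y = red_label Z \<tau> a' c' j (\<phi> y)" for j
  proof (induction j)
    case 0
    then show ?case using ac by (simp add: label_simps)
  next
    case (Suc j)
    have t: "label_tuple Y \<rho> (blue_label Y \<rho> a c j) (red_label Y \<rho> a c j) y =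
        label_tuple Z \<tau> (blue_label Z \<tau> a' c' j) (red_label Z \<tau> a' c' j) (\<phi> y)" if "y \<in> Y" for y
      by (rule label_tuple_natural[OF even_level[OF G] labelling_iterate[OF G Y] labelling_iterate[OF G Z] _ that])
        (use Suc \<phi> in blast)
    show ?case
    proof
      fix y assume y: "y \<in> Y"
      note \<rho>y = labellingD(1)[OF Y y]
      have "\<phi> (\<rho> y) = \<tau> (\<phi> y)" using \<phi>[OF y] by simp
      then show "blue_label Y \<rho> a c (Suc j) y = blue_label Z \<tau> a' c' (Suc j) (\<phi> y) \<and>
          red_label Y \<rho> a c (Suc j) y = red_label Z \<tau> a' c' (Suc j) (\<phi> y)"
        using t[OF y] t[OF \<rho>y] bspec[OF Suc y] by (simp add: label_simps next_blue_def next_red_def)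
    qed
  qed
  then show ?thesis unfolding label_point_def using y by (intro ext) simp
qed

lemma rng_next_blue_eq_iff:
  assumes "even_level G n" and lab: "labelling G n Y \<rho> a c" and y: "y1 \<in> Y" "y2 \<in> Y"
  shows "rng (level G (Suc (Suc n))) (next_blue Y \<rho> a c y1) = rng (level G (Suc (Suc n))) (next_blue Y \<rho> a c y2)
    \<longleftrightarrow> a y1 = a y2 \<and> c y1 = c y2"
proof -
  interpret even_level G n by fact
  have "is_blue G (a y1)" "is_blue G (a y2)" "\<not> is_blue G (c y1)" "\<not> is_blue G (c y2)"
    using labellingD(2,3)[OF lab y(1)] labellingD(2,3)[OF lab y(2)] blue_iff red_edge_iff by auto
  then show ?thesis
    unfolding next_blue_red(3)[OF lab y(1)] next_blue_red(3)[OF lab y(2)] res_vertex.inject pair_eq by metis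
qed

text \<open>If the range vertex for \<open>H\<close> determines both labels for \<open>G\<close>, the same holds two levels up. The
  range vertex two levels up is the pair \<open>{a' y, c' y}\<close>. Now \<open>a' y\<close> fixes the set of red labels
  \<open>c' x\<close> of the points \<open>x\<close> over \<open>y\<close>, and \<open>c' x\<close> has the range of \<open>a' x\<close>, which determines \<open>a x\<close> and
  \<open>c x\<close>; so \<open>a' y\<close> determines the tuple of \<open>y\<close>. Since \<open>c' y\<close> has the source of \<open>a' (\<rho> y)\<close>, it
  determines the tuple of \<open>\<rho> y\<close>, which enters the next red label.\<close>

lemma next_labels_determined:
  assumes "even_level G n" "even_level H m"
    and lab: "labelling G n Y \<rho> a c" and lab': "labelling H m Y \<rho> a' c'"
    and det: "\<And>y1 y2. y1 \<in> Y \<Longrightarrow> y2 \<in> Y \<Longrightarrow> rng (level H m) (a' y1) = rng (level H m) (a' y2) \<Longrightarrow>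
      a y1 = a y2 \<and> c y1 = c y2"
    and y: "y1 \<in> Y" "y2 \<in> Y" "rng (level H (Suc (Suc m))) (next_blue Y \<rho> a' c' y1) =
      rng (level H (Suc (Suc m))) (next_blue Y \<rho> a' c' y2)"
  shows "next_blue Y \<rho> a c y1 = next_blue Y \<rho> a c y2 \<and> next_red Y \<rho> a c y1 = next_red Y \<rho> a c y2"
proof -
  interpret G: even_level G n by fact
  interpret H: even_level H m by fact
  have sub: "z |\<in>| label_tuple Y \<rho> a c w2"
    if w: "w1 \<in> Y" "w2 \<in> Y" "a' w1 = a' w2" and z: "z |\<in>| label_tuple Y \<rho> a c w1" for w1 w2 z
  proof -
    have ac: "a w1 = a w2" "c w1 = c w2" using det[OF w(1,2)] w(3) by simp_all
    have "\<exists>x\<in>Y. \<rho> x = w2 \<and> z = Alpha (c x) {|a x|}"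
      if x: "x \<in> Y" "\<rho> x = w1" "z = Alpha (c x) {|a x|}" for x
    proof -
      have "src (level H m) (c' x) = src (level H m) (a' w2)"
        using labellingD(5)[OF lab' x(1)] x(2) w(3) by simp
      then obtain x2 where x2: "x2 \<in> Y" "\<rho> x2 = w2" "c' x2 = c' x"
        using labelling_lift[OF lab' w(2) labellingD(3)[OF lab' x(1)]] by metis
      have "rng (level H m) (a' x) = rng (level H m) (a' x2)"
        using labellingD(4)[OF lab'] x(1) x2 by metis
      then have "a x = a x2 \<and> c x = c x2" using det x(1) x2(1) by blast
      then show ?thesis using x x2 by metis
    qed
    then show ?thesis using z ac unfolding G.in_label_tuple[OF lab w(1)] G.in_label_tuple[OF lab w(2)] by metis
  qed
  have tuple: "label_tuple Y \<rho> a c w1 = label_tuple Y \<rho> a c w2"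
    if "w1 \<in> Y" "w2 \<in> Y" "a' w1 = a' w2" for w1 w2
    using sub that by (intro fset_eqI) metis
  have eq: "a' y1 = a' y2" "c' y1 = c' y2"
    using y(3) rng_next_blue_eq_iff[OF assms(2) lab' y(1,2)] by simp_all
  have "src (level H m) (a' (\<rho> y1)) = src (level H m) (a' (\<rho> y2))"
    using labellingD(5)[OF lab'] y eq by metis
  then have eq2: "a' (\<rho> y1) = a' (\<rho> y2)"
    using inj_onD[OF H.src_blue_inj] labellingD(1,2)[OF lab'] y by metis
  have ac: "a y1 = a y2" "c y1 = c y2" using det[OF y(1,2)] eq(1) by simp_all
  show ?thesis
    unfolding next_blue_def next_red_def ac
      tuple[OF y(1,2) eq(1)] tuple[OF labellingD(1)[OF lab' y(1)] labellingD(1)[OF lab' y(2)] eq2] by simp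
qed

lemma labels_determined:
  assumes G: "generalized_finite_shift_graph G" and H: "generalized_finite_shift_graph H"
    and lab: "labelling G 0 Y \<rho> a c" and lab': "labelling H 0 Y \<rho> a' c'"
    and det: "\<And>y1 y2. y1 \<in> Y \<Longrightarrow> y2 \<in> Y \<Longrightarrow> rng (level H 0) (a' y1) = rng (level H 0) (a' y2) \<Longrightarrow>
      a y1 = a y2 \<and> c y1 = c y2"
  shows "y1 \<in> Y \<Longrightarrow> y2 \<in> Y \<Longrightarrow>
    rng (level H (2 * j)) (blue_label Y \<rho> a' c' j y1) = rng (level H (2 * j)) (blue_label Y \<rho> a' c' j y2) \<Longrightarrow>
    blue_label Y \<rho> a c j y1 = blue_label Y \<rho> a c j y2 \<and> red_label Y \<rho> a c j y1 = red_label Y \<rho> a c j y2"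
proof (induction j arbitrary: y1 y2)
  case 0
  then show ?case using det[OF 0(1,2)] by (simp add: label_simps)
next
  case (Suc j)
  show ?case
    unfolding label_simps
    by (rule next_labels_determined[OF even_level[OF G] even_level[OF H]
          labelling_iterate[OF G lab] labelling_iterate[OF H lab'] Suc.IH Suc.prems(1,2)])
      (use Suc.prems(3) in \<open>simp_all add: label_simps\<close>)
qed

section \<open>The canonical labelling of a generalized finite shift\<close>

context even_level
begin

text \<open>The source of an odd edge is a pair of mates, and the colour tells which of the two is
  distinguished.\<close>

lemma src_odd_inj:
  assumes x: "x \<in> edges (level G (Suc n))" and y: "y \<in> edges (level G (Suc n))"
    and s: "src (level G (Suc n)) x = src (level G (Suc n)) y" and col: "is_blue G x = is_blue G y"
  shows "x = y"
proof -
  obtain a b where ab: "x = Alpha a {|b|}" "mate G n a b" using x unfolding edges_odd by blast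
  obtain c d where cd: "y = Alpha c {|d|}" "mate G n c d" using y unfolding edges_odd by blast
  have "{|a, b|} = {|c, d|}" "is_blue G a = is_blue G c" using s col ab cd by simp_all
  then have "a = c \<and> b = d" using ab(2) cd(2) unfolding pair_eq mate_def by metis
  then show ?thesis using ab(1) cd(1) by simp
qed

text \<open>Two edges with the same source come from two entries of one tuple, and the entries of a tuple
  have the same range.\<close>

lemma same_source:
  assumes "b \<in> edges (level G (Suc (Suc n)))" "k \<in> edges (level G (Suc (Suc n)))"
    "src (level G (Suc (Suc n))) b = src (level G (Suc (Suc n))) k"
  obtains x z where "x \<in> edges (level G (Suc n))" "z \<in> edges (level G (Suc n))"
    "is_blue G x = is_blue G b" "is_blue G z = is_blue G k"
    "src (level G (Suc n)) x = rng (level G (Suc (Suc n))) b"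
    "src (level G (Suc n)) z = rng (level G (Suc (Suc n))) k"
    "rng (level G (Suc n)) x = rng (level G (Suc n)) z"
proof -
  obtain x T where x: "b = Alpha x (T |-| {|x|})" "T \<in> choices (level G (Suc n)) (rng (level G (Suc n)) x)"
    "x |\<in>| T" "x \<in> edges (level G (Suc n))"
    "src (level G (Suc (Suc n))) b = Tuple_vertex T" using edge_evenE[OF assms(1)] .
  obtain z T' where z: "k = Alpha z (T' |-| {|z|})" "z |\<in>| T'" "z \<in> edges (level G (Suc n))"
    "src (level G (Suc (Suc n))) k = Tuple_vertex T'" using edge_evenE[OF assms(2)] .
  have "z |\<in>| T" using z assms(3) x(5) by simp
  then have "rng (level G (Suc n)) z = rng (level G (Suc n)) x" using choices_odd_elem(2)[OF x(2)] by blast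
  then show thesis by (intro that[of x z]) (simp_all add: x(1,4) z(1,3))
qed

end

text \<open>The odd coordinate following a blue edge at an even level names a red mate of that edge. This is
  the red edge through which the shift acts at this level.\<close>

definition red_at :: "(nat \<Rightarrow> 'e res_edge) \<Rightarrow> nat \<Rightarrow> 'e res_edge" where
  "red_at e j = (THE k. e (Suc (2 * j)) = Alpha (e (2 * j)) {|k|})"

lemma red_at_eq: "e (Suc (2 * j)) = Alpha (e (2 * j)) {|k|} \<Longrightarrow> red_at e j = k"
  unfolding red_at_def by (rule the_equality) auto

context
  fixes G :: "('v, 'e, 'z) shift_graph_scheme"
  assumes G: "generalized_finite_shift_graph G"
begin

lemma gfs_points_blue: "e \<in> gfs_points G \<Longrightarrow> e i \<in> blue_edges G i"
  and gfs_points_rng: "e \<in> gfs_points G \<Longrightarrow> rng (level G (Suc i)) (e (Suc i)) = src (level G i) (e i)"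
  by (auto simp: gfs_points_def)

text \<open>The range condition forces the edge underlying the odd coordinate to have the source of
  \<open>e (2 * j)\<close>, and blue edges are determined by their sources.\<close>

lemma gfs_points_odd:
  assumes e: "e \<in> gfs_points G"
  shows "e (Suc (2 * j)) = Alpha (e (2 * j)) {|red_at e j|}" "red_at e j \<in> red_edges G (2 * j)"
    "rng (level G (2 * j)) (red_at e j) = rng (level G (2 * j)) (e (2 * j))"
proof -
  interpret E: even_level G "2 * j" by (rule even_level[OF G])
  have "e (Suc (2 * j)) \<in> edges (level G (Suc (2 * j)))" "is_blue G (e (Suc (2 * j)))"
    using gfs_points_blue[OF e, of "Suc (2 * j)"] by (auto simp: blue_edges_def)
  then obtain x y where xy: "e (Suc (2 * j)) = Alpha x {|y|}" "mate G (2 * j) x y" "is_blue G x"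
    unfolding E.edges_odd by auto
  have x: "x \<in> blue_edges G (2 * j)" using xy unfolding E.blue_iff by (simp add: mate_def)
  have "src (level G (2 * j)) x = src (level G (2 * j)) (e (2 * j))"
    using gfs_points_rng[OF e, of "2 * j"] xy(1) by simp
  then have eq: "x = e (2 * j)" using inj_onD[OF E.src_blue_inj _ x gfs_points_blue[OF e]] by blast
  then have y: "red_at e j = y" using red_at_eq xy(1) by blast
  show "e (Suc (2 * j)) = Alpha (e (2 * j)) {|red_at e j|}" using xy(1) eq y by simp
  show "red_at e j \<in> red_edges G (2 * j)" "rng (level G (2 * j)) (red_at e j) = rng (level G (2 * j)) (e (2 * j))"
    using xy(2,3) unfolding eq y E.red_edge_iff by (auto simp: mate_def)
qed

lemma gfs_points_eqI:
  assumes e: "e \<in> gfs_points G" and e': "e' \<in> gfs_points G" and eq: "\<And>j. e (2 * j) = e' (2 * j)"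
  shows "e = e'"
proof
  fix i show "e i = e' i"
  proof (cases i rule: even_odd_cases)
    case (2 j)
    interpret E: even_level G "2 * j" by (rule even_level[OF G])
    have "src (level G i) (e i) = src (level G i) (e' i)"
      using gfs_points_rng[OF e, of i] gfs_points_rng[OF e', of i] eq[of "Suc j"] unfolding 2 by simp
    moreover have "e i \<in> blue_edges G i" "e' i \<in> blue_edges G i" by (intro gfs_points_blue e e')+
    ultimately show ?thesis using E.src_odd_inj[of "e i" "e' i"] unfolding 2 by (auto simp: blue_edges_def)
  qed (simp add: eq)
qed

lemma gfs_points_Suc:
  assumes e: "e \<in> gfs_points G"
  obtains T where "e (2 * Suc j) = Alpha (e (Suc (2 * j))) (T |-| {|e (Suc (2 * j))|})"
    "T \<in> choices (level G (Suc (2 * j))) (src (level G (2 * j)) (e (2 * j)))"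
    "e (Suc (2 * j)) |\<in>| T" "src (level G (2 * Suc j)) (e (2 * Suc j)) = Tuple_vertex T"
proof -
  interpret E: even_level G "2 * j" by (rule even_level[OF G])
  have b: "e (Suc (Suc (2 * j))) \<in> edges (level G (Suc (Suc (2 * j))))" "is_blue G (e (Suc (Suc (2 * j))))"
    using gfs_points_blue[OF e, of "Suc (Suc (2 * j))"] by (auto simp: blue_edges_def)
  obtain x T where x: "e (Suc (Suc (2 * j))) = Alpha x (T |-| {|x|})"
    "T \<in> choices (level G (Suc (2 * j))) (rng (level G (Suc (2 * j))) x)"
    "x |\<in>| T" "x \<in> edges (level G (Suc (2 * j)))"
    "src (level G (Suc (Suc (2 * j)))) (e (Suc (Suc (2 * j)))) = Tuple_vertex T" using E.edge_evenE[OF b(1)] .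
  have "x = e (Suc (2 * j))"
    by (rule E.src_odd_inj) (use x(4) b(2) x(1) gfs_points_rng[OF e, of "Suc (2 * j)"]
        gfs_points_blue[OF e, of "Suc (2 * j)"] in \<open>auto simp: blue_edges_def\<close>)
  then show thesis using that[of T] x gfs_points_rng[OF e, of "2 * j"] by simp
qed

text \<open>The range of the next red edge is the pair \<open>{e (2 * j), red_at e j}\<close>, which leaves only one
  possible red entry to start from.\<close>

lemma red_at_Suc:
  assumes e: "e \<in> gfs_points G"
  obtains T v where "red_at e (Suc j) = Alpha (Alpha (red_at e j) {|e (2 * j)|})
      (T |-| {|Alpha (red_at e j) {|e (2 * j)|}|})"
    "T \<in> choices (level G (Suc (2 * j))) v"
    "Alpha (red_at e j) {|e (2 * j)|} |\<in>| T" "src (level G (2 * Suc j)) (red_at e (Suc j)) = Tuple_vertex T"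
proof -
  interpret E: even_level G "2 * j" by (rule even_level[OF G])
  interpret E2: even_level G "2 * Suc j" by (rule even_level[OF G])
  note o = gfs_points_odd[OF e, of "Suc j"] gfs_points_odd[OF e, of j]
  have k: "red_at e (Suc j) \<in> edges (level G (Suc (Suc (2 * j))))" "\<not> is_blue G (red_at e (Suc j))"
    using o(2) unfolding E2.red_edge_iff by auto
  obtain x T where x: "red_at e (Suc j) = Alpha x (T |-| {|x|})"
    "T \<in> choices (level G (Suc (2 * j))) (rng (level G (Suc (2 * j))) x)"
    "x |\<in>| T" "x \<in> edges (level G (Suc (2 * j)))"
    "src (level G (Suc (Suc (2 * j)))) (red_at e (Suc j)) = Tuple_vertex T" using E.edge_evenE[OF k(1)] .
  have m: "mate G (2 * j) (red_at e j) (e (2 * j))"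
    using E.mate_blue_red[OF gfs_points_blue[OF e] o(5)] o(6) mate_sym by metis
  have "src (level G (Suc (2 * j))) x = rng (level G (2 * Suc j)) (red_at e (Suc j))" using x(1) by simp
  also have "\<dots> = src (level G (Suc (2 * j))) (e (Suc (2 * j)))"
    unfolding o(3) using gfs_points_rng[OF e, of "Suc (2 * j)"] by simp
  finally have s: "src (level G (Suc (2 * j))) x = src (level G (Suc (2 * j))) (Alpha (red_at e j) {|e (2 * j)|})"
    unfolding o(4) by (simp add: pair_eq)
  have "x = Alpha (red_at e j) {|e (2 * j)|}"
  proof (rule E.src_odd_inj[OF x(4) _ s])
    show "Alpha (red_at e j) {|e (2 * j)|} \<in> edges (level G (Suc (2 * j)))" using m unfolding E.edges_odd by blast
    show "is_blue G x = is_blue G (Alpha (red_at e j) {|e (2 * j)|})"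
      using k(2) x(1) o(5) unfolding E.red_edge_iff by simp
  qed
  then show thesis using that[of T] x by simp
qed

text \<open>A red edge at an odd level is a red edge with a blue mate, so its source already determines it;
  membership in the class \<open>X(f\<^sub>0)\<close> then identifies \<open>f\<^sub>0\<close>.\<close>

lemma red_pair_eq:
  assumes e: "e \<in> gfs_points G"
  shows "red_pair G (2 * j) (e (2 * j)) (e (Suc (2 * j))) = (red_at e j, Alpha (red_at e j) {|e (2 * j)|})"
  unfolding red_pair_def
proof (rule the_equality)
  interpret E: even_level G "2 * j" by (rule even_level[OF G])
  note o = gfs_points_odd[OF e, of j]
  have m: "mate G (2 * j) (red_at e j) (e (2 * j))"
    using E.mate_blue_red[OF gfs_points_blue[OF e] o(2)] o(3) mate_sym by metis
  have red: "red_at e j \<in> edges (level G (2 * j))" "\<not> is_blue G (red_at e j)"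
    using o(2) unfolding E.red_edge_iff by auto
  have odd: "Alpha (red_at e j) {|e (2 * j)|} \<in> edges (level G (Suc (2 * j)))"
    using m unfolding E.edges_odd by blast
  have "Alpha (red_at e j) {|e (2 * j)|} \<in> red_edges G (Suc (2 * j))"
    using odd o(2) by (simp add: red_edges_def)
  moreover have rc: "Alpha (red_at e j) {|e (2 * j)|} \<in> res_class (level G (2 * j)) (red_at e j)"
    using m unfolding E.res_class_even[OF red(1)] by blast
  ultimately show "case (red_at e j, Alpha (red_at e j) {|e (2 * j)|}) of (f0, f1) \<Rightarrow>
      f0 \<in> red_edges G (2 * j) \<and> f1 \<in> red_edges G (Suc (2 * j)) \<and>
      rng (level G (2 * j)) f0 = rng (level G (2 * j)) (e (2 * j)) \<and>
      rng (level G (Suc (2 * j))) f1 = src (level G (2 * j)) f0 \<and>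
      src (level G (Suc (2 * j))) f1 = src (level G (Suc (2 * j))) (e (Suc (2 * j))) \<and>
      f1 \<in> res_class (level G (2 * j)) f0"
    using o rc by (simp add: pair_eq)
  fix f :: "'e res_edge \<times> 'e res_edge"
  assume f: "case f of (f0, f1) \<Rightarrow>
      f0 \<in> red_edges G (2 * j) \<and> f1 \<in> red_edges G (Suc (2 * j)) \<and>
      rng (level G (2 * j)) f0 = rng (level G (2 * j)) (e (2 * j)) \<and>
      rng (level G (Suc (2 * j))) f1 = src (level G (2 * j)) f0 \<and>
      src (level G (Suc (2 * j))) f1 = src (level G (Suc (2 * j))) (e (Suc (2 * j))) \<and>
      f1 \<in> res_class (level G (2 * j)) f0"
  obtain f0 f1 where ff: "f = (f0, f1)" by (cases f)
  have f0: "f0 \<in> edges (level G (2 * j))" "\<not> is_blue G f0"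
    and f1: "src (level G (Suc (2 * j))) f1 = src (level G (Suc (2 * j))) (e (Suc (2 * j)))"
      "f1 \<in> res_class (level G (2 * j)) f0"
    using f unfolding ff E.red_edge_iff by auto
  obtain b where b: "f1 = Alpha f0 {|b|}" "mate G (2 * j) f0 b"
    using f1(2) unfolding E.res_class_even[OF f0(1)] by blast
  have "f1 = Alpha (red_at e j) {|e (2 * j)|}"
  proof (rule E.src_odd_inj[OF _ odd])
    show "f1 \<in> edges (level G (Suc (2 * j)))" using b unfolding E.edges_odd by blast
    show "src (level G (Suc (2 * j))) f1 = src (level G (Suc (2 * j))) (Alpha (red_at e j) {|e (2 * j)|})"
      unfolding f1(1) o(1) by (simp add: pair_eq)
    show "is_blue G f1 = is_blue G (Alpha (red_at e j) {|e (2 * j)|})"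
      using f0(2) red(2) unfolding b(1) by simp
  qed
  then show "f = (red_at e j, Alpha (red_at e j) {|e (2 * j)|})" using ff b(1) by simp
qed

text \<open>The blue edge \<open>b\<close> exists and is unique because sources of blue edges enumerate the vertices. It
  and the red edge \<open>red_at e (Suc j)\<close> have a common tuple as source, whose entries all have the
  range \<open>src (red_at e j)\<close>.\<close>

lemma blue_pair_eq:
  assumes e: "e \<in> gfs_points G"
  obtains x b where
    "blue_pair G (Suc (2 * j)) (Alpha (red_at e j) {|e (2 * j)|}) (red_at e (Suc j)) = (x, b)"
    "x \<in> blue_edges G (Suc (2 * j))" "b \<in> blue_edges G (2 * Suc j)"
    "rng (level G (Suc (2 * j))) x = src (level G (2 * j)) (red_at e j)"
    "rng (level G (2 * Suc j)) b = src (level G (Suc (2 * j))) x"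
    "src (level G (2 * Suc j)) b = src (level G (2 * Suc j)) (red_at e (Suc j))"
proof -
  interpret E: even_level G "2 * j" by (rule even_level[OF G])
  interpret E2: even_level G "2 * Suc j" by (rule even_level[OF G])
  have k: "red_at e (Suc j) \<in> red_edges G (2 * Suc j)" by (rule gfs_points_odd(2)[OF e])
  obtain T v where T: "red_at e (Suc j) = Alpha (Alpha (red_at e j) {|e (2 * j)|})
      (T |-| {|Alpha (red_at e j) {|e (2 * j)|}|})" using red_at_Suc[OF e] by metis
  have "src (level G (2 * Suc j)) (red_at e (Suc j)) \<in> src (level G (2 * Suc j)) ` blue_edges G (2 * Suc j)"
    unfolding E2.src_blue E2.src_red[symmetric] using k by (rule imageI)
  then obtain b where b: "b \<in> blue_edges G (2 * Suc j)"
    "src (level G (2 * Suc j)) b = src (level G (2 * Suc j)) (red_at e (Suc j))" by (elim imageE) metis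
  have be: "b \<in> edges (level G (Suc (Suc (2 * j))))" "is_blue G b"
    and ke: "red_at e (Suc j) \<in> edges (level G (Suc (Suc (2 * j))))" "\<not> is_blue G (red_at e (Suc j))"
    using b(1) k unfolding E2.blue_iff E2.red_edge_iff by auto
  obtain x z where xz: "x \<in> edges (level G (Suc (2 * j)))" "z \<in> edges (level G (Suc (2 * j)))"
    "is_blue G x = is_blue G b" "is_blue G z = is_blue G (red_at e (Suc j))"
    "src (level G (Suc (2 * j))) x = rng (level G (Suc (Suc (2 * j)))) b"
    "src (level G (Suc (2 * j))) z = rng (level G (Suc (Suc (2 * j)))) (red_at e (Suc j))"
    "rng (level G (Suc (2 * j))) x = rng (level G (Suc (2 * j))) z"
    using E.same_source[OF be(1) ke(1)] b(2) by auto
  have m: "mate G (2 * j) (red_at e j) (e (2 * j))"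
    using E.mate_blue_red[OF gfs_points_blue[OF e] gfs_points_odd(2)[OF e]] gfs_points_odd(3)[OF e] mate_sym by metis
  have "z = Alpha (red_at e j) {|e (2 * j)|}"
  proof (rule E.src_odd_inj[OF xz(2)])
    show "Alpha (red_at e j) {|e (2 * j)|} \<in> edges (level G (Suc (2 * j)))" using m unfolding E.edges_odd by blast
    show "src (level G (Suc (2 * j))) z = src (level G (Suc (2 * j))) (Alpha (red_at e j) {|e (2 * j)|})"
      unfolding xz(6) T by simp
    show "is_blue G z = is_blue G (Alpha (red_at e j) {|e (2 * j)|})" unfolding xz(4) T by simp
  qed
  then have rx: "rng (level G (Suc (2 * j))) x = src (level G (2 * j)) (red_at e j)" using xz(7) by simp
  have x: "x \<in> blue_edges G (Suc (2 * j))" using xz(1,3) be by (simp add: blue_edges_def)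
  have "blue_pair G (Suc (2 * j)) (Alpha (red_at e j) {|e (2 * j)|}) (red_at e (Suc j)) = (x, b)"
    unfolding blue_pair_def
  proof (rule the_equality)
    show "case (x, b) of (e0, e1) \<Rightarrow> e0 \<in> blue_edges G (Suc (2 * j)) \<and> e1 \<in> blue_edges G (Suc (Suc (2 * j))) \<and>
      rng (level G (Suc (2 * j))) e0 = rng (level G (Suc (2 * j))) (Alpha (red_at e j) {|e (2 * j)|}) \<and>
      rng (level G (Suc (Suc (2 * j)))) e1 = src (level G (Suc (2 * j))) e0 \<and>
      src (level G (Suc (Suc (2 * j)))) e1 = src (level G (Suc (Suc (2 * j)))) (red_at e (Suc j))"
      using x b rx xz(5) by simp
    fix p :: "'e res_edge \<times> 'e res_edge"
    assume p: "case p of (e0, e1) \<Rightarrow> e0 \<in> blue_edges G (Suc (2 * j)) \<and> e1 \<in> blue_edges G (Suc (Suc (2 * j))) \<and>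
      rng (level G (Suc (2 * j))) e0 = rng (level G (Suc (2 * j))) (Alpha (red_at e j) {|e (2 * j)|}) \<and>
      rng (level G (Suc (Suc (2 * j)))) e1 = src (level G (Suc (2 * j))) e0 \<and>
      src (level G (Suc (Suc (2 * j)))) e1 = src (level G (Suc (Suc (2 * j)))) (red_at e (Suc j))"
    obtain e0 e1 where pp: "p = (e0, e1)" by (cases p)
    have e1: "e1 = b"
      by (rule inj_onD[OF E2.src_blue_inj]) (use p b in \<open>auto simp: pp\<close>)
    have "e0 = x"
      by (rule E.src_odd_inj) (use p x xz(5) e1 in \<open>auto simp: pp blue_edges_def\<close>)
    then show "p = (x, b)" using pp e1 by simp
  qed
  then show thesis using that x b rx xz(5) by simp
qed

text \<open>The whole shift is governed by one rule at the even levels: the image of \<open>e\<close> has there the blue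
  edge with the source of \<open>red_at e j\<close>.\<close>

lemma gfs_map_props:
  assumes e: "e \<in> gfs_points G"
  shows "gfs_map G e \<in> gfs_points G"
    "src (level G (2 * j)) (gfs_map G e (2 * j)) = src (level G (2 * j)) (red_at e j)"
proof -
  interpret E0: even_level G "2 * 0" by (rule even_level[OF G])
  let ?f = "red_sequence G e" and ?e = "gfs_map G e"
  have f: "?f (2 * j) = red_at e j" "?f (Suc (2 * j)) = Alpha (red_at e j) {|e (2 * j)|}" for j
    using red_pair_eq[OF e, of j] by (simp_all add: red_sequence_def)
  have e': "(?e (Suc (2 * j)), ?e (2 * Suc j)) =
      blue_pair G (Suc (2 * j)) (Alpha (red_at e j) {|e (2 * j)|}) (red_at e (Suc j))" for j
    using f(2)[of j] f(1)[of "Suc j"] by (simp add: gfs_map_def blue_sequence_def Let_def)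
  have step: "?e (Suc (2 * j)) \<in> blue_edges G (Suc (2 * j)) \<and> ?e (2 * Suc j) \<in> blue_edges G (2 * Suc j) \<and>
      rng (level G (Suc (2 * j))) (?e (Suc (2 * j))) = src (level G (2 * j)) (red_at e j) \<and>
      rng (level G (2 * Suc j)) (?e (2 * Suc j)) = src (level G (Suc (2 * j))) (?e (Suc (2 * j))) \<and>
      src (level G (2 * Suc j)) (?e (2 * Suc j)) = src (level G (2 * Suc j)) (red_at e (Suc j))" for j
    by (rule blue_pair_eq[OF e, of j]) (use e'[of j] in auto)
  have e0: "?e 0 \<in> blue_edges G 0 \<and> src (level G 0) (?e 0) = src (level G 0) (red_at e 0)"
  proof -
    have eq: "?e 0 = (THE a. a \<in> blue_edges G 0 \<and> src (level G 0) a = src (level G 0) (red_at e 0))"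
      using step[of 0] by (simp add: gfs_map_def Let_def)
    have "src (level G 0) (red_at e 0) \<in> src (level G 0) ` blue_edges G 0"
      using E0.src_blue E0.src_red gfs_points_odd(2)[OF e, of 0] by auto
    then obtain a where a: "a \<in> blue_edges G 0" "src (level G 0) a = src (level G 0) (red_at e 0)"
      by (metis imageE)
    have "\<exists>!a. a \<in> blue_edges G 0 \<and> src (level G 0) a = src (level G 0) (red_at e 0)"
      using a inj_onD[OF E0.src_blue_inj] by (intro ex1I[of _ a]) auto
    from theI'[OF this] show ?thesis unfolding eq .
  qed
  have even: "?e (2 * j) \<in> blue_edges G (2 * j) \<and>
      src (level G (2 * j)) (?e (2 * j)) = src (level G (2 * j)) (red_at e j)" for j
    using e0 step by (cases j) simp_all
  show "src (level G (2 * j)) (?e (2 * j)) = src (level G (2 * j)) (red_at e j)" using even by blast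
  have "?e i \<in> blue_edges G i \<and> rng (level G (Suc i)) (?e (Suc i)) = src (level G i) (?e i)" for i
    by (cases i rule: even_odd_cases) (use even step in auto)
  then show "?e \<in> gfs_points G" unfolding gfs_points_def by blast
qed

lemma gfs_map_eqI:
  assumes e: "e \<in> gfs_points G" and d: "d \<in> gfs_points G"
    and s: "\<And>j. src (level G (2 * j)) (d (2 * j)) = src (level G (2 * j)) (red_at e j)"
  shows "gfs_map G e = d"
proof (rule gfs_points_eqI[OF gfs_map_props(1)[OF e] d])
  fix j
  interpret E: even_level G "2 * j" by (rule even_level[OF G])
  show "gfs_map G e (2 * j) = d (2 * j)"
    using inj_onD[OF E.src_blue_inj] gfs_points_blue[OF gfs_map_props(1)[OF e]] gfs_points_blue[OF d]
      gfs_map_props(2)[OF e, of j] s[of j] by metis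
qed

text \<open>The common image determines the tuple that is the source of the next red edge of \<open>x\<close> and of \<open>y\<close>.
  If \<open>red_at x j = red_at y j\<close>, this tuple contains only one mate for it, which must be both
  \<open>x (2 * j)\<close> and \<open>y (2 * j)\<close>.\<close>

lemma gfs_map_inj:
  assumes x: "x \<in> gfs_points G" and y: "y \<in> gfs_points G"
    and eq: "gfs_map G x = gfs_map G y" "red_at x 0 = red_at y 0"
  shows "x = y"
proof -
  have step: "x (2 * j) = y (2 * j) \<and> red_at x (Suc j) = red_at y (Suc j)" if k: "red_at x j = red_at y j" for j
  proof -
    interpret E: even_level G "2 * j" by (rule even_level[OF G])
    obtain T v where T: "red_at x (Suc j) = Alpha (Alpha (red_at x j) {|x (2 * j)|})
        (T |-| {|Alpha (red_at x j) {|x (2 * j)|}|})"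
      "T \<in> choices (level G (Suc (2 * j))) v" "Alpha (red_at x j) {|x (2 * j)|} |\<in>| T"
      "src (level G (2 * Suc j)) (red_at x (Suc j)) = Tuple_vertex T"
      using red_at_Suc[OF x] .
    obtain T' v' where T': "red_at y (Suc j) = Alpha (Alpha (red_at y j) {|y (2 * j)|})
        (T' |-| {|Alpha (red_at y j) {|y (2 * j)|}|})" "Alpha (red_at y j) {|y (2 * j)|} |\<in>| T'"
      "src (level G (2 * Suc j)) (red_at y (Suc j)) = Tuple_vertex T'"
      using red_at_Suc[OF y] .
    have TT: "T' = T" using gfs_map_props(2)[OF x, of "Suc j"] gfs_map_props(2)[OF y, of "Suc j"] eq T(4) T'(3) by simp
    have "x (2 * j) = y (2 * j)" using E.choices_odd_unique[OF T(2,3)] T'(2) unfolding TT k .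
    then show ?thesis using T(1) T'(1) k TT by simp
  qed
  have "red_at x j = red_at y j" for j by (induction j) (use eq step in auto)
  then show ?thesis using gfs_points_eqI[OF x y] step by blast
qed

text \<open>A preimage along \<open>k0\<close> is built level by level. If \<open>k\<close> is its red edge at level \<open>2 * j\<close>, the tuple
  at the source of the next even coordinate of \<open>e\<close> contains \<open>k\<close> with a mate \<open>w\<close>; this mate is the
  blue edge of the preimage, and the entry determines the red edge two levels up.\<close>

lemma gfs_map_lift:
  assumes e: "e \<in> gfs_points G" and k0: "k0 \<in> red_edges G 0" "src (level G 0) k0 = src (level G 0) (e 0)"
  obtains x where "x \<in> gfs_points G" "gfs_map G x = e" "red_at x 0 = k0"
proof -
  \<comment> \<open>\<open>P\<close> makes \<open>k\<close> a possible red edge of a preimage of \<open>e\<close>; \<open>Q\<close> links it to the blue edge \<open>w\<close>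
    of the preimage and to the next red edge\<close>
  define P where "P j k \<longleftrightarrow> k \<in> red_edges G (2 * j) \<and> src (level G (2 * j)) k = src (level G (2 * j)) (e (2 * j)) \<and>
    (j = 0 \<longrightarrow> k = k0)" for j k
  define Q where "Q j k k' \<longleftrightarrow> (\<exists>w \<in> blue_edges G (2 * j). rng (level G (2 * j)) w = rng (level G (2 * j)) k \<and>
    rng (level G (2 * Suc j)) k' = Tuple_vertex {|w, k|})" for j k k'
  have "\<exists>f. \<forall>j. P j (f j) \<and> Q j (f j) (f (Suc j))"
  proof (rule dependent_nat_choice)
    show "\<exists>k. P 0 k" using k0 by (auto simp: P_def)
    fix k j assume "P j k"
    then have k: "k \<in> red_edges G (2 * j)" "src (level G (2 * j)) k = src (level G (2 * j)) (e (2 * j))"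
      by (auto simp: P_def)
    interpret E: even_level G "2 * j" by (rule even_level[OF G])
    interpret E2: even_level G "2 * Suc j" by (rule even_level[OF G])
    obtain T where T: "T \<in> choices (level G (Suc (2 * j))) (src (level G (2 * j)) (e (2 * j)))"
      "src (level G (2 * Suc j)) (e (2 * Suc j)) = Tuple_vertex T" using gfs_points_Suc[OF e] .
    have ke: "k \<in> edges (level G (2 * j))" "\<not> is_blue G k" using k(1) unfolding E.red_edge_iff by auto
    obtain w where w: "mate G (2 * j) k w" "Alpha k {|w|} |\<in>| T" using E.choices_odd_ex[OF T(1) ke(1) k(2)] .
    let ?k = "Alpha (Alpha k {|w|}) (T |-| {|Alpha k {|w|}|})"
    have "?k \<in> red_edges G (2 * Suc j)"
      using E.edge_evenI(1)[OF T(1) w(2)] ke(2) unfolding E2.red_edge_iff by simp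
    moreover have "src (level G (2 * Suc j)) ?k = src (level G (2 * Suc j)) (e (2 * Suc j))"
      unfolding T(2) using E.edge_evenI(2)[OF T(1) w(2)] by simp
    moreover have "w \<in> blue_edges G (2 * j)" "rng (level G (2 * j)) w = rng (level G (2 * j)) k"
      using w(1) ke(2) unfolding E.blue_iff by (auto simp: mate_def)
    moreover have "rng (level G (2 * Suc j)) ?k = Tuple_vertex {|w, k|}" by (simp add: pair_eq)
    ultimately show "\<exists>k'. P (Suc j) k' \<and> Q j k k'" unfolding P_def Q_def by blast
  qed
  then obtain f where f: "\<And>j. P j (f j)" "\<And>j. Q j (f j) (f (Suc j))" by blast
  from f(2) obtain w where w: "w j \<in> blue_edges G (2 * j)" "rng (level G (2 * j)) (w j) = rng (level G (2 * j)) (f j)"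
    "rng (level G (2 * Suc j)) (f (Suc j)) = Tuple_vertex {|w j, f j|}" for j
    unfolding Q_def by metis
  define x where "x i = (if even i then w (i div 2) else Alpha (w (i div 2)) {|f (i div 2)|})" for i
  have xs: "x (2 * j) = w j" "x (Suc (2 * j)) = Alpha (w j) {|f j|}" "x (Suc (Suc (2 * j))) = w (Suc j)" for j
    by (simp_all add: x_def)
  have "x i \<in> blue_edges G i \<and> rng (level G (Suc i)) (x (Suc i)) = src (level G i) (x i)" for i
  proof (cases i rule: even_odd_cases)
    case (1 j)
    then show ?thesis using w(1)[of j] by (simp add: xs)
  next
    case (2 j)
    interpret E: even_level G "2 * j" by (rule even_level[OF G])
    have "mate G (2 * j) (w j) (f j)" using E.mate_blue_red w f(1)[of j] unfolding P_def by blast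
    then have "x i \<in> blue_edges G i" using w(1)[of j] unfolding 2 xs blue_edges_def E.edges_odd by auto
    moreover have "rng (level G (Suc i)) (x (Suc i)) = src (level G i) (x i)"
      unfolding 2 xs using w(2)[of "Suc j"] w(3)[of j] by simp
    ultimately show ?thesis by blast
  qed
  then have x: "x \<in> gfs_points G" unfolding gfs_points_def by blast
  have r: "red_at x j = f j" for j by (rule red_at_eq) (simp add: xs)
  have "gfs_map G x = e" by (rule gfs_map_eqI[OF x e]) (use f(1) in \<open>simp add: r P_def\<close>)
  moreover have "red_at x 0 = k0" using f(1)[of 0] by (simp add: r P_def)
  ultimately show thesis using that x by blast
qed

lemma canonical_labelling: "labelling G 0 (gfs_points G) (gfs_map G) (\<lambda>e. e 0) (\<lambda>e. red_at e 0)"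
  unfolding labelling_def
proof (intro conjI ballI impI)
  fix e assume e: "e \<in> gfs_points G"
  show "gfs_map G e \<in> gfs_points G" by (rule gfs_map_props(1)[OF e])
  show "e 0 \<in> blue_edges G 0" by (rule gfs_points_blue[OF e])
  show "red_at e 0 \<in> red_edges G 0" "rng (level G 0) (e 0) = rng (level G 0) (red_at e 0)"
    using gfs_points_odd(2,3)[OF e, of 0] by simp_all
  show "src (level G 0) (red_at e 0) = src (level G 0) (gfs_map G e 0)"
    using gfs_map_props(2)[OF e, of 0] by simp
  fix k assume "k \<in> red_edges G 0" "src (level G 0) k = src (level G 0) (e 0)"
  then obtain x where "x \<in> gfs_points G" "gfs_map G x = e" "red_at x 0 = k" using gfs_map_lift[OF e] by metis
  then show "\<exists>!x. x \<in> gfs_points G \<and> gfs_map G x = e \<and> red_at x 0 = k" using gfs_map_inj by metis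
qed

text \<open>The derived labels of the canonical labelling are the coordinates themselves. By induction every
  entry of the tuple of \<open>e\<close> belongs to the tuple at the source of the next even coordinate of \<open>e\<close>,
  and a tuple cannot be enlarged.\<close>

lemma canonical_label_point:
  assumes e: "e \<in> gfs_points G"
  shows "label_point (gfs_points G) (gfs_map G) (\<lambda>e. e 0) (\<lambda>e. red_at e 0) e = e"
proof -
  let ?P = "gfs_points G" and ?s = "gfs_map G"
  let ?a = "blue_label ?P ?s (\<lambda>e. e 0) (\<lambda>e. red_at e 0)" and ?c = "red_label ?P ?s (\<lambda>e. e 0) (\<lambda>e. red_at e 0)"
  have *: "\<forall>e\<in>?P. ?a j e = e (2 * j) \<and> ?c j e = red_at e j" for j
  proof (induction j)
    case (Suc j)
    interpret E: even_level G "2 * j" by (rule even_level[OF G])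
    note lab = labelling_iterate[OF G canonical_labelling, of j]
    have tuple: "src (level G (2 * Suc j)) (e (2 * Suc j)) = Tuple_vertex (label_tuple ?P ?s (?a j) (?c j) e) \<and>
        e (2 * Suc j) = Alpha (e (Suc (2 * j))) (label_tuple ?P ?s (?a j) (?c j) e |-| {|e (Suc (2 * j))|})"
      if e: "e \<in> ?P" for e
    proof -
      obtain T where T: "e (2 * Suc j) = Alpha (e (Suc (2 * j))) (T |-| {|e (Suc (2 * j))|})"
        "T \<in> choices (level G (Suc (2 * j))) (src (level G (2 * j)) (e (2 * j)))"
        "e (Suc (2 * j)) |\<in>| T" "src (level G (2 * Suc j)) (e (2 * Suc j)) = Tuple_vertex T"
        using gfs_points_Suc[OF e] .
      have "label_tuple ?P ?s (?a j) (?c j) e = T"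
      proof (rule E.choices_odd_subset[OF _ T(2)])
        show "label_tuple ?P ?s (?a j) (?c j) e \<in> choices (level G (Suc (2 * j))) (src (level G (2 * j)) (e (2 * j)))"
          using E.label_tuple_choice[OF lab e] Suc e by simp
        show "label_tuple ?P ?s (?a j) (?c j) e |\<subseteq>| T"
        proof
          fix z assume "z |\<in>| label_tuple ?P ?s (?a j) (?c j) e"
          then consider "z = Alpha (?a j e) {|?c j e|}" | x where "x \<in> ?P" "?s x = e" "z = Alpha (?c j x) {|?a j x|}"
            unfolding E.in_label_tuple[OF lab e] by blast
          then show "z |\<in>| T"
          proof cases
            case 1
            then show ?thesis using T(3) gfs_points_odd(1)[OF e, of j] Suc e by simp
          next
            case (2 x)
            obtain T' v where T': "Alpha (red_at x j) {|x (2 * j)|} |\<in>| T'"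
              "src (level G (2 * Suc j)) (red_at x (Suc j)) = Tuple_vertex T'"
              using red_at_Suc[OF 2(1)] by metis
            have "T' = T" using T'(2) T(4) gfs_map_props(2)[OF 2(1), of "Suc j"] 2(2) by simp
            then show ?thesis using T'(1) 2 Suc by simp
          qed
        qed
      qed
      then show ?thesis using T by simp
    qed
    show ?case
    proof
      fix e assume e: "e \<in> ?P"
      have "?a (Suc j) e = e (2 * Suc j)"
        using tuple[OF e] Suc e gfs_points_odd(1)[OF e, of j] unfolding label_simps next_blue_def by simp
      moreover have "?c (Suc j) e = red_at e (Suc j)"
      proof -
        obtain T v where T: "red_at e (Suc j) = Alpha (Alpha (red_at e j) {|e (2 * j)|})
            (T |-| {|Alpha (red_at e j) {|e (2 * j)|}|})"
          "src (level G (2 * Suc j)) (red_at e (Suc j)) = Tuple_vertex T" using red_at_Suc[OF e] .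
        have "T = label_tuple ?P ?s (?a j) (?c j) (?s e)"
          using conjunct1[OF tuple[OF gfs_map_props(1)[OF e]]] T(2) gfs_map_props(2)[OF e, of "Suc j"]
          by (metis res_vertex.inject(2))
        then show ?thesis using T(1) Suc e unfolding label_simps next_red_def by simp
      qed
      ultimately show "?a (Suc j) e = e (2 * Suc j) \<and> ?c (Suc j) e = red_at e (Suc j)" ..
    qed
  qed (simp add: label_simps)
  show ?thesis
  proof
    fix i show "label_point ?P ?s (\<lambda>e. e 0) (\<lambda>e. red_at e 0) e i = e i"
      by (cases i rule: even_odd_cases) (use * e gfs_points_odd(1)[OF e] in \<open>simp_all add: label_point_simps\<close>)
  qed
qed

lemma label_point_equivariant:
  assumes lab: "labelling G 0 Y \<rho> a c" and y: "y \<in> Y"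
  shows "label_point Y \<rho> a c (\<rho> y) = gfs_map G (label_point Y \<rho> a c y)"
proof (rule sym, rule gfs_map_eqI)
  note \<rho>y = labellingD(1)[OF lab y]
  show "label_point Y \<rho> a c y \<in> gfs_points G" "label_point Y \<rho> a c (\<rho> y) \<in> gfs_points G"
    by (intro label_point_in_gfs_points[OF G lab] y \<rho>y)+
  fix j
  have "red_at (label_point Y \<rho> a c y) j = red_label Y \<rho> a c j y"
    by (rule red_at_eq) (simp add: label_point_simps)
  then show "src (level G (2 * j)) (label_point Y \<rho> a c (\<rho> y) (2 * j)) =
      src (level G (2 * j)) (red_at (label_point Y \<rho> a c y) j)"
    using labellingD(5)[OF labelling_iterate[OF G lab] y] by (simp add: label_point_simps)
qed

end

section \<open>Locally constant maps\<close>

definition locally_constant :: "'a topology \<Rightarrow> ('a \<Rightarrow> 'b) \<Rightarrow> bool" where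
  "locally_constant T f \<longleftrightarrow> (\<forall>v. openin T {x \<in> topspace T. f x = v})"

lemma locally_constant_openin:
  assumes "locally_constant T f"
  shows "openin T {x \<in> topspace T. P (f x)}"
proof -
  have "{x \<in> topspace T. P (f x)} = \<Union> {{x \<in> topspace T. f x = v} | v. P v}" by blast
  then show ?thesis using assms by (auto simp: locally_constant_def intro!: openin_Union)
qed

lemma locally_constant_closedin:
  assumes "locally_constant T f"
  shows "closedin T {x \<in> topspace T. P (f x)}"
proof -
  have "topspace T - {x \<in> topspace T. P (f x)} = {x \<in> topspace T. \<not> P (f x)}" by blast
  then show ?thesis using locally_constant_openin[OF assms, of "\<lambda>v. \<not> P v"] by (auto simp: closedin_def)
qed

lemma locally_constant_determined:
  assumes f: "locally_constant T f"
    and det: "\<And>x y. x \<in> topspace T \<Longrightarrow> y \<in> topspace T \<Longrightarrow> f x = f y \<Longrightarrow> g x = g y"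
  shows "locally_constant T g"
  unfolding locally_constant_def
proof
  fix v
  have "{x \<in> topspace T. g x = v} = {x \<in> topspace T. f x \<in> f ` {y \<in> topspace T. g y = v}}"
    using det by (auto simp: image_iff)
  then show "openin T {x \<in> topspace T. g x = v}"
    using locally_constant_openin[OF f, of "\<lambda>w. w \<in> f ` {y \<in> topspace T. g y = v}"] by simp
qed

lemma locally_constant_Pair:
  assumes "locally_constant T f" "locally_constant T g"
  shows "locally_constant T (\<lambda>x. (f x, g x))"
  unfolding locally_constant_def
proof
  fix v :: "'b \<times> 'c"
  have "{x \<in> topspace T. (f x, g x) = v} = {x \<in> topspace T. f x = fst v} \<inter> {x \<in> topspace T. g x = snd v}"
    by auto
  then show "openin T {x \<in> topspace T. (f x, g x) = v}"
    using assms by (auto simp: locally_constant_def)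
qed

lemma locally_constant_compose:
  assumes "continuous_map S T \<phi>" "locally_constant T f"
  shows "locally_constant S (\<lambda>x. f (\<phi> x))"
  unfolding locally_constant_def
proof
  fix v
  have eq: "{x \<in> topspace S. f (\<phi> x) = v} = {x \<in> topspace S. \<phi> x \<in> {y \<in> topspace T. f y = v}}"
    using continuous_map_image_subset_topspace[OF assms(1)] by auto
  show "openin S {x \<in> topspace S. f (\<phi> x) = v}"
    unfolding eq by (rule openin_continuous_map_preimage[OF assms(1) locally_constant_openin[OF assms(2)]])
qed

lemma locally_constant_finite_range:
  assumes f: "locally_constant T f" and T: "compact_space T"
  shows "finite (f ` topspace T)"
proof -
  let ?U = "(\<lambda>v. {x \<in> topspace T. f x = v}) ` f ` topspace T"
  have "\<forall>U\<in>?U. openin T U" using f by (simp add: locally_constant_def)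
  moreover have "topspace T \<subseteq> \<Union>?U" by auto
  ultimately have "(\<forall>U\<in>?U. openin T U) \<and> topspace T \<subseteq> \<Union>?U" by (rule conjI)
  from mp[OF spec[OF T[unfolded compact_space_alt]] this]
  obtain \<F> where \<F>: "finite \<F>" "\<F> \<subseteq> ?U" "topspace T \<subseteq> \<Union>\<F>" by (elim exE conjE)
  obtain W where W: "finite W" "\<F> = (\<lambda>v. {x \<in> topspace T. f x = v}) ` W"
    using finite_subset_image[OF \<F>(1,2)] by metis
  have "f ` topspace T \<subseteq> W" using \<F>(3) W(2) by auto
  then show ?thesis using W(1) finite_subset by blast
qed

lemma locally_constant_connectedin:
  assumes "locally_constant T f" "connectedin T S" "x \<in> S" "y \<in> S"
  shows "f x = f y"
proof -
  let ?C = "{z \<in> topspace T. f z = f x}"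
  have "S \<subseteq> ?C \<or> disjnt S ?C"
    by (rule connectedin_clopen_cases[OF assms(2)])
      (rule locally_constant_closedin[OF assms(1)] locally_constant_openin[OF assms(1)])+
  moreover have "x \<in> topspace T" using assms(2,3) connectedin_subset_topspace by blast
  ultimately show ?thesis using assms(3,4) by (auto simp: disjnt_iff)
qed

section \<open>Surjective local homeomorphisms of compact spaces\<close>

lemma LHomeoD:
  assumes "LHomeo T \<rho>"
  shows "compact_space T" "Hausdorff_space T" "continuous_map T T \<rho>" "\<rho> ` topspace T = topspace T"
    "\<And>U. openin T U \<Longrightarrow> openin T (\<rho> ` U)" "\<And>C. closedin T C \<Longrightarrow> closedin T (\<rho> ` C)"
proof -
  show comp: "compact_space T" and haus: "Hausdorff_space T" and im: "\<rho> ` topspace T = topspace T"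
    using assms metrizable_imp_Hausdorff_space by (auto simp: LHomeo_def)
  have "\<forall>x\<in>topspace T. \<exists>U. openin T U \<and> x \<in> U \<and> openin T (\<rho> ` U) \<and>
        homeomorphic_map (subtopology T U) (subtopology T (\<rho> ` U)) \<rho>"
    using assms by (simp add: LHomeo_def local_homeomorphism_map_def)
  then obtain N where N: "\<And>x. x \<in> topspace T \<Longrightarrow> openin T (N x) \<and> x \<in> N x \<and> openin T (\<rho> ` N x) \<and>
        homeomorphic_map (subtopology T (N x)) (subtopology T (\<rho> ` N x)) \<rho>" by metis
  have NT: "N x \<subseteq> topspace T" if "x \<in> topspace T" for x using N[OF that] openin_subset by blast
  have piece: "openin T (\<rho> ` (U \<inter> N x))" if U: "openin T U" and x: "x \<in> topspace T" for U x
  proof -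
    have "open_map (subtopology T (N x)) (subtopology T (\<rho> ` N x)) \<rho>"
      using N[OF x] homeomorphic_imp_open_map by blast
    moreover have "openin (subtopology T (N x)) (U \<inter> N x)" using U by (auto simp: openin_subtopology)
    ultimately have "openin (subtopology T (\<rho> ` N x)) (\<rho> ` (U \<inter> N x))" by (auto simp: open_map_def)
    then show ?thesis using N[OF x] openin_trans_full by blast
  qed
  show "openin T (\<rho> ` U)" if U: "openin T U" for U
  proof -
    have "\<rho> ` U = \<Union> ((\<lambda>x. \<rho> ` (U \<inter> N x)) ` U)" using N openin_subset[OF U] by blast
    then show ?thesis using piece[OF U] openin_subset[OF U] by (auto intro!: openin_Union)
  qed
  have pre: "openin T {x \<in> topspace T. \<rho> x \<in> V}" if V: "openin T V" for V
  proof -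
    have "openin T {z \<in> N x. \<rho> z \<in> V}" if x: "x \<in> topspace T" for x
    proof -
      have "continuous_map (subtopology T (N x)) (subtopology T (\<rho> ` N x)) \<rho>"
        using N[OF x] homeomorphic_imp_continuous_map by blast
      moreover have "openin (subtopology T (\<rho> ` N x)) (V \<inter> \<rho> ` N x)" using V by (auto simp: openin_subtopology)
      ultimately have "openin (subtopology T (N x)) {z \<in> topspace (subtopology T (N x)). \<rho> z \<in> V \<inter> \<rho> ` N x}"
        by (rule openin_continuous_map_preimage)
      moreover have "{z \<in> topspace (subtopology T (N x)). \<rho> z \<in> V \<inter> \<rho> ` N x} = {z \<in> N x. \<rho> z \<in> V}"
        using NT[OF x] by auto
      ultimately show ?thesis using N[OF x] openin_trans_full by metis
    qed
    moreover have "{x \<in> topspace T. \<rho> x \<in> V} = \<Union> ((\<lambda>x. {z \<in> N x. \<rho> z \<in> V}) ` topspace T)"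
      using N NT by blast
    ultimately show ?thesis by (auto intro!: openin_Union)
  qed
  show cont: "continuous_map T T \<rho>" unfolding continuous_map_def using pre im by auto
  show "closedin T (\<rho> ` C)" if "closedin T C" for C
    using continuous_imp_closed_map[OF cont comp haus] that by (auto simp: closed_map_def)
qed

text \<open>The set of values on a fibre is locally constant because \<open>\<rho>\<close> maps clopen sets to clopen sets.\<close>

lemma locally_constant_fibre_image:
  assumes T: "LHomeo T \<rho>" and f: "locally_constant T f"
  shows "locally_constant T (\<lambda>y. f ` {x \<in> topspace T. \<rho> x = y})"
  unfolding locally_constant_def
proof
  fix S
  let ?F = "f ` topspace T" and ?L = "\<lambda>y. f ` {x \<in> topspace T. \<rho> x = y}"
  have fin: "finite ?F" by (rule locally_constant_finite_range[OF f LHomeoD(1)[OF T]])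
  define A where "A v = {y \<in> topspace T. (v \<in> ?L y) = (v \<in> S)}" for v
  have A: "openin T (A v)" for v
  proof -
    have im: "{y \<in> topspace T. v \<in> ?L y} = \<rho> ` {x \<in> topspace T. f x = v}"
      using LHomeoD(4)[OF T] by (auto simp: image_iff)
    have o: "openin T {y \<in> topspace T. v \<in> ?L y}"
      unfolding im by (intro LHomeoD(5)[OF T] locally_constant_openin[OF f])
    have c: "closedin T {y \<in> topspace T. v \<in> ?L y}"
      unfolding im by (intro LHomeoD(6)[OF T] locally_constant_closedin[OF f])
    have "A v = (if v \<in> S then {y \<in> topspace T. v \<in> ?L y} else topspace T - {y \<in> topspace T. v \<in> ?L y})"
      by (auto simp: A_def)
    then show ?thesis using o c by auto
  qed
  show "openin T {y \<in> topspace T. ?L y = S}"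
  proof (cases "S \<subseteq> ?F")
    case False
    then have empty: "{y \<in> topspace T. ?L y = S} = {}" by blast
    show ?thesis unfolding empty by simp
  next
    case True
    then have "{y \<in> topspace T. ?L y = S} = (\<Inter>v\<in>?F. A v) \<inter> topspace T"
      unfolding A_def by auto
    moreover have "openin T ((\<Inter>v\<in>?F. A v) \<inter> topspace T)" using fin A by (rule openin_INT)
    ultimately show ?thesis by simp
  qed
qed


section \<open>The topology of a generalized finite shift\<close>

lemma topspace_gfs_space [simp]: "topspace (gfs_space G) = gfs_points G"
proof -
  have "e \<in> gfs_cylinder G 0 e" if "e \<in> gfs_points G" for e using that by (simp add: gfs_cylinder_def)
  then show ?thesis
    unfolding gfs_space_def topology_generated_by_topspace by (auto simp: gfs_cylinder_def)
qed

lemma openin_gfs_cylinder: "openin (gfs_space G) (gfs_cylinder G n p)"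
  unfolding gfs_space_def by (rule topology_generated_by_Basis) blast

lemma locally_constant_coordinate: "locally_constant (gfs_space G) (\<lambda>e. e i)"
  unfolding locally_constant_def
proof
  fix v
  have "{e \<in> topspace (gfs_space G). e i = v} = \<Union> {gfs_cylinder G i p | p. p i = v}"
    by (auto simp: gfs_cylinder_def)
  also have "openin (gfs_space G) \<dots>" by (intro openin_Union) (auto simp: openin_gfs_cylinder)
  finally show "openin (gfs_space G) {e \<in> topspace (gfs_space G). e i = v}" .
qed

lemma continuous_map_gfs_space:
  assumes "\<And>x. x \<in> topspace T \<Longrightarrow> f x \<in> gfs_points G" and lc: "\<And>i. locally_constant T (\<lambda>x. f x i)"
  shows "continuous_map T (gfs_space G) f"
  unfolding gfs_space_def
proof (rule continuous_on_generated_topo)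
  fix U assume "U \<in> {gfs_cylinder G n p | n p. True}"
  then obtain n p where U: "U = gfs_cylinder G n p" by blast
  have eq: "f -` U \<inter> topspace T = (\<Inter>i\<in>{..n}. {x \<in> topspace T. f x i = p i}) \<inter> topspace T"
    using assms(1) by (auto simp: U gfs_cylinder_def)
  show "openin T (f -` U \<inter> topspace T)"
    unfolding eq using lc by (intro openin_INT) (auto simp: locally_constant_def)
next
  show "f ` topspace T \<subseteq> \<Union> {gfs_cylinder G n p | n p. True}"
    using assms(1) topspace_gfs_space[of G] unfolding gfs_space_def topology_generated_by_topspace by blast
qed

context
  fixes G :: "('v, 'e, 'z) shift_graph_scheme"
  assumes G: "generalized_finite_shift_graph G"
begin

lemma finite_blue_edges: "finite (blue_edges G i)"
proof (cases i rule: even_odd_cases)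
  case (1 j)
  interpret E: even_level G "2 * j" by (rule even_level[OF G])
  show ?thesis unfolding 1 blue_edges_def using E.finite_edges by simp
next
  case (2 j)
  interpret E: even_level G "2 * j" by (rule even_level[OF G])
  show ?thesis unfolding 2 blue_edges_def using E.finite_edges_odd by simp
qed

text \<open>The cylinder topology is the subspace topology of a closed subset of a countable product of finite
  discrete spaces.\<close>

lemma gfs_space_compact_metrizable: "compact_space (gfs_space G)" "metrizable_space (gfs_space G)"
proof -
  let ?P = "product_topology (\<lambda>i. discrete_topology (blue_edges G i)) UNIV"
  have coord: "locally_constant ?P (\<lambda>e. e i)" for i
    unfolding locally_constant_def
  proof
    fix v
    have eq: "{e \<in> topspace ?P. e i = v} = {e \<in> topspace ?P. e i \<in> {v} \<inter> blue_edges G i}"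
      by (auto simp: topspace_product_topology)
    show "openin ?P {e \<in> topspace ?P. e i = v}"
      unfolding eq by (rule openin_continuous_map_preimage[OF continuous_map_product_projection]) auto
  qed
  define C where "C i = {e \<in> topspace ?P. rng (level G (Suc i)) (e (Suc i)) = src (level G i) (e i)}" for i
  have "closedin ?P (C i)" for i
    using locally_constant_closedin[OF locally_constant_Pair[OF coord[of i] coord[of "Suc i"]],
        of "\<lambda>(x, y). rng (level G (Suc i)) y = src (level G i) x"] by (simp add: C_def)
  then have "closedin ?P (\<Inter>i\<in>UNIV. C i)" by (intro closedin_INT) auto
  moreover have "gfs_points G = (\<Inter>i\<in>UNIV. C i)"
    by (auto simp: gfs_points_def C_def topspace_product_topology PiE_def Pi_def)
  ultimately have closed: "closedin ?P (gfs_points G)" by simp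
  let ?K = "subtopology ?P (gfs_points G)"
  have sub: "topspace ?K = gfs_points G" using closedin_subset[OF closed] by auto
  have "compact_space ?P"
    unfolding compact_space_product_topology using finite_blue_edges by (simp add: compact_space_discrete_topology)
  then have "compact_space ?K" using closed closedin_compact_space compact_space_subtopology by blast
  moreover have "metrizable_space ?K"
    by (rule metrizable_space_subtopology) (simp add: metrizable_space_product_topology)
  moreover have "?K homeomorphic_space gfs_space G"
  proof (rule homeomorphic_maps_imp_homeomorphic_space)
    have "continuous_map ?K (gfs_space G) (\<lambda>x. x)"
    proof (rule continuous_map_gfs_space)
      fix i show "locally_constant ?K (\<lambda>x. x i)"
        by (rule locally_constant_compose[OF _ coord]) (rule continuous_map_from_subtopology, simp)
    qed (use sub in simp)
    moreover have "continuous_map (gfs_space G) ?K (\<lambda>x. x)"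
      unfolding continuous_map_in_subtopology
    proof
      have "continuous_map (gfs_space G) (discrete_topology (blue_edges G i)) (\<lambda>e. e i)" for i
        unfolding continuous_map_def
      proof
        show "(\<lambda>e. e i) \<in> topspace (gfs_space G) \<rightarrow> topspace (discrete_topology (blue_edges G i))"
          by (auto simp: gfs_points_def)
        show "\<forall>U. openin (discrete_topology (blue_edges G i)) U \<longrightarrow>
            openin (gfs_space G) {x \<in> topspace (gfs_space G). x i \<in> U}"
          by (intro allI impI locally_constant_openin[OF locally_constant_coordinate])
      qed
      then show "continuous_map (gfs_space G) ?P (\<lambda>x. x)" by (simp add: continuous_map_componentwise_UNIV)
    qed simp
    ultimately show "homeomorphic_maps ?K (gfs_space G) (\<lambda>x. x) (\<lambda>x. x)" by (simp add: homeomorphic_maps_def)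
  qed
  ultimately show "compact_space (gfs_space G)" "metrizable_space (gfs_space G)"
    using homeomorphic_compact_space homeomorphic_metrizable_space by blast+
qed

lemma gfs_space_totally_disconnected: "totally_disconnected_space (gfs_space G)"
  unfolding totally_disconnected_space_def
proof (intro allI impI)
  fix S assume S: "connectedin (gfs_space G) S"
  have "x = y" if "x \<in> S" "y \<in> S" for x y
    using locally_constant_connectedin[OF locally_constant_coordinate S that] by blast
  then show "\<exists>a. S \<subseteq> {a}" by blast
qed

lemma locally_constant_red_at: "locally_constant (gfs_space G) (\<lambda>e. red_at e j)"
  by (rule locally_constant_determined[OF locally_constant_Pair[OF
        locally_constant_coordinate[of _ "2 * j"] locally_constant_coordinate[of _ "Suc (2 * j)"]]])
    (simp add: red_at_def)

lemma continuous_gfs_map: "continuous_map (gfs_space G) (gfs_space G) (gfs_map G)"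
proof (rule continuous_map_gfs_space)
  have even: "locally_constant (gfs_space G) (\<lambda>e. gfs_map G e (2 * j))" for j
  proof (rule locally_constant_determined[OF locally_constant_red_at[of j]])
    fix x y assume xy: "x \<in> topspace (gfs_space G)" "y \<in> topspace (gfs_space G)" "red_at x j = red_at y j"
    interpret E: even_level G "2 * j" by (rule even_level[OF G])
    show "gfs_map G x (2 * j) = gfs_map G y (2 * j)"
      by (rule inj_onD[OF E.src_blue_inj])
        (use xy gfs_map_props[OF G] gfs_points_blue[OF G gfs_map_props(1)[OF G]] in simp_all)
  qed
  fix i show "locally_constant (gfs_space G) (\<lambda>e. gfs_map G e i)"
  proof (cases i rule: even_odd_cases)
    case (2 j)
    show ?thesis
    proof (rule locally_constant_determined[OF even[of "Suc j"]])
      fix x y assume xy: "x \<in> topspace (gfs_space G)" "y \<in> topspace (gfs_space G)"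
        and eq: "gfs_map G x (2 * Suc j) = gfs_map G y (2 * Suc j)"
      interpret E: even_level G "2 * j" by (rule even_level[OF G])
      have p: "gfs_map G x \<in> gfs_points G" "gfs_map G y \<in> gfs_points G"
        using xy gfs_map_props(1)[OF G] by simp_all
      have "gfs_map G x i \<in> blue_edges G i" "gfs_map G y i \<in> blue_edges G i"
        by (rule gfs_points_blue[OF G p(1)], rule gfs_points_blue[OF G p(2)])
      moreover have "src (level G i) (gfs_map G x i) = src (level G i) (gfs_map G y i)"
        using gfs_points_rng[OF G p(1), of i] gfs_points_rng[OF G p(2), of i] eq by (simp add: 2)
      ultimately show "gfs_map G x i = gfs_map G y i"
        using E.src_odd_inj unfolding 2 blue_edges_def by blast
    qed
  qed (simp add: even)
qed (simp add: gfs_map_props(1)[OF G])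

end

text \<open>On the clopen piece of a red edge \<open>\<rho>\<close> is a continuous bijection onto a clopen set, hence a
  homeomorphism by compactness. It is surjective since every source vertex is the source of a red
  edge.\<close>

lemma local_homeomorphism_of_labelling:
  assumes "even_level G n" and lab: "labelling G n (topspace T) \<rho> a c"
    and lc: "locally_constant T a" "locally_constant T c"
    and T: "compact_space T" "Hausdorff_space T" and cont: "continuous_map T T \<rho>"
  shows "local_homeomorphism_map T T \<rho>" "\<rho> ` topspace T = topspace T"
proof -
  interpret even_level G n by fact
  show "\<rho> ` topspace T = topspace T"
  proof (intro equalityI subsetI)
    fix y assume y: "y \<in> topspace T"
    have "src (level G n) (a y) \<in> src (level G n) ` red_edges G n"
      using labellingD(2)[OF lab y] src_blue src_red by blast
    then obtain k where "k \<in> red_edges G n" "src (level G n) k = src (level G n) (a y)" by (elim imageE) metis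
    then obtain x where "x \<in> topspace T" "\<rho> x = y" using labelling_lift[OF lab y] by metis
    then show "y \<in> \<rho> ` topspace T" by blast
  qed (use labellingD(1)[OF lab] in blast)
  show "local_homeomorphism_map T T \<rho>"
    unfolding local_homeomorphism_map_def
  proof
    fix x assume x: "x \<in> topspace T"
    let ?U = "{z \<in> topspace T. c z = c x}" and ?V = "{z \<in> topspace T. src (level G n) (a z) = src (level G n) (c x)}"
    have im: "\<rho> ` ?U = ?V"
    proof (intro equalityI subsetI)
      fix y assume "y \<in> \<rho> ` ?U"
      then obtain z where "z \<in> topspace T" "c z = c x" "y = \<rho> z" by blast
      then show "y \<in> ?V" using labellingD(1,5)[OF lab, of z] by simp
    next
      fix y assume "y \<in> ?V"
      then obtain z where "z \<in> topspace T" "\<rho> z = y" "c z = c x"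
        using labelling_lift[OF lab _ labellingD(3)[OF lab x], of y] by auto
      then show "y \<in> \<rho> ` ?U" by blast
    qed
    have U: "openin T ?U" "closedin T ?U" and V: "openin T ?V"
      by - (rule locally_constant_openin[OF lc(2)] locally_constant_closedin[OF lc(2)]
        locally_constant_openin[OF lc(1)])+
    have "homeomorphic_map (subtopology T ?U) (subtopology T ?V) \<rho>"
    proof (rule continuous_imp_homeomorphic_map)
      show "continuous_map (subtopology T ?U) (subtopology T ?V) \<rho>"
        using cont im by (auto simp: continuous_map_in_subtopology continuous_map_from_subtopology)
      show "compact_space (subtopology T ?U)"
        using U(2) T(1) closedin_compact_space compact_space_subtopology by blast
      show "Hausdorff_space (subtopology T ?V)" using T(2) Hausdorff_space_subtopology by blast
      have "topspace (subtopology T ?U) = ?U" "topspace (subtopology T ?V) = ?V" by auto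
      then show "\<rho> ` topspace (subtopology T ?U) = topspace (subtopology T ?V)"
        "inj_on \<rho> (topspace (subtopology T ?U))"
        using im labelling_inj[OF lab] by (auto intro!: inj_onI)
    qed
    then show "\<exists>U. openin T U \<and> x \<in> U \<and> openin T (\<rho> ` U) \<and>
        homeomorphic_map (subtopology T U) (subtopology T (\<rho> ` U)) \<rho>"
      using U(1) V x im by (intro exI[of _ ?U]) simp
  qed
qed

lemma LHomeo_gfs:
  assumes G: "generalized_finite_shift_graph G"
  shows "LHomeo (gfs_space G) (gfs_map G)"
proof -
  have lab: "labelling G 0 (topspace (gfs_space G)) (gfs_map G) (\<lambda>e. e 0) (\<lambda>e. red_at e 0)"
    using canonical_labelling[OF G] by simp
  note c = gfs_space_compact_metrizable[OF G]
  show ?thesis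
    unfolding LHomeo_def
    using local_homeomorphism_of_labelling[OF even_level_0[OF G] lab locally_constant_coordinate
        locally_constant_red_at[OF G] c(1) metrizable_imp_Hausdorff_space[OF c(2)] continuous_gfs_map[OF G]]
      c gfs_space_totally_disconnected[OF G] by blast
qed

lemma locally_constant_labels:
  assumes T: "LHomeo T \<rho>" and lc: "locally_constant T a" "locally_constant T c"
  shows "locally_constant T (blue_label (topspace T) \<rho> a c j) \<and> locally_constant T (red_label (topspace T) \<rho> a c j)"
proof (induction j)
  case (Suc j)
  let ?a = "blue_label (topspace T) \<rho> a c j" and ?c = "red_label (topspace T) \<rho> a c j"
  have lc: "locally_constant T ?a" "locally_constant T ?c" using Suc by auto
  have fib: "locally_constant T (\<lambda>y. (\<lambda>x. Alpha (?c x) {|?a x|}) ` {x \<in> topspace T. \<rho> x = y})"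
    by (rule locally_constant_fibre_image[OF T])
      (rule locally_constant_determined[OF locally_constant_Pair[OF lc]], simp)
  have tuple: "locally_constant T (label_tuple (topspace T) \<rho> ?a ?c)"
    by (rule locally_constant_determined[OF locally_constant_Pair[OF locally_constant_Pair[OF lc] fib]])
      (simp add: label_tuple_def)
  have "locally_constant T (next_blue (topspace T) \<rho> ?a ?c)"
    by (rule locally_constant_determined[OF locally_constant_Pair[OF locally_constant_Pair[OF lc] tuple]])
      (simp add: next_blue_def)
  moreover have "locally_constant T (next_red (topspace T) \<rho> ?a ?c)"
    by (rule locally_constant_determined[OF locally_constant_Pair[OF locally_constant_Pair[OF lc]
            locally_constant_compose[OF LHomeoD(3)[OF T] tuple]]])
      (simp add: next_red_def)
  ultimately show ?case by (simp add: label_simps)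
qed (use lc in \<open>simp add: label_simps\<close>)

lemma label_point_morphism:
  assumes G: "generalized_finite_shift_graph G" and T: "LHomeo T \<rho>"
    and lab: "labelling G 0 (topspace T) \<rho> a c" and lc: "locally_constant T a" "locally_constant T c"
  shows "LHomeo_morphism T \<rho> (gfs_space G) (gfs_map G) (label_point (topspace T) \<rho> a c)"
  unfolding LHomeo_morphism_def
proof (intro conjI ballI)
  show "continuous_map T (gfs_space G) (label_point (topspace T) \<rho> a c)"
  proof (rule continuous_map_gfs_space)
    fix i
    have l: "locally_constant T (blue_label (topspace T) \<rho> a c (i div 2))"
      "locally_constant T (red_label (topspace T) \<rho> a c (i div 2))"
      using locally_constant_labels[OF T lc] by auto
    show "locally_constant T (\<lambda>x. label_point (topspace T) \<rho> a c x i)"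
      by (rule locally_constant_determined[OF locally_constant_Pair[OF l]]) (simp add: label_point_def)
  qed (rule label_point_in_gfs_points[OF G lab])
qed (rule label_point_equivariant[OF G lab])

section \<open>Clopen sets in totally disconnected compact metrizable spaces\<close>

text \<open>In a compact Hausdorff space a point can be separated by a clopen set from every closed set that no
  connected set joins to it.\<close>

lemma clopen_neighbourhood:
  assumes "totally_disconnected_space T" "compact_space T" "Hausdorff_space T"
    and U: "openin T U" "x \<in> U"
  obtains C where "openin T C" "closedin T C" "x \<in> C" "C \<subseteq> U"
proof -
  have x: "x \<in> topspace T" using U openin_subset by blast
  have "separated_between T {x} (topspace T - U)"
  proof (rule cut_wire_fence_theorem_gen)
    show "disjnt C {x} \<or> disjnt C (topspace T - U)" if conn: "connectedin T C" for C
    proof -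
      obtain a where "C \<subseteq> {a}" using assms(1) conn unfolding totally_disconnected_space_def by blast
      then show ?thesis using U(2) by (auto simp: disjnt_iff)
    qed
  qed (use assms x U in \<open>auto simp: closedin_def\<close>)
  then obtain A B where AB: "openin T A" "openin T B" "A \<union> B = topspace T" "disjnt A B" "{x} \<subseteq> A" "topspace T - U \<subseteq> B"
    unfolding separated_between_def by blast
  show thesis
  proof (rule that[of A])
    have "topspace T - A = B" using AB(3,4) by (auto simp: disjnt_iff)
    then show "closedin T A" using AB openin_subset[OF AB(1)] by (simp add: closedin_def)
    show "A \<subseteq> U" using AB(3,4,6) by (auto simp: disjnt_iff)
  qed (use AB in auto)
qed

text \<open>For every \<open>n\<close> compactness provides finitely many clopen sets, each contained in a ball of radius
  \<open>1 / (n + 1)\<close>, that cover the space; together they form a basis.\<close>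

lemma countable_clopen_basis:
  assumes td: "totally_disconnected_space T" and comp: "compact_space T" and metr: "metrizable_space T"
  obtains C :: "nat \<Rightarrow> 'a set" where "\<And>n. openin T (C n)" "\<And>n. closedin T (C n)"
    "\<And>U x. openin T U \<Longrightarrow> x \<in> U \<Longrightarrow> \<exists>n. x \<in> C n \<and> C n \<subseteq> U"
proof -
  obtain M d where "Metric_space M d" and T: "T = Metric_space.mtopology M d"
    using metr unfolding metrizable_space_def by blast
  then interpret Metric_space M d by simp
  have top: "topspace T = M" by (simp add: T)
  have "\<exists>\<F>. finite \<F> \<and> (\<forall>C\<in>\<F>. openin T C \<and> closedin T C \<and> (\<exists>z\<in>M. C \<subseteq> mball z (1 / Suc n))) \<and> M \<subseteq> \<Union>\<F>" for n :: nat
  proof -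
    let ?U = "{C. openin T C \<and> closedin T C \<and> (\<exists>z\<in>M. C \<subseteq> mball z (1 / Suc n))}"
    have "\<exists>C\<in>?U. x \<in> C" if "x \<in> M" for x
    proof -
      have "openin T (mball x (1 / Suc n))" "x \<in> mball x (1 / Suc n)" using that by (simp_all add: T)
      then obtain C where "openin T C" "closedin T C" "x \<in> C" "C \<subseteq> mball x (1 / Suc n)"
        by (rule clopen_neighbourhood[OF td comp metrizable_imp_Hausdorff_space[OF metr]])
      then show ?thesis using that by blast
    qed
    then have "(\<forall>C\<in>?U. openin T C) \<and> topspace T \<subseteq> \<Union>?U" unfolding top by blast
    from mp[OF spec[OF comp[unfolded compact_space_alt]] this]
    obtain \<F> where "finite \<F>" "\<F> \<subseteq> ?U" "topspace T \<subseteq> \<Union>\<F>" by (elim exE conjE)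
    then show ?thesis unfolding top by (intro exI[of _ \<F>]) blast
  qed
  then obtain F where F: "\<And>n. finite (F n)"
    "\<And>n C. C \<in> F n \<Longrightarrow> openin T C \<and> closedin T C \<and> (\<exists>z\<in>M. C \<subseteq> mball z (1 / Suc n))" "\<And>n. M \<subseteq> \<Union>(F n)"
    by metis
  define A where "A = insert {} (\<Union>n. F n)"
  have A: "countable A" "A \<noteq> {}" unfolding A_def using F(1) by (auto intro: countable_finite)
  have clopen: "openin T C \<and> closedin T C" if "C \<in> A" for C using that F(2) unfolding A_def by auto
  show thesis
  proof (rule that[of "from_nat_into A"])
    show "openin T (from_nat_into A n)" "closedin T (from_nat_into A n)" for n
      using clopen[OF from_nat_into[OF A(2)]] by auto
    fix U x assume U: "openin T U" "x \<in> U"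
    obtain r where r: "r > 0" "mball x r \<subseteq> U" using U unfolding T openin_mtopology by blast
    have x: "x \<in> M" using U openin_subset top by blast
    obtain n :: nat where n: "1 / Suc n < r / 2" using r(1) by (metis half_gt_zero nat_approx_posE)
    obtain C where C: "C \<in> F n" "x \<in> C" using F(3) x by blast
    obtain z where z: "z \<in> M" "C \<subseteq> mball z (1 / Suc n)" using F(2)[OF C(1)] by blast
    have "C \<subseteq> mball x r"
    proof
      fix y assume "y \<in> C"
      then have y: "y \<in> M" "d z y < 1 / Suc n" "d z x < 1 / Suc n" using z C(2) by (auto simp: subset_iff)
      have "d x y \<le> d z x + d z y" using triangle'[of z y x] x y z by (metis commute triangle)
      then show "y \<in> mball x r" using x y n by simp
    qed
    moreover have "C \<in> A" using C(1) unfolding A_def by blast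
    then obtain k where "from_nat_into A k = C" using from_nat_into_surj[OF A(1)] by metis
    ultimately show "\<exists>n. x \<in> from_nat_into A n \<and> from_nat_into A n \<subseteq> U" using C(2) r(2) by blast
  qed
qed

section \<open>The shift graph of a clopen partition\<close>

text \<open>The code of the piece of \<open>y\<close> in the common refinement of the partition by \<open>q\<close> and of the images of
  its pieces under \<open>\<sigma>\<close>: a value \<open>q x\<close> occurs on the fibre over \<open>y\<close> exactly if \<open>y\<close> lies in the image
  of that piece.\<close>

definition fibre_code :: "'a set \<Rightarrow> ('a \<Rightarrow> 'a) \<Rightarrow> ('a \<Rightarrow> nat) \<Rightarrow> 'a \<Rightarrow> nat" where
  "fibre_code S \<sigma> q y = prod_encode (q y, set_encode (q ` {x \<in> S. \<sigma> x = y}))"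

definition image_code :: "'a set \<Rightarrow> ('a \<Rightarrow> 'a) \<Rightarrow> ('a \<Rightarrow> nat) \<Rightarrow> 'a \<Rightarrow> nat" where
  "image_code S \<sigma> q x = prod_encode (q x, fibre_code S \<sigma> q (\<sigma> x))"

text \<open>Parity keeps the codes apart: range vertices and blue edges are even, source vertices and red edges
  are odd. A blue edge has its own code as source, a red edge the code of the image.\<close>

definition partition_graph :: "'a set \<Rightarrow> ('a \<Rightarrow> 'a) \<Rightarrow> ('a \<Rightarrow> nat) \<Rightarrow> (nat, nat) shift_graph" where
  "partition_graph S \<sigma> q =
     (let B = (\<lambda>v. {2 * fibre_code S \<sigma> q x | x. x \<in> S \<and> 2 * q x = v});
          R = (\<lambda>v. {Suc (2 * image_code S \<sigma> q x) | x. x \<in> S \<and> 2 * q x = v})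
      in \<lparr>V0 = (\<lambda>x. 2 * q x) ` S,
          V1 = (\<lambda>x. Suc (2 * fibre_code S \<sigma> q x)) ` S,
          edges = (\<lambda>x. 2 * fibre_code S \<sigma> q x) ` S \<union> (\<lambda>x. Suc (2 * image_code S \<sigma> q x)) ` S,
          rng = (\<lambda>e. 2 * fst (prod_decode (e div 2))),
          src = (\<lambda>e. if even e then Suc e else Suc (2 * snd (prod_decode (e div 2)))),
          classes = (\<lambda>v. if even v then {B v, R v} else {}),
          blue = B, red = R\<rparr>)"

definition blue_code :: "'a set \<Rightarrow> ('a \<Rightarrow> 'a) \<Rightarrow> ('a \<Rightarrow> nat) \<Rightarrow> 'a \<Rightarrow> nat res_edge" where
  "blue_code S \<sigma> q x = Base_edge (2 * fibre_code S \<sigma> q x)"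

definition red_code :: "'a set \<Rightarrow> ('a \<Rightarrow> 'a) \<Rightarrow> ('a \<Rightarrow> nat) \<Rightarrow> 'a \<Rightarrow> nat res_edge" where
  "red_code S \<sigma> q x = Base_edge (Suc (2 * image_code S \<sigma> q x))"

lemma parity: "2 * m \<noteq> Suc (2 * k)" "Suc (2 * k) \<noteq> 2 * m" for m k :: nat
  by presburger+

context
  fixes S :: "'a set" and \<sigma> :: "'a \<Rightarrow> 'a" and q :: "'a \<Rightarrow> nat"
  assumes surj: "\<sigma> ` S = S" and fin: "finite (q ` S)"
begin

lemma partition_graph_simps:
  "V0 (partition_graph S \<sigma> q) = (\<lambda>x. 2 * q x) ` S"
  "V1 (partition_graph S \<sigma> q) = (\<lambda>x. Suc (2 * fibre_code S \<sigma> q x)) ` S"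
  "edges (partition_graph S \<sigma> q) =
     (\<lambda>x. 2 * fibre_code S \<sigma> q x) ` S \<union> (\<lambda>x. Suc (2 * image_code S \<sigma> q x)) ` S"
  "rng (partition_graph S \<sigma> q) (2 * fibre_code S \<sigma> q x) = 2 * q x"
  "rng (partition_graph S \<sigma> q) (Suc (2 * image_code S \<sigma> q x)) = 2 * q x"
  "even (rng (partition_graph S \<sigma> q) e)"
  "src (partition_graph S \<sigma> q) (2 * fibre_code S \<sigma> q x) = Suc (2 * fibre_code S \<sigma> q x)"
  "src (partition_graph S \<sigma> q) (Suc (2 * image_code S \<sigma> q x)) = Suc (2 * fibre_code S \<sigma> q (\<sigma> x))"
  "classes (partition_graph S \<sigma> q) v = (if even v then {blue (partition_graph S \<sigma> q) v, red (partition_graph S \<sigma> q) v} else {})"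
  "blue (partition_graph S \<sigma> q) v = (\<lambda>x. 2 * fibre_code S \<sigma> q x) ` {x \<in> S. 2 * q x = v}"
  "red (partition_graph S \<sigma> q) v = (\<lambda>x. Suc (2 * image_code S \<sigma> q x)) ` {x \<in> S. 2 * q x = v}"
  by (auto simp: partition_graph_def Let_def fibre_code_def image_code_def)

lemma \<sigma>_in: "x \<in> S \<Longrightarrow> \<sigma> x \<in> S"
  using surj by blast

lemma finite_fibre_values: "finite (q ` {x \<in> S. \<sigma> x = y})"
  by (rule finite_subset[OF _ fin]) blast

lemma finite_codes: "finite (fibre_code S \<sigma> q ` S)" "finite (image_code S \<sigma> q ` S)"
proof -
  have "fibre_code S \<sigma> q ` S \<subseteq> (\<lambda>(v, W). prod_encode (v, set_encode W)) ` (q ` S \<times> Pow (q ` S))"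
  proof
    fix v assume "v \<in> fibre_code S \<sigma> q ` S"
    then obtain y where y: "y \<in> S" "v = fibre_code S \<sigma> q y" by blast
    show "v \<in> (\<lambda>(v, W). prod_encode (v, set_encode W)) ` (q ` S \<times> Pow (q ` S))"
      by (rule image_eqI[of _ _ "(q y, q ` {x \<in> S. \<sigma> x = y})"]) (use y in \<open>auto simp: fibre_code_def\<close>)
  qed
  then show f: "finite (fibre_code S \<sigma> q ` S)" by (rule finite_subset) (use fin in simp)
  have "image_code S \<sigma> q ` S \<subseteq> prod_encode ` (q ` S \<times> fibre_code S \<sigma> q ` S)"
    unfolding image_code_def using \<sigma>_in by blast
  then show "finite (image_code S \<sigma> q ` S)" by (rule finite_subset) (use fin f in simp)
qed

lemma fibre_code_eqD: "fibre_code S \<sigma> q x = fibre_code S \<sigma> q y \<Longrightarrow>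
    q x = q y \<and> q ` {z \<in> S. \<sigma> z = x} = q ` {z \<in> S. \<sigma> z = y}"
  unfolding fibre_code_def using set_encode_eq[OF finite_fibre_values finite_fibre_values] by auto

lemma gfs_partition_graph: "generalized_finite_shift_graph (partition_graph S \<sigma> q)" (is "generalized_finite_shift_graph ?G")
proof -
  note [simp] = partition_graph_simps
  have part: "partition_on {e \<in> edges ?G. rng ?G e = v} (classes ?G v)" if v: "v \<in> V0 ?G \<union> V1 ?G" for v
  proof (cases "even v")
    case True
    then obtain x where x: "x \<in> S" "v = 2 * q x" using v by auto
    have eq: "{e \<in> edges ?G. rng ?G e = v} = blue ?G v \<union> red ?G v" by auto
    have "blue ?G v \<inter> red ?G v = {}" using parity by auto
    moreover have "blue ?G v \<noteq> {}" "red ?G v \<noteq> {}" using x by auto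
    moreover have "classes ?G v = {blue ?G v, red ?G v}" using True by simp
    ultimately show ?thesis unfolding eq by (auto simp only: partition_on_def disjoint_def)
  next
    case False
    then have "{e \<in> edges ?G. rng ?G e = v} = {}" "classes ?G v = {}" using partition_graph_simps(6) by auto
    then show ?thesis by (simp only:) (simp add: partition_on_def)
  qed
  have fbs: "finite_bipartite_separated_graph ?G"
    unfolding finite_bipartite_separated_graph_def
  proof (intro conjI ballI part)
    show "finite (V0 ?G)" "finite (V1 ?G)" "finite (edges ?G)"
      using finite_imageI[OF fin, of "\<lambda>v. 2 * v"] finite_imageI[OF finite_codes(1), of "\<lambda>v. Suc (2 * v)"]
        finite_imageI[OF finite_codes(1), of "\<lambda>v. 2 * v"] finite_imageI[OF finite_codes(2), of "\<lambda>v. Suc (2 * v)"]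
      by (simp_all add: image_image)
    show "V0 ?G \<inter> V1 ?G = {}" using parity by auto
    show "src ?G ` edges ?G = V1 ?G" by (auto simp: image_Un image_image intro: \<sigma>_in)
    show "rng ?G ` edges ?G = V0 ?G" by (auto simp: image_Un image_image)
  qed
  have srcb: "src ?G ` blue ?G v = (\<lambda>x. Suc (2 * fibre_code S \<sigma> q x)) ` {x \<in> S. 2 * q x = v}" for v
    by (simp add: image_image)
  have srcr: "src ?G ` red ?G v = (\<lambda>x. Suc (2 * fibre_code S \<sigma> q (\<sigma> x))) ` {x \<in> S. 2 * q x = v}" for v
    by (simp add: image_image)
  have "\<forall>v \<in> V0 ?G. classes ?G v = {blue ?G v, red ?G v} \<and> blue ?G v \<noteq> red ?G v \<and>
        blue ?G v \<noteq> {} \<and> red ?G v \<noteq> {}"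
  proof
    fix v assume "v \<in> V0 ?G"
    then obtain x where x: "x \<in> S" "v = 2 * q x" by auto
    have "2 * fibre_code S \<sigma> q x \<in> blue ?G v" "2 * fibre_code S \<sigma> q x \<notin> red ?G v" "red ?G v \<noteq> {}"
      using x parity by auto
    then show "classes ?G v = {blue ?G v, red ?G v} \<and> blue ?G v \<noteq> red ?G v \<and>
        blue ?G v \<noteq> {} \<and> red ?G v \<noteq> {}" using x(2) by (auto simp del: partition_graph_simps(10,11))
  qed
  moreover have "V1 ?G = (\<Union>v\<in>V0 ?G. src ?G ` blue ?G v)" unfolding srcb by auto
  moreover have "disjoint_family_on (\<lambda>v. src ?G ` blue ?G v) (V0 ?G)"
    unfolding disjoint_family_on_def srcb by auto (metis fibre_code_eqD)
  moreover have "V1 ?G = (\<Union>v\<in>V0 ?G. src ?G ` red ?G v)"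
  proof -
    have "(\<Union>v\<in>V0 ?G. src ?G ` red ?G v) = (\<lambda>x. Suc (2 * fibre_code S \<sigma> q x)) ` \<sigma> ` S"
      unfolding srcr by auto
    then show ?thesis unfolding surj by simp
  qed
  moreover have "\<forall>v \<in> V0 ?G. inj_on (src ?G) (blue ?G v)" by (auto intro!: inj_onI)
  ultimately show ?thesis using fbs unfolding generalized_finite_shift_graph_def by blast
qed

lemma partition_graph_level_0:
  "blue_edges (partition_graph S \<sigma> q) 0 = blue_code S \<sigma> q ` S" (is "blue_edges ?G 0 = _")
  "red_edges (partition_graph S \<sigma> q) 0 = red_code S \<sigma> q ` S"
  "rng (level (partition_graph S \<sigma> q) 0) (blue_code S \<sigma> q x) = Base_vertex (2 * q x)"
  "rng (level (partition_graph S \<sigma> q) 0) (red_code S \<sigma> q x) = Base_vertex (2 * q x)"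
  "src (level (partition_graph S \<sigma> q) 0) (blue_code S \<sigma> q x) = Base_vertex (Suc (2 * fibre_code S \<sigma> q x))"
  "src (level (partition_graph S \<sigma> q) 0) (red_code S \<sigma> q x) = Base_vertex (Suc (2 * fibre_code S \<sigma> q (\<sigma> x)))"
proof -
  note [simp] = partition_graph_simps
  have e: "edges (level ?G 0) = blue_code S \<sigma> q ` S \<union> red_code S \<sigma> q ` S"
    by (auto simp: base_level_def blue_code_def red_code_def)
  have b: "is_blue ?G (blue_code S \<sigma> q x)" "\<not> is_red ?G (blue_code S \<sigma> q x)"
    "\<not> is_blue ?G (red_code S \<sigma> q x)" "is_red ?G (red_code S \<sigma> q x)" if "x \<in> S" for x
    using that parity unfolding blue_code_def red_code_def by auto
  show "blue_edges ?G 0 = blue_code S \<sigma> q ` S" "red_edges ?G 0 = red_code S \<sigma> q ` S"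
    unfolding blue_edges_def red_edges_def e using b by blast+
  show "rng (level ?G 0) (blue_code S \<sigma> q x) = Base_vertex (2 * q x)"
    "rng (level ?G 0) (red_code S \<sigma> q x) = Base_vertex (2 * q x)"
    "src (level ?G 0) (blue_code S \<sigma> q x) = Base_vertex (Suc (2 * fibre_code S \<sigma> q x))"
    "src (level ?G 0) (red_code S \<sigma> q x) = Base_vertex (Suc (2 * fibre_code S \<sigma> q (\<sigma> x)))"
    by (simp_all add: base_level_def blue_code_def red_code_def)
qed

text \<open>A red edge with the source of the blue label of \<open>y\<close> names a piece that meets the fibre over \<open>y\<close>, and
  it meets it once because \<open>\<sigma>\<close> is injective on pieces.\<close>

lemma labelling_partition_graph:
  assumes inj: "\<And>x y. x \<in> S \<Longrightarrow> y \<in> S \<Longrightarrow> \<sigma> x = \<sigma> y \<Longrightarrow> q x = q y \<Longrightarrow> x = y"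
  shows "labelling (partition_graph S \<sigma> q) 0 S \<sigma> (blue_code S \<sigma> q) (red_code S \<sigma> q)"
  unfolding labelling_def partition_graph_level_0
proof (intro conjI ballI impI)
  fix y k assume y: "y \<in> S" and k: "k \<in> red_code S \<sigma> q ` S"
    and s: "src (level (partition_graph S \<sigma> q) 0) k = Base_vertex (Suc (2 * fibre_code S \<sigma> q y))"
  obtain x' where x': "x' \<in> S" "k = red_code S \<sigma> q x'" using k by blast
  have eq: "fibre_code S \<sigma> q (\<sigma> x') = fibre_code S \<sigma> q y" using s unfolding x'(2) partition_graph_level_0 by simp
  have "q x' \<in> q ` {z \<in> S. \<sigma> z = \<sigma> x'}" using x'(1) by blast
  then have "q x' \<in> q ` {z \<in> S. \<sigma> z = y}" unfolding conjunct2[OF fibre_code_eqD[OF eq]] .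
  then obtain x where x: "q x' = q x" "x \<in> {z \<in> S. \<sigma> z = y}" by (rule imageE)
  then have x: "x \<in> S" "\<sigma> x = y" "q x = q x'" by simp_all
  have "red_code S \<sigma> q x = k" using x eq x'(2) by (simp add: red_code_def image_code_def)
  moreover have "z = x" if "z \<in> S" "\<sigma> z = y" "red_code S \<sigma> q z = k" for z
    using that x x'(2) inj[of z x] by (simp add: red_code_def image_code_def)
  ultimately show "\<exists>!x. x \<in> S \<and> \<sigma> x = y \<and> red_code S \<sigma> q x = k" using x by blast
qed (use \<sigma>_in in auto)

end

section \<open>Inverse limits of shifts from towers of labellings\<close>

text \<open>The system \<open>X\<close>, on which every edge of \<open>H\<close> occurs as a label, serves as a dictionary that turns the
  vertices of \<open>H\<close> into labels for \<open>G\<close>. Since the defining conditions of a labelling only compare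
  labels of a point with those of its image and of the points over it, they can be checked in \<open>X\<close>
  at a point with the same labels for \<open>H\<close> and carried over to \<open>Z\<close>.\<close>

lemma labelling_transfer:
  assumes G: "generalized_finite_shift_graph G" and H: "generalized_finite_shift_graph H"
    and X: "labelling G 0 X \<sigma> a c" and X': "labelling H 0 X \<sigma> a' c'"
    and surj: "blue_edges H 0 \<subseteq> a' ` X" "red_edges H 0 \<subseteq> c' ` X"
    and Z': "labelling H 0 Z \<tau> \<alpha>' \<gamma>'"
    and eq: "\<And>z x. z \<in> Z \<Longrightarrow> x \<in> X \<Longrightarrow> rng (level H 0) (\<alpha>' z) = rng (level H 0) (a' x) \<Longrightarrow> \<alpha> z = a x \<and> \<gamma> z = c x"
  shows "labelling G 0 Z \<tau> \<alpha> \<gamma>"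
proof -
  interpret H: even_level H 0 by (rule even_level_0[OF H])
  have over: "\<exists>x\<in>X. a' x = \<alpha>' z" "\<exists>x\<in>X. c' x = \<gamma>' z" if "z \<in> Z" for z
    using labellingD(2,3)[OF Z' that] surj by (metis imageE subsetD)+
  have via_c: "\<alpha> z = a x \<and> \<gamma> z = c x" if z: "z \<in> Z" and x: "x \<in> X" and c: "\<gamma>' z = c' x" for z x
    using eq[OF z x] labellingD(4)[OF Z' z] labellingD(4)[OF X' x] c by simp
  have "src (level G 0) (\<gamma> z) = src (level G 0) (\<alpha> (\<tau> z))" if z: "z \<in> Z" for z
  proof -
    obtain x where x: "x \<in> X" "c' x = \<gamma>' z" using over(2)[OF z] by blast
    have "src (level H 0) (a' (\<sigma> x)) = src (level H 0) (\<alpha>' (\<tau> z))"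
      using labellingD(5)[OF X' x(1)] labellingD(5)[OF Z' z] x(2) by simp
    then have "a' (\<sigma> x) = \<alpha>' (\<tau> z)"
      using inj_onD[OF H.src_blue_inj] labellingD(1,2)[OF X'] labellingD(1,2)[OF Z'] x(1) z by metis
    then have "\<alpha> (\<tau> z) = a (\<sigma> x)" using eq[OF labellingD(1)[OF Z' z] labellingD(1)[OF X' x(1)]] by simp
    then show ?thesis using via_c[OF z x(1)] x(2) labellingD(5)[OF X x(1)] by simp
  qed
  moreover have "\<exists>!w. w \<in> Z \<and> \<tau> w = z \<and> \<gamma> w = k"
    if z: "z \<in> Z" and k: "k \<in> red_edges G 0" "src (level G 0) k = src (level G 0) (\<alpha> z)" for z k
  proof -
    obtain x where x: "x \<in> X" "a' x = \<alpha>' z" using over(1)[OF z] by blast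
    have ax: "\<alpha> z = a x" using eq[OF z x(1)] x(2) by simp
    obtain x1 where x1: "x1 \<in> X" "\<sigma> x1 = x" "c x1 = k" using labelling_lift[OF X x(1) k(1)] k(2) ax by metis
    have "src (level H 0) (c' x1) = src (level H 0) (\<alpha>' z)" using labellingD(5)[OF X' x1(1)] x1(2) x(2) by simp
    from labelling_lift[OF Z' z labellingD(3)[OF X' x1(1)] this]
    obtain w where w: "w \<in> Z" "\<tau> w = z" "\<gamma>' w = c' x1" .
    have "w' = w" if w': "w' \<in> Z" "\<tau> w' = z" "\<gamma> w' = k" for w'
    proof -
      have "src (level H 0) (\<gamma>' w') = src (level H 0) (a' x)" using labellingD(5)[OF Z' w'(1)] w'(2) x(2) by simp
      from labelling_lift[OF X' x(1) labellingD(3)[OF Z' w'(1)] this]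
      obtain x2 where x2: "x2 \<in> X" "\<sigma> x2 = x" "c' x2 = \<gamma>' w'" .
      have "c x2 = c x1" using via_c[OF w'(1) x2(1)] x2(3) w'(3) x1(3) by simp
      then have "x2 = x1" using labelling_inj[OF X x2(1) x1(1)] x2(2) x1(2) by simp
      then show "w' = w" using labelling_inj[OF Z' w'(1) w(1)] w'(2) w(2,3) x2(3) by simp
    qed
    then show ?thesis using w via_c[OF w(1) x1(1) w(3)] x1(3) by blast
  qed
  moreover have "\<alpha> z \<in> blue_edges G 0 \<and> \<gamma> z \<in> red_edges G 0 \<and> rng (level G 0) (\<alpha> z) = rng (level G 0) (\<gamma> z)"
    if z: "z \<in> Z" for z
  proof -
    obtain x where x: "x \<in> X" "a' x = \<alpha>' z" using over(1)[OF z] by blast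
    then show ?thesis using eq[OF z x(1)] labellingD(2,3,4)[OF X x(1)] by simp
  qed
  ultimately show ?thesis unfolding labelling_def using labellingD(1)[OF Z'] by blast
qed

text \<open>In \<open>refines\<close> the range vertex alone, and not the full blue label, is required to determine both labels
  of the earlier stages. This advance of one step per stage is what forces the limit of the shifts
  down to \<open>X\<close>.\<close>

locale labelling_tower =
  fixes X :: "'a topology" and \<sigma> :: "'a \<Rightarrow> 'a"
    and G :: "nat \<Rightarrow> ('v, 'e, 'z) shift_graph_scheme" and a c :: "nat \<Rightarrow> 'a \<Rightarrow> 'e res_edge"
  assumes LH: "LHomeo X \<sigma>"
    and gfs: "\<And>n. generalized_finite_shift_graph (G n)"
    and lab: "\<And>n. labelling (G n) 0 (topspace X) \<sigma> (a n) (c n)"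
    and lc: "\<And>n. locally_constant X (a n)" "\<And>n. locally_constant X (c n)"
    and onto: "\<And>n. blue_edges (G n) 0 \<subseteq> a n ` topspace X" "\<And>n. red_edges (G n) 0 \<subseteq> c n ` topspace X"
    and refines: "\<And>n m x y. n < m \<Longrightarrow> x \<in> topspace X \<Longrightarrow> y \<in> topspace X \<Longrightarrow>
      rng (level (G m) 0) (a m x) = rng (level (G m) 0) (a m y) \<Longrightarrow> a n x = a n y \<and> c n x = c n y"
    and separates: "\<And>x y. x \<in> topspace X \<Longrightarrow> y \<in> topspace X \<Longrightarrow> (\<And>n. a n x = a n y) \<Longrightarrow> x = y"
begin

definition rep :: "nat \<Rightarrow> ('v, 'e) res_vertex \<Rightarrow> 'a" where
  "rep m v = (SOME x. x \<in> topspace X \<and> rng (level (G m) 0) (a m x) = v)"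

text \<open>Labels for \<open>G n\<close> on the shift of \<open>G m\<close>. For \<open>n < m\<close> they are functions of the first vertex of a point;
  the canonical labels, used for \<open>n = m\<close>, are not, but they make \<open>bond m m\<close> the identity.\<close>

definition blue_tr :: "nat \<Rightarrow> nat \<Rightarrow> (nat \<Rightarrow> 'e res_edge) \<Rightarrow> 'e res_edge" where
  "blue_tr n m y = (if n < m then a n (rep m (rng (level (G m) 0) (y 0))) else y 0)"

definition red_tr :: "nat \<Rightarrow> nat \<Rightarrow> (nat \<Rightarrow> 'e res_edge) \<Rightarrow> 'e res_edge" where
  "red_tr n m y = (if n < m then c n (rep m (rng (level (G m) 0) (y 0))) else red_at y 0)"

abbreviation P :: "nat \<Rightarrow> (nat \<Rightarrow> 'e res_edge) set" where "P m \<equiv> gfs_points (G m)"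

definition bond :: "nat \<Rightarrow> nat \<Rightarrow> (nat \<Rightarrow> 'e res_edge) \<Rightarrow> (nat \<Rightarrow> 'e res_edge)" where
  "bond n m = label_point (P m) (gfs_map (G m)) (blue_tr n m) (red_tr n m)"

definition proj :: "nat \<Rightarrow> 'a \<Rightarrow> (nat \<Rightarrow> 'e res_edge)" where
  "proj n = label_point (topspace X) \<sigma> (a n) (c n)"

lemma tr_eq:
  assumes "n < m" "x \<in> topspace X" "rng (level (G m) 0) (y 0) = rng (level (G m) 0) (a m x)"
  shows "blue_tr n m y = a n x \<and> red_tr n m y = c n x"
proof -
  let ?r = "rep m (rng (level (G m) 0) (y 0))"
  have "?r \<in> topspace X \<and> rng (level (G m) 0) (a m ?r) = rng (level (G m) 0) (y 0)"
    unfolding rep_def by (rule someI[of _ x]) (use assms in simp)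
  then have "a n ?r = a n x \<and> c n ?r = c n x" using refines[OF assms(1), of ?r x] assms(2,3) by simp
  then show ?thesis using assms(1) by (simp add: blue_tr_def red_tr_def)
qed

lemma tr_self: "blue_tr m m y = y 0" "red_tr m m y = red_at y 0"
  by (simp_all add: blue_tr_def red_tr_def)

lemma tr_self_fun: "blue_tr m m = (\<lambda>y. y 0)" "red_tr m m = (\<lambda>y. red_at y 0)"
  by (simp_all add: fun_eq_iff tr_self)

lemma over: "y \<in> P m \<Longrightarrow> \<exists>x\<in>topspace X. a m x = y 0"
  using onto(1)[of m] gfs_points_blue[OF gfs, of y m 0] by (metis imageE subsetD)

lemma labelling_tr:
  assumes "n \<le> m"
  shows "labelling (G n) 0 (P m) (gfs_map (G m)) (blue_tr n m) (red_tr n m)"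
proof (cases "n = m")
  case True
  then show ?thesis using canonical_labelling[OF gfs] tr_self_fun by simp
next
  case False
  show ?thesis
    by (rule labelling_transfer[OF gfs gfs lab lab onto canonical_labelling[OF gfs]])
      (rule tr_eq, use False assms in auto)
qed

lemma locally_constant_tr: "locally_constant (gfs_space (G m)) (blue_tr n m)" "locally_constant (gfs_space (G m)) (red_tr n m)"
proof -
  note l = locally_constant_Pair[OF locally_constant_coordinate[of "G m" 0] locally_constant_red_at[OF gfs, of m 0]]
  show "locally_constant (gfs_space (G m)) (blue_tr n m)" "locally_constant (gfs_space (G m)) (red_tr n m)"
    by (rule locally_constant_determined[OF l], simp add: blue_tr_def red_tr_def)+
qed

lemma bond_morphism:
  assumes "n \<le> m"
  shows "LHomeo_morphism (gfs_space (G m)) (gfs_map (G m)) (gfs_space (G n)) (gfs_map (G n)) (bond n m)"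
proof -
  have "labelling (G n) 0 (topspace (gfs_space (G m))) (gfs_map (G m)) (blue_tr n m) (red_tr n m)"
    using labelling_tr[OF assms] by simp
  from label_point_morphism[OF gfs LHomeo_gfs[OF gfs] this locally_constant_tr]
  show ?thesis by (simp add: bond_def)
qed

lemma bond_in: "n \<le> m \<Longrightarrow> y \<in> P m \<Longrightarrow> bond n m y \<in> P n"
  unfolding bond_def by (rule label_point_in_gfs_points[OF gfs labelling_tr])

lemma bond_start: "bond n m y 0 = blue_tr n m y" "red_at (bond n m y) 0 = red_tr n m y"
proof -
  show "bond n m y 0 = blue_tr n m y" unfolding bond_def by (simp add: label_point_def label_simps)
  show "red_at (bond n m y) 0 = red_tr n m y"
    by (rule red_at_eq) (simp add: bond_def label_point_def label_simps)
qed

lemma bond_self: "y \<in> P m \<Longrightarrow> bond m m y = y"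
  using canonical_label_point[OF gfs] by (simp add: bond_def tr_self_fun)

lemma bond_comp:
  assumes "n \<le> m" "m \<le> k" "y \<in> P k"
  shows "bond n m (bond m k y) = bond n k y"
proof (cases "m = k")
  case True
  then show ?thesis using bond_self assms(3) by simp
next
  case False
  then have mk: "m < k" using assms(2) by simp
  show ?thesis
    unfolding bond_def[of n]
  proof (rule label_point_natural[OF gfs labelling_tr labelling_tr])
    fix y assume y: "y \<in> P k"
    show "bond m k y \<in> P m \<and> bond m k (gfs_map (G k) y) = gfs_map (G m) (bond m k y)"
      using bond_in[OF assms(2) y] bond_morphism[OF assms(2)] y by (simp add: LHomeo_morphism_def)
    show "blue_tr n k y = blue_tr n m (bond m k y) \<and> red_tr n k y = red_tr n m (bond m k y)"
    proof (cases "n = m")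
      case True
      then show ?thesis by (simp add: tr_self bond_start)
    next
      case n: False
      obtain x where x: "x \<in> topspace X" "a k x = y 0" using over[OF y] by blast
      have "bond m k y 0 = a m x" using tr_eq[OF mk x(1), of y] x(2) by (simp add: bond_start)
      then show ?thesis using tr_eq[of n m x "bond m k y"] tr_eq[of n k x y] x n mk assms(1) by simp
    qed
  qed (use assms in auto)
qed

lemma proj_in: "x \<in> topspace X \<Longrightarrow> proj n x \<in> P n"
  unfolding proj_def by (rule label_point_in_gfs_points[OF gfs lab])

lemma proj_morphism: "LHomeo_morphism X \<sigma> (gfs_space (G n)) (gfs_map (G n)) (proj n)"
  unfolding proj_def by (rule label_point_morphism[OF gfs LH lab lc])

lemma proj_start: "proj n x 0 = a n x" "red_at (proj n x) 0 = c n x"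
proof -
  show "proj n x 0 = a n x" unfolding proj_def by (simp add: label_point_def label_simps)
  show "red_at (proj n x) 0 = c n x"
    by (rule red_at_eq) (simp add: proj_def label_point_def label_simps)
qed

lemma bond_proj:
  assumes "n \<le> m" "x \<in> topspace X"
  shows "bond n m (proj m x) = proj n x"
  unfolding bond_def proj_def[of n]
proof (rule label_point_natural[OF gfs lab labelling_tr[OF assms(1)] _ _ assms(2)])
  fix y assume y: "y \<in> topspace X"
  show "proj m y \<in> P m \<and> proj m (\<sigma> y) = gfs_map (G m) (proj m y)"
    using proj_in[OF y] proj_morphism[of m] y by (simp add: LHomeo_morphism_def)
  show "a n y = blue_tr n m (proj m y) \<and> c n y = red_tr n m (proj m y)"
    using tr_eq[of n m y "proj m y"] y assms(1) by (cases "n = m") (simp_all add: tr_self proj_start)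
qed

text \<open>By \<open>labels_determined\<close> the range vertex at level \<open>2 * d\<close> for one stage determines both labels at
  level \<open>2 * d\<close> for the stage before, that is, its range vertex at level \<open>2 * (d + 1)\<close>. Descending from
  stage \<open>m\<close>, the first vertex of a point determines more and more of its images.\<close>

lemma vertex_determines_label:
  assumes "n + d = m" and y: "y1 \<in> P m" "y2 \<in> P m" "rng (level (G m) 0) (y1 0) = rng (level (G m) 0) (y2 0)"
  shows "rng (level (G n) (2 * d)) (blue_label (P m) (gfs_map (G m)) (blue_tr n m) (red_tr n m) d y1) =
    rng (level (G n) (2 * d)) (blue_label (P m) (gfs_map (G m)) (blue_tr n m) (red_tr n m) d y2)"
  using assms(1)
proof (induction d arbitrary: n)
  case 0
  then show ?case using y by (simp add: label_simps tr_self)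
next
  case (Suc d)
  let ?L = "\<lambda>n. blue_label (P m) (gfs_map (G m)) (blue_tr n m) (red_tr n m)"
  have n: "n < m" "Suc n \<le> m" "n \<le> m" "Suc n + d = m" using Suc.prems by auto
  have "?L n d y1 = ?L n d y2 \<and>
      red_label (P m) (gfs_map (G m)) (blue_tr n m) (red_tr n m) d y1 =
      red_label (P m) (gfs_map (G m)) (blue_tr n m) (red_tr n m) d y2"
  proof (rule labels_determined[OF gfs gfs labelling_tr[OF n(3)] labelling_tr[OF n(2)] _ y(1,2) Suc.IH[OF n(4)]])
    fix z1 z2 assume z: "z1 \<in> P m" "z2 \<in> P m"
      and eq: "rng (level (G (Suc n)) 0) (blue_tr (Suc n) m z1) = rng (level (G (Suc n)) 0) (blue_tr (Suc n) m z2)"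
    obtain x1 x2 where x: "x1 \<in> topspace X" "a m x1 = z1 0" "x2 \<in> topspace X" "a m x2 = z2 0"
      using over[OF z(1)] over[OF z(2)] by blast
    have t: "blue_tr k m z1 = a k x1 \<and> blue_tr k m z2 = a k x2" if "k \<le> m" for k
      using tr_eq[of k m x1 z1] tr_eq[of k m x2 z2] x that by (cases "k = m") (simp_all add: tr_self)
    have "red_tr n m z1 = c n x1" "red_tr n m z2 = c n x2"
      using tr_eq[OF n(1), of x1 z1] tr_eq[OF n(1), of x2 z2] x by simp_all
    then show "blue_tr n m z1 = blue_tr n m z2 \<and> red_tr n m z1 = red_tr n m z2"
      using refines[of n "Suc n" x1 x2] eq t[OF n(2)] t[OF n(3)] x(1,3) by simp
  qed
  then show ?case
    using rng_next_blue_eq_iff[OF even_level[OF gfs] labelling_iterate[OF gfs labelling_tr[OF n(3)]] y(1,2), of d]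
    by (simp add: label_simps)
qed

lemma vertex_determines_bond:
  assumes m: "m = n + Suc j" and y: "y1 \<in> P m" "y2 \<in> P m" "rng (level (G m) 0) (y1 0) = rng (level (G m) 0) (y2 0)"
  shows "bond n m y1 (2 * j) = bond n m y2 (2 * j)"
proof -
  have nm: "n \<le> m" using m by simp
  show ?thesis
    using vertex_determines_label[OF m[symmetric] y]
      rng_next_blue_eq_iff[OF even_level[OF gfs] labelling_iterate[OF gfs labelling_tr[OF nm]] y(1,2), of j]
    by (simp add: label_simps bond_def label_point_simps)
qed

lemma inverse_system: "LHomeo_inverse_system (\<lambda>n. gfs_space (G n)) (\<lambda>n. gfs_map (G n)) bond"
  unfolding LHomeo_inverse_system_def
  using LHomeo_gfs[OF gfs] bond_morphism bond_self bond_comp by simp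

lemma topspace_limit: "topspace (inverse_limit_space (\<lambda>n. gfs_space (G n)) bond) =
    {y. (\<forall>n. y n \<in> P n) \<and> (\<forall>n m. n \<le> m \<longrightarrow> bond n m (y m) = y n)}"
  unfolding inverse_limit_space_def by (auto simp: topspace_product_topology PiE_def Pi_def)

text \<open>Every vertex of a stage is the vertex of a point of \<open>X\<close>. The sets of points of \<open>X\<close> with the first
  vertex of \<open>y m\<close> therefore form a decreasing sequence of nonempty closed sets; a common point has
  the same image as \<open>y\<close> in every stage, because the vertices of later stages determine all
  coordinates.\<close>

lemma limit_point_hit:
  assumes yP: "\<And>n. y n \<in> P n" and y: "\<And>n m. n \<le> m \<Longrightarrow> bond n m (y m) = y n"
  obtains x where "x \<in> topspace X" "(\<lambda>n. proj n x) = y"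
proof -
  define F where "F m = {x \<in> topspace X. rng (level (G m) 0) (a m x) = rng (level (G m) 0) (y m 0)}" for m
  have "closedin X (F m)" for m unfolding F_def by (rule locally_constant_closedin[OF lc(1)])
  moreover have "F m \<noteq> {}" for m
  proof -
    obtain x where "x \<in> topspace X" "a m x = y m 0" using over[OF yP] by blast
    then show ?thesis unfolding F_def by auto
  qed
  moreover have "decseq F"
  proof (intro decseq_SucI subsetI)
    fix m x assume x: "x \<in> F (Suc m)"
    have "y m 0 = a m x"
      using tr_eq[of m "Suc m" x "y (Suc m)"] x y[of m "Suc m"] bond_start(1)[of m "Suc m" "y (Suc m)"]
      by (simp add: F_def)
    then show "x \<in> F m" using x by (simp add: F_def)
  qed
  ultimately have "(\<Inter>m. F m) \<noteq> {}" by (intro compact_space_imp_nest[OF LHomeoD(1)[OF LH]])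
  then obtain x where x: "\<And>m. x \<in> F m" by blast
  then have xX: "x \<in> topspace X" unfolding F_def by blast
  have "proj n x = y n" for n
  proof (rule gfs_points_eqI[OF gfs proj_in[OF xX] yP])
    fix j
    let ?m = "n + Suc j"
    have "bond n ?m (proj ?m x) (2 * j) = bond n ?m (y ?m) (2 * j)"
      by (rule vertex_determines_bond[OF refl proj_in[OF xX] yP]) (use x[of ?m] in \<open>simp add: F_def proj_start\<close>)
    then show "proj n x (2 * j) = y n (2 * j)" using bond_proj[OF _ xX, of n ?m] y[of n ?m] by simp
  qed
  then show thesis using that xX by blast
qed

lemma conjugate_limit:
  "conjugate_systems X \<sigma> (inverse_limit_space (\<lambda>n. gfs_space (G n)) bond) (inverse_limit_map (\<lambda>n. gfs_map (G n)))"
proof -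
  let ?L = "inverse_limit_space (\<lambda>n. gfs_space (G n)) bond" and ?h = "\<lambda>x n. proj n x"
  have cont: "continuous_map X (gfs_space (G n)) (proj n)" for n
    using proj_morphism by (simp add: LHomeo_morphism_def)
  have im: "?h x \<in> topspace ?L" if "x \<in> topspace X" for x
    unfolding topspace_limit using proj_in[OF that] bond_proj[OF _ that] by simp
  have "homeomorphic_map X ?L ?h"
  proof (rule continuous_imp_homeomorphic_map[OF _ LHomeoD(1)[OF LH]])
    show "continuous_map X ?L ?h"
      unfolding inverse_limit_space_def continuous_map_in_subtopology continuous_map_componentwise_UNIV
      using cont bond_proj by auto
    show "Hausdorff_space ?L"
      unfolding inverse_limit_space_def
      by (intro Hausdorff_space_subtopology) (simp add: Hausdorff_space_product_topology LHomeoD(2)[OF LHomeo_gfs[OF gfs]])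
    show "?h ` topspace X = topspace ?L"
    proof (intro equalityI subsetI)
      fix y assume "y \<in> topspace ?L"
      then have y: "\<And>n. y n \<in> P n" "\<And>n m. n \<le> m \<Longrightarrow> bond n m (y m) = y n" unfolding topspace_limit by auto
      show "y \<in> ?h ` topspace X" by (rule limit_point_hit[OF y]) auto
    qed (use im in auto)
    show "inj_on ?h (topspace X)"
    proof (rule inj_onI)
      fix x x' assume x: "x \<in> topspace X" "x' \<in> topspace X" and eq: "?h x = ?h x'"
      have "a n x = a n x'" for n using fun_cong[OF eq, of n] proj_start(1) by metis
      then show "x = x'" using separates[OF x] by blast
    qed
  qed
  moreover have "?h (\<sigma> x) = inverse_limit_map (\<lambda>n. gfs_map (G n)) (?h x)" if "x \<in> topspace X" for x
    unfolding inverse_limit_map_def using proj_morphism that by (auto simp: LHomeo_morphism_def)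
  ultimately show ?thesis unfolding conjugate_systems_def by blast
qed

end

section \<open>Refining partitions\<close>

text \<open>Each partition remembers the two labels obtained from the preceding one and membership in one more
  set, so that finally every set \<open>C n\<close> is taken into account.\<close>

primrec refinement :: "'a set \<Rightarrow> ('a \<Rightarrow> 'a) \<Rightarrow> (nat \<Rightarrow> 'a set) \<Rightarrow> ('a \<Rightarrow> nat) \<Rightarrow> nat \<Rightarrow> 'a \<Rightarrow> nat" where
  "refinement S \<sigma> C q 0 = q"
| "refinement S \<sigma> C q (Suc n) = (\<lambda>x. prod_encode (image_code S \<sigma> (refinement S \<sigma> C q n) x,
     prod_encode (fibre_code S \<sigma> (refinement S \<sigma> C q n) x, if x \<in> C n then 1 else 0)))"

lemma locally_constant_codes:
  assumes T: "LHomeo T \<sigma>" and q: "locally_constant T q"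
  shows "locally_constant T (fibre_code (topspace T) \<sigma> q)" "locally_constant T (image_code (topspace T) \<sigma> q)"
proof -
  show f: "locally_constant T (fibre_code (topspace T) \<sigma> q)"
    by (rule locally_constant_determined[OF locally_constant_Pair[OF q locally_constant_fibre_image[OF T q]]])
      (simp add: fibre_code_def)
  show "locally_constant T (image_code (topspace T) \<sigma> q)"
    by (rule locally_constant_determined[OF locally_constant_Pair[OF q locally_constant_compose[OF LHomeoD(3)[OF T] f]]])
      (simp add: image_code_def)
qed

lemma locally_constant_clopen:
  assumes "openin T C" "closedin T C"
  shows "locally_constant T (\<lambda>x. x \<in> C)"
  unfolding locally_constant_def
proof
  fix v
  have "{x \<in> topspace T. (x \<in> C) = v} = (if v then C else topspace T - C)"
    using openin_subset[OF assms(1)] by auto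
  then show "openin T {x \<in> topspace T. (x \<in> C) = v}" using assms by auto
qed

text \<open>Finitely many basic clopen sets on which \<open>\<sigma>\<close> is injective cover the space; the piece of a point
  records in which of them it lies.\<close>

lemma injective_partition:
  fixes C :: "nat \<Rightarrow> 'a set"
  assumes T: "LHomeo T \<sigma>"
    and C: "\<And>n. openin T (C n)" "\<And>n. closedin T (C n)"
      "\<And>U x. openin T U \<Longrightarrow> x \<in> U \<Longrightarrow> \<exists>n. x \<in> C n \<and> C n \<subseteq> U"
  obtains q :: "'a \<Rightarrow> nat" where "locally_constant T q"
    "\<And>x y. x \<in> topspace T \<Longrightarrow> y \<in> topspace T \<Longrightarrow> \<sigma> x = \<sigma> y \<Longrightarrow> q x = q y \<Longrightarrow> x = y"
proof -
  let ?I = "{n. inj_on \<sigma> (C n)}"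
  have "\<exists>n\<in>?I. x \<in> C n" if x: "x \<in> topspace T" for x
  proof -
    obtain U where U: "openin T U" "x \<in> U" "homeomorphic_map (subtopology T U) (subtopology T (\<sigma> ` U)) \<sigma>"
      using T x unfolding LHomeo_def local_homeomorphism_map_def by blast
    have "inj_on \<sigma> U"
      using homeomorphic_imp_injective_map[OF U(3)] openin_subset[OF U(1)] by (simp add: Int_absorb1)
    moreover obtain n where "x \<in> C n" "C n \<subseteq> U" using C(3)[OF U(1,2)] by blast
    ultimately show ?thesis using inj_on_subset by blast
  qed
  then have "(\<forall>U\<in>C ` ?I. openin T U) \<and> topspace T \<subseteq> \<Union>(C ` ?I)" using C(1) by blast
  from mp[OF spec[OF LHomeoD(1)[OF T, unfolded compact_space_alt]] this]
  obtain \<F> where \<F>: "finite \<F>" "\<F> \<subseteq> C ` ?I" "topspace T \<subseteq> \<Union>\<F>" by (elim exE conjE)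
  obtain K where K: "K \<subseteq> ?I" "finite K" "\<F> = C ` K" using finite_subset_image[OF \<F>(1,2)] by metis
  define q where "q x = set_encode {n \<in> K. x \<in> C n}" for x
  have qD: "{n \<in> K. x \<in> C n} = {n \<in> K. y \<in> C n}" if "q x = q y" for x y
    using that set_encode_eq[of "{n \<in> K. x \<in> C n}" "{n \<in> K. y \<in> C n}"] K(2) unfolding q_def by simp
  show thesis
  proof (rule that[of q])
    have lcJ: "locally_constant T (\<lambda>x. {n \<in> J. x \<in> C n})" if "finite J" for J
      using that
    proof induction
      case empty
      show ?case unfolding locally_constant_def
      proof
        fix v
        show "openin T {x \<in> topspace T. {n \<in> {}. x \<in> C n} = v}" by (cases "v = {}") simp_all
      qed
    next
      case (insert k J)
      show ?case
        by (rule locally_constant_determined[OF locally_constant_Pair[OF insert.IH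
                locally_constant_clopen[OF C(1,2), of k]]]) auto
    qed
    show "locally_constant T q"
      by (rule locally_constant_determined[OF lcJ[OF K(2)]]) (simp add: q_def)
    fix x y assume x: "x \<in> topspace T" "y \<in> topspace T" "\<sigma> x = \<sigma> y" "q x = q y"
    obtain n where n: "n \<in> K" "x \<in> C n" using \<F>(3) K(3) x(1) by blast
    then have "y \<in> C n" using qD[OF x(4)] by blast
    then show "x = y" using n K(1) x(3) by (auto dest: inj_onD)
  qed
qed

theorem theorem1p3:
  fixes X :: "'a topology" and \<sigma> :: "'a \<Rightarrow> 'a"
  assumes "topspace X \<noteq> {}"
    and "totally_disconnected_space X" and "compact_space X" and "metrizable_space X"
    and "local_homeomorphism_map X X \<sigma>" and "\<sigma> ` topspace X = topspace X"
  shows "\<exists>(G :: nat \<Rightarrow> (nat, nat) shift_graph) \<psi>.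
    (\<forall>n. generalized_finite_shift_graph (G n)) \<and>
    LHomeo_inverse_system (\<lambda>n. gfs_space (G n)) (\<lambda>n. gfs_map (G n)) \<psi> \<and>
    conjugate_systems X \<sigma>
      (inverse_limit_space (\<lambda>n. gfs_space (G n)) \<psi>)
      (inverse_limit_map (\<lambda>n. gfs_map (G n)))"
proof -
  let ?S = "topspace X"
  have LH: "LHomeo X \<sigma>" using assms by (simp add: LHomeo_def)
  obtain C :: "nat \<Rightarrow> 'a set" where C: "\<And>n. openin X (C n)" "\<And>n. closedin X (C n)"
    "\<And>U x. openin X U \<Longrightarrow> x \<in> U \<Longrightarrow> \<exists>n. x \<in> C n \<and> C n \<subseteq> U"
    using countable_clopen_basis[OF assms(2-4)] by metis
  obtain q0 :: "'a \<Rightarrow> nat" where q0: "locally_constant X q0"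
    "\<And>x y. x \<in> ?S \<Longrightarrow> y \<in> ?S \<Longrightarrow> \<sigma> x = \<sigma> y \<Longrightarrow> q0 x = q0 y \<Longrightarrow> x = y"
    using injective_partition[OF LH C] by metis
  define q where "q = refinement ?S \<sigma> C q0"
  have q_Suc: "q (Suc n) x = prod_encode (image_code ?S \<sigma> (q n) x, prod_encode (fibre_code ?S \<sigma> (q n) x, if x \<in> C n then 1 else 0))"
    for n x by (simp add: q_def)
  have lc: "locally_constant X (q n)" for n
  proof (induction n)
    case (Suc n)
    show ?case
      by (rule locally_constant_determined[OF locally_constant_Pair[OF locally_constant_Pair[OF
              locally_constant_codes[OF LH Suc]] locally_constant_clopen[OF C(1,2), of n]]])
        (simp add: q_Suc)
  qed (simp add: q_def q0)
  have fin: "finite (q n ` ?S)" for n by (rule locally_constant_finite_range[OF lc assms(3)])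
  have q_step: "image_code ?S \<sigma> (q n) x = image_code ?S \<sigma> (q n) y \<and> fibre_code ?S \<sigma> (q n) x = fibre_code ?S \<sigma> (q n) y \<and>
      (x \<in> C n \<longleftrightarrow> y \<in> C n) \<and> q n x = q n y" if "q (Suc n) x = q (Suc n) y" for n x y
    using that by (auto simp: q_Suc image_code_def split: if_splits)
  have down: "q n x = q n y" if "n \<le> m" "q m x = q m y" for n m x y
    using that
  proof (induction m rule: dec_induct)
    case (step k)
    then show ?case using q_step[of k x y] by simp
  qed
  have inj: "x = y" if "x \<in> ?S" "y \<in> ?S" "\<sigma> x = \<sigma> y" "q n x = q n y" for n x y
    using q0(2)[OF that(1-3)] down[of 0 n x y] that(4) by (simp add: q_def)
  let ?G = "\<lambda>n. partition_graph ?S \<sigma> (q n)"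
  let ?a = "\<lambda>n. blue_code ?S \<sigma> (q n)" and ?c = "\<lambda>n. red_code ?S \<sigma> (q n)"
  note lev = partition_graph_level_0[OF assms(6) fin]
  interpret labelling_tower X \<sigma> ?G ?a ?c
  proof
    fix n
    show "generalized_finite_shift_graph (?G n)" by (rule gfs_partition_graph[OF assms(6) fin])
    show "labelling (?G n) 0 ?S \<sigma> (?a n) (?c n)"
      by (rule labelling_partition_graph[OF assms(6) fin]) (rule inj)
    show "locally_constant X (?a n)"
      by (rule locally_constant_determined[OF locally_constant_codes(1)[OF LH lc[of n]]]) (simp add: blue_code_def)
    show "locally_constant X (?c n)"
      by (rule locally_constant_determined[OF locally_constant_codes(2)[OF LH lc[of n]]]) (simp add: red_code_def)
    show "blue_edges (?G n) 0 \<subseteq> ?a n ` ?S" "red_edges (?G n) 0 \<subseteq> ?c n ` ?S" by (simp_all add: lev(1,2))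
  next
    fix n m x y
    assume nm: "n < m" and eq: "rng (level (?G m) 0) (?a m x) = rng (level (?G m) 0) (?a m y)"
    have "q m x = q m y" using eq unfolding lev by simp
    then have "q (Suc n) x = q (Suc n) y" using down[of "Suc n" m x y] nm by simp
    then show "?a n x = ?a n y \<and> ?c n x = ?c n y" using q_step[of n x y] by (simp add: blue_code_def red_code_def)
  next
    fix x y assume x: "x \<in> ?S" "y \<in> ?S" and eq: "\<And>n. ?a n x = ?a n y"
    show "x = y"
    proof (rule ccontr)
      assume "x \<noteq> y"
      then obtain U where U: "openin X U" "x \<in> U" "y \<notin> U"
        using LHomeoD(2)[OF LH] x unfolding Hausdorff_space_def by (metis disjnt_iff)
      obtain n where n: "x \<in> C n" "C n \<subseteq> U" using C(3)[OF U(1,2)] by blast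
      have "q (Suc n) x = q (Suc n) y" using eq[of "Suc n"] by (simp add: blue_code_def fibre_code_def)
      then show False using q_step[of n x y] n U(3) by blast
    qed
  qed (rule LH)
  show ?thesis
    by (intro exI[of _ ?G] exI[of _ bond] conjI allI gfs inverse_system conjugate_limit)
qed

end
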